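(* If $(W_-,W_+)=(-\infty,+\infty)$, then the space $(L^2(M,\mathbb{R})\setminus\{0\},\tilde G)$ is metrically complete and geodesically complete. The subset $(C^\infty(M,\mathbb{R})\setminus\{0\},\tilde G)$ is geodesically complete.
   Context: $M$ is a smooth compact manifold (possibly with boundary or corners) of dimension at least $1$, and $\mu_0$ is a fixed smooth positive density on $M$ with $\int_M\mu_0=1$. $\langle f,h\rangle=\int_M fh\,\mu_0$ and $\|f\|^2=\langle f,f\rangle$ denote the $L^2(\mu_0)$ inner product and norm. $C_1,C_2:(0,\infty)\to\mathbb{R}$ are smooth with $C_1(m)>0$ and $C_2(m)>-\frac1mC_1(m)$ for all $m>0$. The Riemannian metric $\tilde G$ on $L^2(M,\mathbb{R})\setminus\{0\}$ (and by restriction on $C^\infty(M,\mathbb{R})\setminus\{0\}$) is $$\tilde G_f(h,k)=4C_1(\|f\|^2)\langle h,k\rangle+4C_2(\|f\|^2)\langle f,h\rangle\langle f,k\rangle .$$ Put $g_2(r)=4(C_1(r^2)+C_2(r^2)r^2)$, $W(r)=\int_1^r\sqrt{g_2(\rho)}\,d\rho$, $W_-=\lim_{r\to0+}W(r)$, $W_+=\lim_{r\to\infty}W(r)$. Metrically complete means complete for the geodesic distance (infimum of lengths of paths); geodesically complete means that every geodesic extends to all times in $\mathbb{R}$ within the given space. *)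

theory Defs
  imports "HOL-Analysis.Analysis"
begin

section \<open>Smooth maps\<close>

text \<open>
  \<open>Ck_on k f S\<close> is meant for open sets \<open>S\<close> of a Euclidean space: \<open>f\<close> is \<open>k\<close> times
  continuously differentiable on \<open>S\<close>, via iterated directional derivatives.
\<close>

primrec Ck_on :: "nat \<Rightarrow> ('a::euclidean_space \<Rightarrow> 'b::real_normed_vector) \<Rightarrow> 'a set \<Rightarrow> bool" where
  "Ck_on 0 f S \<longleftrightarrow> continuous_on S f"
| "Ck_on (Suc k) f S \<longleftrightarrow>
     (\<forall>x\<in>S. f differentiable (at x)) \<and>
     (\<forall>v. Ck_on k (\<lambda>x. frechet_derivative f (at x) v) S)"

text \<open>
  On an arbitrary set, smoothness means that \<open>f\<close> extends, locally around every point, to a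
  smooth map on an open set (this is what is needed at boundary and corner points).
\<close>

definition smooth_on :: "('a::euclidean_space \<Rightarrow> 'b::real_normed_vector) \<Rightarrow> 'a set \<Rightarrow> bool" where
  "smooth_on f S \<longleftrightarrow>
     (\<forall>x\<in>S. \<exists>V F. open V \<and> x \<in> V \<and> (\<forall>k. Ck_on k F V) \<and> (\<forall>y\<in>S \<inter> V. F y = f y))"

section \<open>Manifolds with corners, smooth functions and densities\<close>

text \<open>
  The manifold is the whole type \<open>'m\<close> (Hausdorff and second countable by its type class).
  Charts take values in the closed quadrant, which covers the cases without boundary, with
  boundary and with corners.  The dimension is \<open>DIM('e)\<close>, which is at least 1 in every
  Euclidean space type.
\<close>

type_synonym ('m, 'e) chart = "'m set \<times> ('m \<Rightarrow> 'e)"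

definition quadrant :: "'e::euclidean_space set" where
  "quadrant = {y. \<forall>b\<in>Basis. 0 \<le> y \<bullet> b}"

definition corner_chart ::
    "('m::topological_space, 'e::euclidean_space) chart \<Rightarrow> bool" where
  "corner_chart = (\<lambda>(U, \<phi>). open U \<and>
     openin (top_of_set quadrant) (\<phi> ` U) \<and> homeomorphism U (\<phi> ` U) \<phi> (inv_into U \<phi>))"

definition smooth_corner_atlas ::
    "('m::topological_space, 'e::euclidean_space) chart set \<Rightarrow> bool" where
  "smooth_corner_atlas \<A> \<longleftrightarrow>
     (\<forall>c\<in>\<A>. corner_chart c) \<and>
     (\<Union>(U, \<phi>)\<in>\<A>. U) = UNIV \<and>
     (\<forall>(U, \<phi>)\<in>\<A>. \<forall>(V, \<psi>)\<in>\<A>. smooth_on (\<psi> \<circ> inv_into U \<phi>) (\<phi> ` (U \<inter> V)))"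

definition smooth_functions ::
    "('m, 'e::euclidean_space) chart set \<Rightarrow> ('m \<Rightarrow> real) set" where
  "smooth_functions \<A> =
     {f. \<forall>(U, \<phi>)\<in>\<A>. smooth_on (\<lambda>y. f (inv_into U \<phi> y)) (\<phi> ` U)}"

definition smooth_positive_density ::
    "('m::topological_space, 'e::euclidean_space) chart set \<Rightarrow> 'm measure \<Rightarrow> bool" where
  "smooth_positive_density \<A> \<mu> \<longleftrightarrow>
     sets \<mu> = sets borel \<and>
     (\<forall>(U, \<phi>)\<in>\<A>. \<exists>\<rho>. smooth_on \<rho> (\<phi> ` U) \<and> (\<forall>y\<in>\<phi> ` U. 0 < \<rho> y) \<and>
        (\<forall>B\<in>sets borel. B \<subseteq> U \<longrightarrow>
           emeasure \<mu> B = (\<integral>\<^sup>+y. ennreal (\<rho> y) * indicator (\<phi> ` B) y \<partial>lborel)))"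

section \<open>The space of square integrable functions\<close>

text \<open>
  Elements of the Hilbert space are handled through representatives in \<open>L2_functions \<mu>\<close>;
  \<open>L2_class\<close> is the almost-everywhere equivalence class of a representative.
\<close>

definition L2_functions :: "'m measure \<Rightarrow> ('m \<Rightarrow> real) set" where
  "L2_functions \<mu> = {f \<in> borel_measurable \<mu>. integrable \<mu> (\<lambda>x. (f x)\<^sup>2)}"

definition L2_inner :: "'m measure \<Rightarrow> ('m \<Rightarrow> real) \<Rightarrow> ('m \<Rightarrow> real) \<Rightarrow> real" where
  "L2_inner \<mu> f h = (\<integral>x. f x * h x \<partial>\<mu>)"

definition L2_norm :: "'m measure \<Rightarrow> ('m \<Rightarrow> real) \<Rightarrow> real" where
  "L2_norm \<mu> f = sqrt (L2_inner \<mu> f f)"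

definition L2_class :: "'m measure \<Rightarrow> ('m \<Rightarrow> real) \<Rightarrow> ('m \<Rightarrow> real) set" where
  "L2_class \<mu> f = {g \<in> L2_functions \<mu>. AE x in \<mu>. g x = f x}"

definition L2_nonzero_functions :: "'m measure \<Rightarrow> ('m \<Rightarrow> real) set" where
  "L2_nonzero_functions \<mu> = {f \<in> L2_functions \<mu>. \<not> (AE x in \<mu>. f x = 0)}"

definition L2_nonzero :: "'m measure \<Rightarrow> ('m \<Rightarrow> real) set set" where
  "L2_nonzero \<mu> = L2_class \<mu> ` L2_nonzero_functions \<mu>"

definition has_L2_derivative ::
    "'m measure \<Rightarrow> (real \<Rightarrow> 'm \<Rightarrow> real) \<Rightarrow> ('m \<Rightarrow> real) \<Rightarrow> real \<Rightarrow> real set \<Rightarrow> bool" where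
  "has_L2_derivative \<mu> c v t S \<longleftrightarrow>
     ((\<lambda>s. L2_norm \<mu> (\<lambda>x. (c s x - c t x) / (s - t) - v x)) \<longlongrightarrow> 0) (at t within S)"

section \<open>The Riemannian metric\<close>

definition metric_G ::
    "'m measure \<Rightarrow> (real \<Rightarrow> real) \<Rightarrow> (real \<Rightarrow> real) \<Rightarrow>
     ('m \<Rightarrow> real) \<Rightarrow> ('m \<Rightarrow> real) \<Rightarrow> ('m \<Rightarrow> real) \<Rightarrow> real" where
  "metric_G \<mu> C1 C2 f h k =
     4 * C1 ((L2_norm \<mu> f)\<^sup>2) * L2_inner \<mu> h k
     + 4 * C2 ((L2_norm \<mu> f)\<^sup>2) * L2_inner \<mu> f h * L2_inner \<mu> f k"

definition g2 :: "(real \<Rightarrow> real) \<Rightarrow> (real \<Rightarrow> real) \<Rightarrow> real \<Rightarrow> real" where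
  "g2 C1 C2 r = 4 * (C1 (r\<^sup>2) + C2 (r\<^sup>2) * r\<^sup>2)"

text \<open>An oriented integral: it is negative for \<open>r < 1\<close>.\<close>

definition W :: "(real \<Rightarrow> real) \<Rightarrow> (real \<Rightarrow> real) \<Rightarrow> real \<Rightarrow> real" where
  "W C1 C2 r = interval_lebesgue_integral lborel (ereal 1) (ereal r) (\<lambda>\<rho>. sqrt (g2 C1 C2 \<rho>))"

section \<open>Geodesic distance\<close>

text \<open>\<open>C\<^sup>1\<close> paths in the space of nonzero elements, with velocity field \<open>v\<close>.\<close>

definition L2_C1_path ::
    "'m measure \<Rightarrow> (real \<Rightarrow> 'm \<Rightarrow> real) \<Rightarrow> (real \<Rightarrow> 'm \<Rightarrow> real) \<Rightarrow> bool" where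
  "L2_C1_path \<mu> c v \<longleftrightarrow>
     (\<forall>t\<in>{0..1}. c t \<in> L2_nonzero_functions \<mu> \<and> v t \<in> L2_functions \<mu> \<and>
        has_L2_derivative \<mu> c (v t) t {0..1} \<and>
        ((\<lambda>s. L2_norm \<mu> (\<lambda>x. v s x - v t x)) \<longlongrightarrow> 0) (at t within {0..1}))"

definition path_length ::
    "(('m \<Rightarrow> real) \<Rightarrow> ('m \<Rightarrow> real) \<Rightarrow> ('m \<Rightarrow> real) \<Rightarrow> real) \<Rightarrow>
     (real \<Rightarrow> 'm \<Rightarrow> real) \<Rightarrow> (real \<Rightarrow> 'm \<Rightarrow> real) \<Rightarrow> real" where
  "path_length G c v = integral {0..1} (\<lambda>t. sqrt (G (c t) (v t) (v t)))"

text \<open>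
  The distance of two classes.  The value 0 outside \<open>L2_nonzero \<mu>\<close> is a dummy, there because
  the locale \<open>Metric_space\<close> demands nonnegativity and symmetry on the whole type.
\<close>

definition geodesic_dist ::
    "'m measure \<Rightarrow> (('m \<Rightarrow> real) \<Rightarrow> ('m \<Rightarrow> real) \<Rightarrow> ('m \<Rightarrow> real) \<Rightarrow> real) \<Rightarrow>
     ('m \<Rightarrow> real) set \<Rightarrow> ('m \<Rightarrow> real) set \<Rightarrow> real" where
  "geodesic_dist \<mu> G P Q =
     (if P \<in> L2_nonzero \<mu> \<and> Q \<in> L2_nonzero \<mu>
      then Inf {path_length G c v | c v. L2_C1_path \<mu> c v \<and> c 0 \<in> P \<and> c 1 \<in> Q}
      else 0)"

section \<open>Geodesics\<close>

text \<open>
  The geodesic equation at time \<open>t\<close> of a curve \<open>c\<close> with velocity \<open>v\<close>, in a space whose tangent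
  space is \<open>T\<close>: for every constant tangent vector \<open>k\<close>,
  \<open>d/dt G\<^bsub>c\<^esub>(v, k) = 1/2 (D\<^bsub>c,k\<^esub> G)(v, v)\<close>.  This is the Euler-Lagrange equation of the energy
  \<open>1/2 \<integral> G\<^bsub>c\<^esub>(v, v) dt\<close>, i.e. vanishing covariant acceleration; it makes sense for weak
  Riemannian metrics as well.
\<close>

definition geodesic_equation_at ::
    "(('m \<Rightarrow> real) \<Rightarrow> ('m \<Rightarrow> real) \<Rightarrow> ('m \<Rightarrow> real) \<Rightarrow> real) \<Rightarrow> ('m \<Rightarrow> real) set \<Rightarrow>
     (real \<Rightarrow> 'm \<Rightarrow> real) \<Rightarrow> (real \<Rightarrow> 'm \<Rightarrow> real) \<Rightarrow> real \<Rightarrow> bool" where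
  "geodesic_equation_at G T c v t \<longleftrightarrow>
     (\<forall>k\<in>T. \<exists>q.
        ((\<lambda>\<epsilon>. G (\<lambda>x. c t x + \<epsilon> * k x) (v t) (v t)) has_real_derivative q) (at 0) \<and>
        ((\<lambda>s. G (c s) (v s) k) has_real_derivative (q / 2)) (at t))"

text \<open>
  Geodesics on an open interval \<open>I\<close> are smooth curves solving the geodesic equation.  In \<open>L\<^sup>2\<close>,
  smoothness is given by the sequence \<open>D\<close> of successive derivatives.
\<close>

definition L2_geodesic ::
    "'m measure \<Rightarrow> (('m \<Rightarrow> real) \<Rightarrow> ('m \<Rightarrow> real) \<Rightarrow> ('m \<Rightarrow> real) \<Rightarrow> real) \<Rightarrow>
     real set \<Rightarrow> (real \<Rightarrow> 'm \<Rightarrow> real) \<Rightarrow> bool" where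
  "L2_geodesic \<mu> G I c \<longleftrightarrow>
     (\<forall>t\<in>I. c t \<in> L2_nonzero_functions \<mu>) \<and>
     (\<exists>D. D 0 = c \<and>
        (\<forall>n. \<forall>t\<in>I. D n t \<in> L2_functions \<mu> \<and> has_L2_derivative \<mu> (D n) (D (Suc n) t) t I) \<and>
        (\<forall>t\<in>I. geodesic_equation_at G (L2_functions \<mu>) c (D 1) t))"

text \<open>
  A curve in the Frechet space of smooth functions is smooth iff it is jointly smooth in time
  and space; its velocity is then the pointwise time derivative.
\<close>

definition smooth_curve ::
    "('m, 'e::euclidean_space) chart set \<Rightarrow> real set \<Rightarrow> (real \<Rightarrow> 'm \<Rightarrow> real) \<Rightarrow> bool" where
  "smooth_curve \<A> I c \<longleftrightarrow>
     (\<forall>(U, \<phi>)\<in>\<A>. smooth_on (\<lambda>(t, y). c t (inv_into U \<phi> y)) (I \<times> \<phi> ` U))"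

definition smooth_geodesic ::
    "('m, 'e::euclidean_space) chart set \<Rightarrow>
     (('m \<Rightarrow> real) \<Rightarrow> ('m \<Rightarrow> real) \<Rightarrow> ('m \<Rightarrow> real) \<Rightarrow> real) \<Rightarrow>
     real set \<Rightarrow> (real \<Rightarrow> 'm \<Rightarrow> real) \<Rightarrow> bool" where
  "smooth_geodesic \<A> G I c \<longleftrightarrow>
     (\<forall>t\<in>I. c t \<in> smooth_functions \<A> - {\<lambda>x. 0}) \<and>
     smooth_curve \<A> I c \<and>
     (\<forall>t\<in>I. geodesic_equation_at G (smooth_functions \<A>) c (\<lambda>s x. deriv (\<lambda>\<tau>. c \<tau> x) s) t)"

definition L2_geodesically_complete ::
    "'m measure \<Rightarrow> (('m \<Rightarrow> real) \<Rightarrow> ('m \<Rightarrow> real) \<Rightarrow> ('m \<Rightarrow> real) \<Rightarrow> real) \<Rightarrow> bool" where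
  "L2_geodesically_complete \<mu> G \<longleftrightarrow>
     (\<forall>I c. open I \<and> is_interval I \<and> I \<noteq> {} \<and> L2_geodesic \<mu> G I c \<longrightarrow>
        (\<exists>c'. L2_geodesic \<mu> G UNIV c' \<and> (\<forall>t\<in>I. AE x in \<mu>. c' t x = c t x)))"

definition smooth_geodesically_complete ::
    "('m, 'e::euclidean_space) chart set \<Rightarrow>
     (('m \<Rightarrow> real) \<Rightarrow> ('m \<Rightarrow> real) \<Rightarrow> ('m \<Rightarrow> real) \<Rightarrow> real) \<Rightarrow> bool" where
  "smooth_geodesically_complete \<A> G \<longleftrightarrow>
     (\<forall>I c. open I \<and> is_interval I \<and> I \<noteq> {} \<and> smooth_geodesic \<A> G I c \<longrightarrow>
        (\<exists>c'. smooth_geodesic \<A> G UNIV c' \<and> (\<forall>t\<in>I. c' t = c t)))"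

end

theory Submission
  imports Defs
begin

text \<open>
  The metric is rotation invariant: on \<open>L\<^sup>2 \<setminus> {0}\<close>, written as radius times unit sphere, it is
  \<open>g2 (r) dr\<^sup>2 + 4 r\<^sup>2 C1 (r\<^sup>2) d\<theta>\<^sup>2\<close>, and \<open>s = W (r)\<close> is the arc length in the radial direction. The
  hypothesis says that \<open>W\<close> maps the positive half line onto the real line, so both the origin and
  infinity are infinitely far away.

  Metric completeness. The length of a path bounds the variation of \<open>W\<close> of the norm along it
  (\<open>W_variation_le_length\<close>). Hence paths of bounded length from a given point stay in a spherical
  shell \<open>a \<le> \<parallel>f\<parallel> \<le> b\<close> with \<open>a > 0\<close>, on which the metric is comparable to the constant one
  (\<open>displacement_bound\<close>). A Cauchy sequence for the geodesic distance is therefore Cauchy in \<open>L\<^sup>2\<close>; its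
  \<open>L\<^sup>2\<close> limit is nonzero and, by comparison along segments (\<open>gdist_upper\<close>), also its limit for the
  geodesic distance. The triangle inequality needs the joining of \<open>C\<^sup>1\<close> paths (\<open>path_concat\<close>), and
  finiteness of the distance needs \<open>L\<^sup>2\<close> to be at least two-dimensional.

  Geodesic completeness. A geodesic stays in a plane, and angular momentum and energy are conserved.
  With \<open>J = (C1 r\<^sup>2 \<theta>')\<^sup>2\<close> the energy is \<open>s'\<^sup>2 + 4 J / (r\<^sup>2 C1)\<close>: a particle on the line in a nonnegative
  potential. Its velocity is bounded, so Newton's equation has a solution for all times
  (\<open>Newton_global\<close>), and since \<open>W\<close> is onto, every value of \<open>s\<close> corresponds to a radius \<open>r > 0\<close>. The
  angle then follows by one integration, which gives a global geodesic with arbitrary initial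
  position and velocity (\<open>motion_exists\<close>). By uniqueness (\<open>motion_unique\<close>) it extends the given one.
  As the extension is a combination, with coefficients depending smoothly on time, of two fixed
  vectors in the span of the initial position and velocity, it consists of smooth functions if the
  given geodesic does. Both cases are treated at once, with the space \<open>T\<close> of admissible positions,
  velocities and test vectors as a parameter.
\<close>

section \<open>Calculus of smooth functions\<close>

lemma Ck_on_cong:
  assumes "open S" and "\<And>x. x \<in> S \<Longrightarrow> f x = g x"
  shows "Ck_on k f S \<longleftrightarrow> Ck_on k g S"
proof -
  have imp: "Ck_on k g S" if "Ck_on k f S" "\<And>x. x \<in> S \<Longrightarrow> f x = g x" for f g
    using that
  proof (induction k arbitrary: f g)
    case 0
    then show ?case by (simp cong: continuous_on_cong)
  next
    case (Suc k)
    have fr: "frechet_derivative f (at x) = frechet_derivative g (at x)" if "x \<in> S" for x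
      using Suc.prems that by (intro frechet_derivative_transform_within_open[OF _ \<open>open S\<close>]) auto
    have "g differentiable (at x)" if "x \<in> S" for x
      using Suc.prems that \<open>open S\<close>
      by (metis Ck_on.simps(2) differentiable_def has_derivative_transform_within_open)
    moreover have "Ck_on k (\<lambda>x. frechet_derivative g (at x) v) S" for v
      by (rule Suc.IH[of "\<lambda>x. frechet_derivative f (at x) v"]) (use Suc.prems fr in auto)
    ultimately show ?case by simp
  qed
  show ?thesis using imp[of f g] imp[of g f] assms(2) by auto
qed

lemma Ck_on_SucI:
  assumes "open S" "\<And>x. x \<in> S \<Longrightarrow> (f has_derivative f' x) (at x)"
    and "\<And>v. Ck_on k (\<lambda>x. f' x v) S"
  shows "Ck_on (Suc k) f S"
proof -
  have "frechet_derivative f (at x) = f' x" if "x \<in> S" for x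
    using frechet_derivative_at[OF assms(2)[OF that]] by simp
  then have "Ck_on k (\<lambda>x. frechet_derivative f (at x) v) S" for v
    using assms(3)[of v] Ck_on_cong[OF assms(1), of "\<lambda>x. frechet_derivative f (at x) v" "\<lambda>x. f' x v"]
    by auto
  then show ?thesis using assms(2) by (auto simp: differentiable_def)
qed

lemma Ck_on_SucD: "Ck_on (Suc k) f S \<Longrightarrow> Ck_on k f S"
proof (induction k arbitrary: f)
  case 0
  then show ?case
    by (auto intro!: continuous_at_imp_continuous_on differentiable_imp_continuous_within)
next
  case (Suc k)
  then show ?case by (metis Ck_on.simps(2))
qed

lemma Ck_on_subset: "Ck_on k f S \<Longrightarrow> T \<subseteq> S \<Longrightarrow> Ck_on k f T"
  by (induction k arbitrary: f) (auto intro: continuous_on_subset)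

lemma Ck_on_local:
  assumes "\<And>x. x \<in> S \<Longrightarrow> \<exists>V. open V \<and> x \<in> V \<and> Ck_on k f V"
  shows "Ck_on k f S"
  using assms
proof (induction k arbitrary: f)
  case 0
  then have "continuous (at x) f" if "x \<in> S" for x
    using that 0 by (metis Ck_on.simps(1) continuous_on_eq_continuous_at)
  then show ?case by (simp add: continuous_at_imp_continuous_on)
next
  case (Suc k)
  have "Ck_on k (\<lambda>x. frechet_derivative f (at x) v) S" for v
    by (rule Suc.IH) (use Suc.prems in fastforce)
  then show ?case using Suc.prems by fastforce
qed

lemma Ck_on_const: "Ck_on k (\<lambda>x. c) S"
  by (induction k arbitrary: c) auto

lemma Ck_on_add:
  assumes "open S"
  shows "Ck_on k f S \<Longrightarrow> Ck_on k g S \<Longrightarrow> Ck_on k (\<lambda>x. f x + g x) S"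
proof (induction k arbitrary: f g)
  case 0
  then show ?case by (auto intro: continuous_intros)
next
  case (Suc k)
  show ?case
  proof (rule Ck_on_SucI[OF assms])
    show "((\<lambda>x. f x + g x) has_derivative
        (\<lambda>v. frechet_derivative f (at x) v + frechet_derivative g (at x) v)) (at x)" if "x \<in> S" for x
      using Suc.prems that by (auto intro!: has_derivative_add simp: frechet_derivative_works[symmetric])
    show "Ck_on k (\<lambda>x. frechet_derivative f (at x) v + frechet_derivative g (at x) v) S" for v
      using Suc by simp
  qed
qed

lemma Ck_on_mult:
  fixes f g :: "'a::euclidean_space \<Rightarrow> real"
  assumes "open S"
  shows "Ck_on k f S \<Longrightarrow> Ck_on k g S \<Longrightarrow> Ck_on k (\<lambda>x. f x * g x) S"
proof (induction k arbitrary: f g)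
  case 0
  then show ?case by (auto intro: continuous_intros)
next
  case (Suc k)
  show ?case
  proof (rule Ck_on_SucI[OF assms])
    show "((\<lambda>x. f x * g x) has_derivative
        (\<lambda>v. f x * frechet_derivative g (at x) v + frechet_derivative f (at x) v * g x)) (at x)"
      if "x \<in> S" for x
      using Suc.prems that by (auto intro!: has_derivative_mult simp: frechet_derivative_works[symmetric])
    show "Ck_on k (\<lambda>x. f x * frechet_derivative g (at x) v + frechet_derivative f (at x) v * g x) S" for v
      using Suc.prems by (intro Ck_on_add assms Suc.IH Ck_on_SucD[OF Suc.prems(1)]
          Ck_on_SucD[OF Suc.prems(2)]) auto
  qed
qed

lemma Ck_on_realI:
  fixes f :: "real \<Rightarrow> real"
  assumes "open S" "\<And>x. x \<in> S \<Longrightarrow> (f has_real_derivative f' x) (at x)" "Ck_on k f' S"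
  shows "Ck_on (Suc k) f S"
proof (rule Ck_on_SucI[OF assms(1)])
  show "(f has_derivative (\<lambda>v. f' x * v)) (at x)" if "x \<in> S" for x
    using assms(2)[OF that] by (simp add: has_field_derivative_def)
  show "Ck_on k (\<lambda>x. f' x * v) S" for v
    by (intro Ck_on_mult Ck_on_const assms(1,3))
qed

lemma Ck_on_realD:
  fixes f :: "real \<Rightarrow> real"
  assumes "open S" "Ck_on (Suc k) f S"
  shows "\<And>x. x \<in> S \<Longrightarrow> (f has_real_derivative deriv f x) (at x)" and "Ck_on k (deriv f) S"
proof -
  show D: "(f has_real_derivative deriv f x) (at x)" if "x \<in> S" for x
    using assms that by (simp add: DERIV_deriv_iff_real_differentiable)
  have "frechet_derivative f (at x) 1 = deriv f x" if "x \<in> S" for x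
    using frechet_derivative_at[OF D[OF that, unfolded has_field_derivative_def]]
    by (metis mult.right_neutral)
  moreover have "Ck_on k (\<lambda>x. frechet_derivative f (at x) 1) S"
    using assms by simp
  ultimately show "Ck_on k (deriv f) S"
    using Ck_on_cong[OF assms(1), of "\<lambda>x. frechet_derivative f (at x) 1" "deriv f" k] by simp
qed

lemma Ck_on_compose:
  fixes f :: "real \<Rightarrow> real" and g :: "'a::euclidean_space \<Rightarrow> real"
  assumes "open S" "open T" "g ` S \<subseteq> T"
  shows "Ck_on k f T \<Longrightarrow> Ck_on k g S \<Longrightarrow> Ck_on k (\<lambda>x. f (g x)) S"
proof (induction k arbitrary: f)
  case 0
  then show ?case using continuous_on_compose2[of T f S g] assms(3) by simp
next
  case (Suc k)
  show ?case
  proof (rule Ck_on_SucI[OF assms(1)])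
    show "((\<lambda>x. f (g x)) has_derivative
        (\<lambda>v. deriv f (g x) * frechet_derivative g (at x) v)) (at x)" if "x \<in> S" for x
    proof -
      have g: "(g has_derivative frechet_derivative g (at x)) (at x)"
        using Suc.prems that by (simp add: frechet_derivative_works[symmetric])
      have f: "(f has_real_derivative deriv f (g x)) (at (g x))"
        using Ck_on_realD(1)[OF assms(2) Suc.prems(1)] assms(3) that by blast
      show ?thesis
        using has_derivative_compose[OF g f[unfolded has_field_derivative_def]] .
    qed
    have "Ck_on k (\<lambda>x. deriv f (g x)) S"
      by (rule Suc.IH[OF Ck_on_realD(2)[OF assms(2) Suc.prems(1)] Ck_on_SucD[OF Suc.prems(2)]])
    moreover have "Ck_on k (\<lambda>x. frechet_derivative g (at x) v) S" for v
      using Suc.prems(2) by simp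
    ultimately show "Ck_on k (\<lambda>x. deriv f (g x) * frechet_derivative g (at x) v) S" for v
      by (rule Ck_on_mult[OF assms(1)])
  qed
qed

lemma Ck_on_affine:
  fixes L :: "'a::euclidean_space \<Rightarrow> 'b::euclidean_space"
  assumes "bounded_linear L" "open V"
  shows "Ck_on k F V \<Longrightarrow> Ck_on k (\<lambda>x. F (L x + d)) ((\<lambda>x. L x + d) -` V)"
proof (induction k arbitrary: F)
  case 0
  interpret bounded_linear L by fact
  have "continuous_on ((\<lambda>x. L x + d) -` V) (\<lambda>x. L x + d)"
    by (intro continuous_intros continuous_on)
  with 0 show ?case by (auto intro: continuous_on_compose2[of V F])
next
  case (Suc k)
  interpret bounded_linear L by fact
  have "continuous_on UNIV (\<lambda>x. L x + d)" by (intro continuous_intros continuous_on)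
  then have op: "open ((\<lambda>x. L x + d) -` V)"
    using assms(2) by (simp add: open_vimage)
  show ?case
  proof (rule Ck_on_SucI[OF op])
    show "((\<lambda>x. F (L x + d)) has_derivative (\<lambda>v. frechet_derivative F (at (L x + d)) (L v))) (at x)"
      if "x \<in> (\<lambda>x. L x + d) -` V" for x
    proof -
      have "((\<lambda>x. L x + d) has_derivative L) (at x)"
        by (auto intro!: derivative_eq_intros has_derivative)
      moreover have "(F has_derivative frechet_derivative F (at (L x + d))) (at (L x + d))"
        using Suc.prems that by (simp add: frechet_derivative_works[symmetric])
      ultimately show ?thesis
        by (rule has_derivative_compose)
    qed
    show "Ck_on k (\<lambda>x. frechet_derivative F (at (L x + d)) (L v)) ((\<lambda>x. L x + d) -` V)" for v
      by (rule Suc.IH[of "\<lambda>y. frechet_derivative F (at y) (L v)"]) (use Suc.prems in simp)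
  qed
qed

definition C_infty :: "('a::euclidean_space \<Rightarrow> 'b::real_normed_vector) \<Rightarrow> 'a set \<Rightarrow> bool" where
  "C_infty f S \<longleftrightarrow> (\<forall>k. Ck_on k f S)"

text \<open>A function whose derivative is an expression in the function itself is smooth as soon as
  that expression preserves every order of differentiability.\<close>

lemma C_infty_bootstrap:
  fixes f :: "real \<Rightarrow> real"
  assumes "open S" "\<And>x. x \<in> S \<Longrightarrow> (f has_real_derivative f' x) (at x)"
    and "\<And>k. Ck_on k f S \<Longrightarrow> Ck_on k f' S"
  shows "C_infty f S"
proof -
  have "Ck_on k f S" for k
  proof (induction k)
    case 0
    then show ?case
      by (metis Ck_on.simps(1) DERIV_isCont assms(2) continuous_at_imp_continuous_on)
  next
    case (Suc k)
    show ?case by (rule Ck_on_realI[OF assms(1,2) assms(3)[OF Suc]])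
  qed
  then show ?thesis by (simp add: C_infty_def)
qed

lemma C_infty_const: "C_infty (\<lambda>x. c) S"
  by (simp add: C_infty_def Ck_on_const)

lemma C_infty_ident: "open S \<Longrightarrow> C_infty (\<lambda>x::real. x) S"
  by (rule C_infty_bootstrap[where f' = "\<lambda>x. 1"]) (auto intro: Ck_on_const)

lemma C_infty_add: "open S \<Longrightarrow> C_infty f S \<Longrightarrow> C_infty g S \<Longrightarrow> C_infty (\<lambda>x. f x + g x) S"
  by (simp add: C_infty_def Ck_on_add)

lemma C_infty_mult:
  fixes f g :: "'a::euclidean_space \<Rightarrow> real"
  shows "open S \<Longrightarrow> C_infty f S \<Longrightarrow> C_infty g S \<Longrightarrow> C_infty (\<lambda>x. f x * g x) S"
  by (simp add: C_infty_def Ck_on_mult)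

lemma C_infty_compose:
  fixes f :: "real \<Rightarrow> real" and g :: "'a::euclidean_space \<Rightarrow> real"
  assumes "C_infty f T" "C_infty g S" "open S" "open T" "g ` S \<subseteq> T"
  shows "C_infty (\<lambda>x. f (g x)) S"
  unfolding C_infty_def
proof
  show "Ck_on k (\<lambda>x. f (g x)) S" for k
    by (rule Ck_on_compose[OF assms(3-5)]) (use assms(1,2) in \<open>simp_all add: C_infty_def\<close>)
qed

lemma C_infty_deriv:
  fixes f :: "real \<Rightarrow> real"
  assumes "C_infty f S" "open S"
  shows "\<And>x. x \<in> S \<Longrightarrow> (f has_real_derivative deriv f x) (at x)" and "C_infty (deriv f) S"
proof -
  have "Ck_on (Suc k) f S" for k using assms(1) unfolding C_infty_def by blast
  then show "\<And>x. x \<in> S \<Longrightarrow> (f has_real_derivative deriv f x) (at x)" "C_infty (deriv f) S"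
    using Ck_on_realD[OF assms(2)] unfolding C_infty_def by blast+
qed

lemma C_infty_derivI:
  fixes f :: "real \<Rightarrow> real"
  assumes "open S" "\<And>x. x \<in> S \<Longrightarrow> (f has_real_derivative f' x) (at x)" "C_infty f' S"
  shows "C_infty f S"
  using assms by (intro C_infty_bootstrap[where f' = f']) (auto simp: C_infty_def)

lemma C_infty_continuous: "C_infty f S \<Longrightarrow> continuous_on S f"
  by (metis C_infty_def Ck_on.simps(1))

lemma C_infty_inverse: "C_infty (inverse :: real \<Rightarrow> real) {0<..}"
proof (rule C_infty_bootstrap)
  show "(inverse has_real_derivative (- 1) * (inverse x * inverse x)) (at x)" if "x \<in> {0<..}" for x :: real
    using that by (auto intro!: derivative_eq_intros simp: power2_eq_square)
  show "Ck_on k (\<lambda>x::real. (- 1) * (inverse x * inverse x)) {0<..}" if "Ck_on k inverse {0::real<..}" for k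
    by (intro Ck_on_mult Ck_on_const that) auto
qed auto

lemma C_infty_sqrt: "C_infty sqrt {0<..}"
proof (rule C_infty_bootstrap)
  show "(sqrt has_real_derivative inverse (sqrt x) * (1/2)) (at x)" if "x \<in> {0<..}" for x
    using that by (auto intro!: derivative_eq_intros)
  show "Ck_on k (\<lambda>x. inverse (sqrt x) * (1/2)) {0<..}" if "Ck_on k sqrt {0<..}" for k
  proof (rule Ck_on_mult)
    show "Ck_on k (\<lambda>x. inverse (sqrt x)) {0<..}"
      by (rule Ck_on_compose[where T = "{0<..}" and f = inverse])
        (use C_infty_inverse that in \<open>auto simp: C_infty_def\<close>)
  qed (auto intro: Ck_on_const)
qed auto

lemma C_infty_cos_sin: "C_infty (cos :: real \<Rightarrow> real) UNIV" "C_infty (sin :: real \<Rightarrow> real) UNIV"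
proof -
  have "Ck_on k (cos :: real \<Rightarrow> real) UNIV \<and> Ck_on k (sin :: real \<Rightarrow> real) UNIV" for k
  proof (induction k)
    case 0
    then show ?case by (auto intro: continuous_intros)
  next
    case (Suc k)
    have "Ck_on k (\<lambda>x::real. (- 1) * sin x) UNIV"
      by (intro Ck_on_mult Ck_on_const conjunct2[OF Suc]) auto
    then have "Ck_on (Suc k) (cos :: real \<Rightarrow> real) UNIV"
      by (rule Ck_on_realI[rotated 2]) (auto intro!: derivative_eq_intros)
    moreover have "Ck_on (Suc k) (sin :: real \<Rightarrow> real) UNIV"
      by (rule Ck_on_realI[where f' = cos]) (use Suc in \<open>auto intro!: derivative_eq_intros\<close>)
    ultimately show ?case by simp
  qed
  then show "C_infty (cos :: real \<Rightarrow> real) UNIV" "C_infty (sin :: real \<Rightarrow> real) UNIV"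
    by (auto simp: C_infty_def)
qed

lemma smooth_on_open_iff:
  assumes "open S"
  shows "smooth_on f S \<longleftrightarrow> C_infty f S"
proof
  assume sm: "smooth_on f S"
  have "Ck_on k f S" for k
  proof (rule Ck_on_local)
    fix x assume "x \<in> S"
    then obtain V F where V: "open V" "x \<in> V" "\<And>k. Ck_on k F V" "\<And>y. y \<in> S \<inter> V \<Longrightarrow> F y = f y"
      using sm unfolding smooth_on_def by metis
    have "Ck_on k F (S \<inter> V)" using V(3) by (rule Ck_on_subset) simp
    then have "Ck_on k f (S \<inter> V)"
      using Ck_on_cong[of "S \<inter> V" F f] V assms by auto
    then show "\<exists>V. open V \<and> x \<in> V \<and> Ck_on k f V"
      using V assms \<open>x \<in> S\<close> by (intro exI[of _ "S \<inter> V"]) auto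
  qed
  then show "C_infty f S" by (simp add: C_infty_def)
next
  assume "C_infty f S"
  then show "smooth_on f S"
    using assms unfolding smooth_on_def C_infty_def by blast
qed

lemma smooth_on_add:
  assumes "smooth_on f S" "smooth_on g S"
  shows "smooth_on (\<lambda>x. f x + g x) S"
  unfolding smooth_on_def
proof
  fix x assume "x \<in> S"
  obtain V F where V: "open V" "x \<in> V" "\<And>k. Ck_on k F V" "\<And>y. y \<in> S \<inter> V \<Longrightarrow> F y = f y"
    using assms(1) \<open>x \<in> S\<close> unfolding smooth_on_def by metis
  obtain V' G where V': "open V'" "x \<in> V'" "\<And>k. Ck_on k G V'" "\<And>y. y \<in> S \<inter> V' \<Longrightarrow> G y = g y"
    using assms(2) \<open>x \<in> S\<close> unfolding smooth_on_def by metis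
  have "Ck_on k (\<lambda>x. F x + G x) (V \<inter> V')" for k
    using V V' by (intro Ck_on_add) (auto intro: Ck_on_subset)
  then show "\<exists>V F. open V \<and> x \<in> V \<and> (\<forall>k. Ck_on k F V) \<and> (\<forall>y\<in>S \<inter> V. F y = f y + g y)"
    using V V' by (intro exI[of _ "V \<inter> V'"] exI[of _ "\<lambda>x. F x + G x"]) auto
qed

lemma smooth_on_mult:
  fixes f g :: "'a::euclidean_space \<Rightarrow> real"
  assumes "smooth_on f S" "smooth_on g S"
  shows "smooth_on (\<lambda>x. f x * g x) S"
  unfolding smooth_on_def
proof
  fix x assume "x \<in> S"
  obtain V F where V: "open V" "x \<in> V" "\<And>k. Ck_on k F V" "\<And>y. y \<in> S \<inter> V \<Longrightarrow> F y = f y"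
    using assms(1) \<open>x \<in> S\<close> unfolding smooth_on_def by metis
  obtain V' G where V': "open V'" "x \<in> V'" "\<And>k. Ck_on k G V'" "\<And>y. y \<in> S \<inter> V' \<Longrightarrow> G y = g y"
    using assms(2) \<open>x \<in> S\<close> unfolding smooth_on_def by metis
  have "Ck_on k (\<lambda>x. F x * G x) (V \<inter> V')" for k
    using V V' by (intro Ck_on_mult) (auto intro: Ck_on_subset)
  then show "\<exists>V F. open V \<and> x \<in> V \<and> (\<forall>k. Ck_on k F V) \<and> (\<forall>y\<in>S \<inter> V. F y = f y * g y)"
    using V V' by (intro exI[of _ "V \<inter> V'"] exI[of _ "\<lambda>x. F x * G x"]) auto
qed

lemma smooth_on_affine:
  fixes L :: "'a::euclidean_space \<Rightarrow> 'b::euclidean_space"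
  assumes "smooth_on f S" "bounded_linear L" "\<And>x. x \<in> T \<Longrightarrow> L x + d \<in> S"
  shows "smooth_on (\<lambda>x. f (L x + d)) T"
  unfolding smooth_on_def
proof
  fix x assume "x \<in> T"
  then obtain V F where V: "open V" "L x + d \<in> V" "\<And>k. Ck_on k F V" "\<And>y. y \<in> S \<inter> V \<Longrightarrow> F y = f y"
    using assms(1,3) unfolding smooth_on_def by metis
  have "continuous_on UNIV (\<lambda>x. L x + d)"
    by (intro continuous_intros linear_continuous_on assms(2))
  then have "open ((\<lambda>x. L x + d) -` V)"
    using V(1) by (simp add: open_vimage)
  then show "\<exists>V F. open V \<and> x \<in> V \<and> (\<forall>k. Ck_on k F V) \<and> (\<forall>y\<in>T \<inter> V. F y = f (L y + d))"
    using V assms(3) Ck_on_affine[OF assms(2) V(1) V(3)]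
    by (intro exI[of _ "(\<lambda>x. L x + d) -` V"] exI[of _ "\<lambda>x. F (L x + d)"]) auto
qed

lemma smooth_on_const: "smooth_on (\<lambda>x. c) S"
  unfolding smooth_on_def using Ck_on_const by blast

lemma smooth_on_continuous:
  assumes "smooth_on f S"
  shows "continuous_on S f"
  unfolding continuous_on_def
proof
  fix x assume "x \<in> S"
  then obtain V F where V: "open V" "x \<in> V" "\<And>k. Ck_on k F V" "\<And>y. y \<in> S \<inter> V \<Longrightarrow> F y = f y"
    using assms unfolding smooth_on_def by metis
  have "continuous_on V F" using V(3)[of 0] by simp
  then have "(F \<longlongrightarrow> F x) (at x within S)"
    using V(1,2) continuous_on_eq_continuous_at continuous_at_imp_continuous_at_within
      continuous_within by blast
  moreover have "\<forall>\<^sub>F y in at x within S. F y = f y"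
    unfolding eventually_at_topological using V by auto
  ultimately show "(f \<longlongrightarrow> f x) (at x within S)"
    using V(2,4) \<open>x \<in> S\<close> by (metis IntI tendsto_cong)
qed

section \<open>Ordinary differential equations\<close>

lemma gronwall_zero:
  fixes N N' :: "real \<Rightarrow> real"
  assumes "is_interval I" "t0 \<in> I" "t \<in> I" "N t0 = 0"
    and nonneg: "\<And>s. s \<in> I \<Longrightarrow> 0 \<le> N s"
    and deriv: "\<And>s. s \<in> I \<Longrightarrow> (N has_real_derivative N' s) (at s)"
    and bound: "\<And>a b. {a..b} \<subseteq> I \<Longrightarrow> \<exists>K. \<forall>s\<in>{a..b}. \<bar>N' s\<bar> \<le> K * N s"
  shows "N t = 0"
proof (cases "t0 \<le> t")
  case True
  have sub: "{t0..t} \<subseteq> I"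
    using mem_is_interval_1_I[OF assms(1-3)] by auto
  obtain K where K: "\<And>s. s \<in> {t0..t} \<Longrightarrow> \<bar>N' s\<bar> \<le> K * N s"
    using bound[OF sub] by blast
  have "N t * exp (- K * t) \<le> N t0 * exp (- K * t0)"
  proof (rule DERIV_nonpos_imp_nonincreasing[OF True])
    fix x assume x: "t0 \<le> x" "x \<le> t"
    then have d: "(N has_real_derivative N' x) (at x)" using deriv sub by auto
    have "((\<lambda>s. N s * exp (- K * s)) has_real_derivative (N' x - K * N x) * exp (- K * x)) (at x)"
      by (auto intro!: derivative_eq_intros d simp: algebra_simps)
    moreover have "(N' x - K * N x) * exp (- K * x) \<le> 0"
      using K[of x] x by (intro mult_nonpos_nonneg) auto
    ultimately show "\<exists>y. ((\<lambda>s. N s * exp (- K * s)) has_real_derivative y) (at x) \<and> y \<le> 0"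
      by blast
  qed
  then have "N t \<le> 0" using assms(4) by (simp add: mult_le_0_iff)
  then show ?thesis using nonneg[OF assms(3)] by simp
next
  case False
  then have le: "t \<le> t0" by simp
  have sub: "{t..t0} \<subseteq> I"
    using mem_is_interval_1_I[OF assms(1,3,2)] by auto
  obtain K where K: "\<And>s. s \<in> {t..t0} \<Longrightarrow> \<bar>N' s\<bar> \<le> K * N s"
    using bound[OF sub] by blast
  have "N t * exp (K * t) \<le> N t0 * exp (K * t0)"
  proof (rule DERIV_nonneg_imp_nondecreasing[OF le])
    fix x assume x: "t \<le> x" "x \<le> t0"
    then have d: "(N has_real_derivative N' x) (at x)" using deriv sub by auto
    have "((\<lambda>s. N s * exp (K * s)) has_real_derivative (N' x + K * N x) * exp (K * x)) (at x)"
      by (auto intro!: derivative_eq_intros d simp: algebra_simps)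
    moreover have "(N' x + K * N x) * exp (K * x) \<ge> 0"
      using K[of x] x by (intro mult_nonneg_nonneg) auto
    ultimately show "\<exists>y. ((\<lambda>s. N s * exp (K * s)) has_real_derivative y) (at x) \<and> y \<ge> 0"
      by blast
  qed
  then have "N t \<le> 0" using assms(4) by (simp add: mult_le_0_iff)
  then show ?thesis using nonneg[OF assms(3)] by simp
qed

lemma DERIV_zero_interval:
  fixes f :: "real \<Rightarrow> real"
  assumes "is_interval I" "\<And>x. x \<in> I \<Longrightarrow> (f has_real_derivative 0) (at x)" "a \<in> I" "b \<in> I"
  shows "f a = f b"
  using field_differentiable_bound[of I f "\<lambda>x. 0" 0 a b] assms
  by (auto simp: is_interval_convex has_field_derivative_at_within)

lemma antiderivative_exists:
  fixes h :: "real \<Rightarrow> 'a::euclidean_space"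
  assumes "continuous_on UNIV h"
  shows "\<exists>H. H 0 = 0 \<and> (\<forall>t. (H has_vector_derivative h t) (at t))"
proof -
  define H where "H = (\<lambda>u. interval_lebesgue_integral lborel (ereal 0) (ereal u) h)"
  have "(H has_vector_derivative h t) (at t)" for t
  proof -
    have "(H has_vector_derivative h t) (at t within {- \<bar>t\<bar> - 1..\<bar>t\<bar> + 1})"
      unfolding H_def
      by (rule interval_integral_FTC2) (auto intro: continuous_on_subset[OF assms])
    then show ?thesis
      by (subst (asm) at_within_interior) (auto simp: interior_atLeastAtMost_real)
  qed
  moreover have "H 0 = 0" by (simp add: H_def)
  ultimately show ?thesis by blast
qed

lemma exp_weighted_bound:
  fixes H :: "real \<Rightarrow> 'a::euclidean_space"
  assumes H: "\<And>t. (H has_vector_derivative h t) (at t)" "H 0 = 0"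
    and h: "\<And>t. norm (h t) \<le> A * exp (K * \<bar>t\<bar>)" and "0 < K"
  shows "norm (H t) \<le> A / K * exp (K * \<bar>t\<bar>)"
proof -
  have "norm (h 0) \<le> A" using h[of 0] by simp
  then have "0 \<le> A" using norm_ge_zero order_trans by blast
  have cont: "continuous_on S H" for S
    using H(1) by (meson continuous_at_imp_continuous_on has_vector_derivative_continuous)
  consider "t = 0" | "0 < t" | "t < 0" by linarith
  then show ?thesis
  proof cases
    case 1
    then show ?thesis using H(2) \<open>0 \<le> A\<close> \<open>0 < K\<close> by simp
  next
    case 2
    have "norm (H t - H 0) \<le> A / K * exp (K * t) - A / K * exp (K * 0)"
    proof (rule differentiable_bound_general[OF 2 cont])
      show "continuous_on {0..t} (\<lambda>s. A / K * exp (K * s))" by (intro continuous_intros)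
      show "((\<lambda>s. A / K * exp (K * s)) has_vector_derivative A * exp (K * x)) (at x)" for x
        unfolding has_real_derivative_iff_has_vector_derivative[symmetric]
        using \<open>0 < K\<close> by (auto intro!: derivative_eq_intros)
      show "norm (h x) \<le> A * exp (K * x)" if "0 < x" for x
        using h[of x] that by simp
    qed (use H in auto)
    moreover have "0 \<le> A / K" using \<open>0 \<le> A\<close> \<open>0 < K\<close> by simp
    ultimately show ?thesis using H(2) 2 by simp
  next
    case 3
    have "norm (H 0 - H t) \<le> (- A / K * exp (- K * 0)) - (- A / K * exp (- K * t))"
    proof (rule differentiable_bound_general[OF 3 cont])
      show "continuous_on {t..0} (\<lambda>s. - A / K * exp (- K * s))" by (intro continuous_intros)
      show "((\<lambda>s. - A / K * exp (- K * s)) has_vector_derivative A * exp (- K * x)) (at x)" for x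
        unfolding has_real_derivative_iff_has_vector_derivative[symmetric]
        using \<open>0 < K\<close> by (auto intro!: derivative_eq_intros)
      show "norm (h x) \<le> A * exp (- K * x)" if "x < 0" for x
        using h[of x] that by simp
    qed (use H in auto)
    moreover have "0 \<le> A / K" using \<open>0 \<le> A\<close> \<open>0 < K\<close> by simp
    ultimately show ?thesis using H(2) 3 by simp
  qed
qed

text \<open>Picard iteration in the norm \<open>sup exp (- 2 L \<bar>t\<bar>) \<bar>y t\<bar>\<close>, in which the integral operator
  contracts by the factor \<open>1/2\<close> on the whole time axis at once.\<close>

lemma global_solution_Lipschitz:
  fixes f :: "'a::euclidean_space \<Rightarrow> 'a"
  assumes "0 < L" and lip: "\<And>x y. norm (f x - f y) \<le> L * norm (x - y)"
  shows "\<exists>y. y 0 = y0 \<and> (\<forall>t. (y has_vector_derivative f (y t)) (at t))"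
proof -
  \<comment> \<open>The integral operator divides the Lipschitz constant by the growth rate \<open>K\<close> of the weight.\<close>
  define K where "K = 2 * L"
  have "0 < K" using assms by (simp add: K_def)
  define e where "e = (\<lambda>t. exp (K * \<bar>t\<bar>) :: real)"
  have e: "0 < e t" "1 \<le> e t" "e 0 = 1" for t
    using \<open>0 < K\<close> by (auto simp: e_def)
  have cont_e: "continuous_on UNIV e"
    unfolding e_def by (intro continuous_intros)
  have "L-lipschitz_on UNIV f"
    using assms by (auto intro!: lipschitz_onI simp: dist_norm)
  then have cont_f: "continuous_on UNIV f" by (rule lipschitz_on_continuous_on)
  define A where "A h = (SOME H. H 0 = 0 \<and> (\<forall>t. (H has_vector_derivative h t) (at t)))"
    for h :: "real \<Rightarrow> 'a"
  have A: "A h 0 = 0" "(A h has_vector_derivative h t) (at t)" if "continuous_on UNIV h" for h t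
    using someI_ex[OF antiderivative_exists[OF that]] unfolding A_def by auto
  define r where "r z = (\<lambda>s. f (e s *\<^sub>R apply_bcontfun z s))" for z
  have cont_r: "continuous_on UNIV (r z)" for z
    unfolding r_def by (intro continuous_on_compose2[OF cont_f] continuous_intros cont_e) auto
  define T where "T z = (\<lambda>t. (1 / e t) *\<^sub>R (y0 + A (r z) t))" for z
  have T: "T z \<in> bcontfun" for z
  proof -
    have "continuous_on UNIV (A (r z))"
      using A(2)[OF cont_r] by (meson continuous_at_imp_continuous_on has_vector_derivative_continuous)
    then have c: "continuous_on UNIV (T z)"
      unfolding T_def using e(1) by (intro continuous_intros cont_e) (auto simp: less_imp_neq[THEN not_sym])
    obtain B where B: "\<And>s. norm (apply_bcontfun z s) \<le> B"
      using bounded_apply_bcontfun[of z] unfolding bounded_iff by auto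
    have r: "norm (r z s) \<le> (norm (f 0) + L * B) * e s" for s
    proof -
      have "norm (r z s) \<le> norm (f 0) + norm (f (e s *\<^sub>R apply_bcontfun z s) - f 0)"
        unfolding r_def by (metis add.commute diff_add_cancel norm_triangle_ineq)
      also have "\<dots> \<le> norm (f 0) * e s + L * (e s * B)"
      proof (rule add_mono)
        show "norm (f 0) \<le> norm (f 0) * e s"
          using mult_left_mono[OF e(2)[of s] norm_ge_zero[of "f 0"]] by simp
        have "norm (f (e s *\<^sub>R apply_bcontfun z s) - f 0) \<le> L * (e s * norm (apply_bcontfun z s))"
          using lip[of "e s *\<^sub>R apply_bcontfun z s" 0] e(1)[of s] by simp
        also have "\<dots> \<le> L * (e s * B)"
          using B[of s] e(1)[of s] \<open>0 < L\<close> by (simp add: mult_left_mono)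
        finally show "norm (f (e s *\<^sub>R apply_bcontfun z s) - f 0) \<le> L * (e s * B)" .
      qed
      finally show ?thesis by (simp add: algebra_simps)
    qed
    have Ab: "norm (A (r z) t) \<le> (norm (f 0) + L * B) / K * e t" for t
      unfolding e_def
      by (rule exp_weighted_bound[OF A(2)[OF cont_r] A(1)[OF cont_r] _ \<open>0 < K\<close>])
        (use r in \<open>simp add: e_def\<close>)
    have "norm (T z t) \<le> norm y0 + (norm (f 0) + L * B) / K" for t
    proof -
      have "norm (T z t) = norm (y0 + A (r z) t) / e t"
        unfolding T_def using e(1)[of t] by simp
      also have "\<dots> \<le> (norm y0 * e t + (norm (f 0) + L * B) / K * e t) / e t"
      proof (rule divide_right_mono)
        have "norm y0 \<le> norm y0 * e t"
          using mult_left_mono[OF e(2)[of t] norm_ge_zero[of y0]] by simp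
        then show "norm (y0 + A (r z) t) \<le> norm y0 * e t + (norm (f 0) + L * B) / K * e t"
          using norm_triangle_ineq[of y0 "A (r z) t"] Ab[of t] by linarith
      qed (use e(1)[of t] in simp)
      also have "\<dots> = norm y0 + (norm (f 0) + L * B) / K"
        using e(1)[of t] by (simp add: field_simps)
      finally show ?thesis .
    qed
    then have "bounded (range (T z))" unfolding bounded_iff by blast
    with c show ?thesis by (simp add: bcontfun_def)
  qed
  have "dist (Bcontfun (T z)) (Bcontfun (T z')) \<le> 1 / 2 * dist z z'" for z z'
  proof (rule dist_bound)
    fix t
    have "((\<lambda>t. A (r z) t - A (r z') t) has_vector_derivative r z t - r z' t) (at t)" for t
      by (intro has_vector_derivative_diff A cont_r)
    moreover have "A (r z) 0 - A (r z') 0 = 0" using A cont_r by simp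
    moreover have "norm (r z s - r z' s) \<le> L * dist z z' * exp (K * \<bar>s\<bar>)" for s
    proof -
      have "norm (r z s - r z' s) \<le> L * norm (e s *\<^sub>R (apply_bcontfun z s - apply_bcontfun z' s))"
        unfolding r_def by (metis lip scaleR_right_diff_distrib)
      also have "\<dots> = L * (e s * dist (apply_bcontfun z s) (apply_bcontfun z' s))"
        using e(1)[of s] by (simp add: dist_norm)
      also have "\<dots> \<le> L * (e s * dist z z')"
        using e(1)[of s] \<open>0 < L\<close> dist_bounded[of z s z'] by (simp add: mult_left_mono)
      finally show ?thesis by (simp add: e_def mult_ac)
    qed
    ultimately have "norm (A (r z) t - A (r z') t) \<le> L * dist z z' / K * exp (K * \<bar>t\<bar>)"
      by (rule exp_weighted_bound) fact
    also have "\<dots> = 1 / 2 * dist z z' * e t"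
      using \<open>0 < L\<close> by (simp add: K_def e_def)
    finally have "norm (A (r z) t - A (r z') t) / e t \<le> 1 / 2 * dist z z'"
      using e(1)[of t] by (simp add: field_simps)
    moreover have "dist (T z t) (T z' t) = norm (A (r z) t - A (r z') t) / e t"
      unfolding T_def dist_norm scaleR_right_diff_distrib[symmetric] using e(1)[of t] by simp
    ultimately show "dist (apply_bcontfun (Bcontfun (T z)) t) (apply_bcontfun (Bcontfun (T z')) t)
        \<le> 1 / 2 * dist z z'"
      by (simp add: Bcontfun_inverse T)
  qed
  then obtain z where z: "Bcontfun (T z) = z"
    using banach_fix_type[of "1/2" "\<lambda>z. Bcontfun (T z)"] by auto
  then have zt: "apply_bcontfun z t = T z t" for t
    by (metis Bcontfun_inverse T)
  define y where "y = (\<lambda>t. y0 + A (r z) t)"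
  have ye: "e t *\<^sub>R apply_bcontfun z t = y t" for t
    using e(1)[of t] by (simp add: zt T_def y_def)
  have "y 0 = y0" using A(1)[OF cont_r] by (simp add: y_def)
  moreover have "(y has_vector_derivative f (y t)) (at t)" for t
  proof -
    have "(y has_vector_derivative 0 + r z t) (at t)"
      unfolding y_def by (intro has_vector_derivative_add has_vector_derivative_const A(2) cont_r)
    then show ?thesis by (simp add: r_def ye)
  qed
  ultimately show ?thesis by blast
qed

text \<open>A \<open>C\<^sup>1\<close> function that leaves zero gently; it serves both for the truncated energy below and for
  joining paths.\<close>

lemma DERIV_positive_part_square:
  "((\<lambda>x::real. (max 0 x)\<^sup>2) has_real_derivative 2 * max 0 x) (at x)"
proof -
  consider "x < 0" | "x = 0" | "0 < x" by linarith
  then show ?thesis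
  proof cases
    case 1
    have "((\<lambda>x::real. 0) has_real_derivative 2 * max 0 x) (at x)" using 1 by auto
    then show ?thesis
      by (rule has_field_derivative_transform_within_open[where S = "{..<0}"]) (use 1 in auto)
  next
    case 3
    have "((\<lambda>x::real. x\<^sup>2) has_real_derivative 2 * max 0 x) (at x)"
      using 3 by (auto intro!: derivative_eq_intros)
    then show ?thesis
      by (rule has_field_derivative_transform_within_open[where S = "{0<..}"]) (use 3 in auto)
  next
    case 2
    have "((\<lambda>h::real. (max 0 h)\<^sup>2 / h) \<longlongrightarrow> 0) (at 0)"
    proof (rule Lim_null_comparison)
      show "\<forall>\<^sub>F h in at 0. norm ((max 0 h)\<^sup>2 / h) \<le> \<bar>h\<bar>"
        by (rule always_eventually) (auto simp: max_def power2_eq_square)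
      show "((\<lambda>h::real. \<bar>h\<bar>) \<longlongrightarrow> 0) (at 0)"
        using tendsto_rabs_zero tendsto_ident_at by blast
    qed
    then show ?thesis using 2 by (simp add: DERIV_def)
  qed
qed

lemma C_infty_Lipschitz_on_bounded:
  fixes F :: "real \<Rightarrow> real"
  assumes "C_infty F UNIV"
  shows "\<exists>L>0. \<forall>x\<in>{-R..R}. \<forall>y\<in>{-R..R}. \<bar>F x - F y\<bar> \<le> L * \<bar>x - y\<bar>"
proof -
  note F = C_infty_deriv[OF assms open_UNIV]
  have "continuous_on {-R..R} (deriv F)"
    using C_infty_continuous[OF F(2)] continuous_on_subset by blast
  then have "bounded (deriv F ` {-R..R})"
    by (intro compact_imp_bounded compact_continuous_image) auto
  then obtain B where B: "0 < B" "\<And>x. x \<in> {-R..R} \<Longrightarrow> \<bar>deriv F x\<bar> \<le> B"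
    unfolding bounded_pos by auto
  have "\<bar>F x - F y\<bar> \<le> B * \<bar>x - y\<bar>" if "x \<in> {-R..R}" "y \<in> {-R..R}" for x y
    using field_differentiable_bound[of "{-R..R}" F "deriv F" B x y] F(1) B(2) that
    by (auto intro: has_field_derivative_at_within)
  with B(1) show ?thesis by blast
qed

lemma Newton_unique:
  fixes s z s' z' F :: "real \<Rightarrow> real"
  assumes "is_interval I" "t0 \<in> I" "t \<in> I" "C_infty F UNIV"
    and sol: "\<And>t. t \<in> I \<Longrightarrow> (s has_real_derivative z t) (at t)"
      "\<And>t. t \<in> I \<Longrightarrow> (z has_real_derivative F (s t)) (at t)"
    and sol': "\<And>t. t \<in> I \<Longrightarrow> (s' has_real_derivative z' t) (at t)"
      "\<And>t. t \<in> I \<Longrightarrow> (z' has_real_derivative F (s' t)) (at t)"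
    and init: "s t0 = s' t0" "z t0 = z' t0"
  shows "s t = s' t \<and> z t = z' t"
proof -
  define N where "N = (\<lambda>t. (s t - s' t)\<^sup>2 + (z t - z' t)\<^sup>2)"
  define N' where "N' = (\<lambda>t. 2 * ((s t - s' t) * (z t - z' t))
    + 2 * ((z t - z' t) * (F (s t) - F (s' t))))"
  have "N t = 0"
  proof (rule gronwall_zero[OF assms(1-3), of N N'])
    show "N t0 = 0" using init by (simp add: N_def)
    show "0 \<le> N x" for x by (simp add: N_def)
    show "(N has_real_derivative N' x) (at x)" if "x \<in> I" for x
      unfolding N_def N'_def
      by (auto intro!: derivative_eq_intros sol[OF that] sol'[OF that] simp: algebra_simps)
    fix a b assume ab: "{a..b} \<subseteq> I"
    have "continuous_on {a..b} s" "continuous_on {a..b} s'"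
      using sol(1) sol'(1) ab by (meson DERIV_isCont continuous_at_imp_continuous_on subsetD)+
    then have "bounded (s ` {a..b})" "bounded (s' ` {a..b})"
      by (auto intro!: compact_imp_bounded compact_continuous_image)
    then have "\<exists>R. \<forall>x\<in>{a..b}. \<bar>s x\<bar> \<le> R" "\<exists>R. \<forall>x\<in>{a..b}. \<bar>s' x\<bar> \<le> R"
      by (auto simp: bounded_iff)
    then obtain R R' where R: "\<And>x. x \<in> {a..b} \<Longrightarrow> \<bar>s x\<bar> \<le> R"
      and R': "\<And>x. x \<in> {a..b} \<Longrightarrow> \<bar>s' x\<bar> \<le> R'"
      by metis
    obtain L where L: "0 < L" "\<And>x y. x \<in> {-max R R'..max R R'} \<Longrightarrow> y \<in> {-max R R'..max R R'} \<Longrightarrow>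
        \<bar>F x - F y\<bar> \<le> L * \<bar>x - y\<bar>"
      using C_infty_Lipschitz_on_bounded[OF assms(4)] by blast
    have "\<bar>N' x\<bar> \<le> (1 + L) * N x" if x: "x \<in> {a..b}" for x
    proof -
      define u v where "u = \<bar>s x - s' x\<bar>" and "v = \<bar>z x - z' x\<bar>"
      have F: "\<bar>F (s x) - F (s' x)\<bar> \<le> L * u"
        unfolding u_def using R[OF x] R'[OF x] by (intro L(2)) auto
      have "\<bar>N' x\<bar> \<le> 2 * (u * v) + 2 * (v * \<bar>F (s x) - F (s' x)\<bar>)"
        unfolding N'_def u_def v_def
        by (rule order_trans[OF abs_triangle_ineq]) (simp add: abs_mult)
      also have "\<dots> \<le> 2 * (u * v) + 2 * (v * (L * u))"
        using F by (simp add: v_def mult_left_mono)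
      also have "\<dots> = (1 + L) * (2 * u * v)" by (simp add: algebra_simps)
      also have "\<dots> \<le> (1 + L) * (u\<^sup>2 + v\<^sup>2)"
        using L(1) sum_squares_bound[of u v] by (intro mult_left_mono) auto
      also have "\<dots> = (1 + L) * N x"
        by (simp add: N_def u_def v_def)
      finally show ?thesis .
    qed
    then show "\<exists>K. \<forall>x\<in>{a..b}. \<bar>N' x\<bar> \<le> K * N x" by blast
  qed
  then show ?thesis by (simp add: N_def sum_power2_eq_zero_iff)
qed

text \<open>Both components of the vector field are truncated, which makes it globally Lipschitz. As the
  truncated velocity is bounded, the position does not reach its truncation level within time \<open>n\<close>.
  During this time an energy is still conserved, in which \<open>z\<^sup>2\<close> is replaced by a convex function of
  linear growth; as \<open>V\<close> is nonnegative, it keeps the velocity below its truncation level as well, so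
  that the truncated equation is the original one.\<close>

lemma Newton_local:
  fixes F V :: "real \<Rightarrow> real"
  assumes "C_infty F UNIV" and V: "\<And>x. (V has_real_derivative - 2 * F x) (at x)"
    and Vpos: "\<And>x. 0 \<le> V x" and "0 < n"
  shows "\<exists>s z. s 0 = s0 \<and> z 0 = z0 \<and> (\<forall>t. \<bar>t\<bar> < n \<longrightarrow>
    (s has_real_derivative z t) (at t) \<and> (z has_real_derivative F (s t)) (at t))"
proof -
  define E where "E = z0\<^sup>2 + V s0"
  define Z where "Z = sqrt E + 1"
  have E0: "0 \<le> E" using Vpos[of s0] by (simp add: E_def)
  have Z: "1 \<le> Z" "E < Z\<^sup>2"
    using E0 by (auto simp: Z_def power2_sum intro: add_pos_nonneg)
  have z0: "\<bar>z0\<bar> \<le> Z"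
  proof -
    have "\<bar>z0\<bar> \<le> sqrt E" using Vpos[of s0] by (simp add: E_def real_le_rsqrt)
    then show ?thesis by (simp add: Z_def)
  qed
  define R where "R = \<bar>s0\<bar> + Z * n"
  have R: "0 \<le> R" using Z \<open>0 < n\<close> by (simp add: R_def)
  define clamp where "clamp = (\<lambda>r x::real. max (- r) (min r x))"
  have clamp_lip: "\<bar>clamp r x - clamp r y\<bar> \<le> \<bar>x - y\<bar>" for r x y
    by (auto simp: clamp_def max_def min_def)
  have clamp_in: "clamp r x \<in> {- r..r}" if "0 \<le> r" for r x
    using that by (auto simp: clamp_def)
  obtain L where L: "0 < L" "\<And>x y. x \<in> {-R..R} \<Longrightarrow> y \<in> {-R..R} \<Longrightarrow> \<bar>F x - F y\<bar> \<le> L * \<bar>x - y\<bar>"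
    using C_infty_Lipschitz_on_bounded[OF assms(1)] by blast
  define f where "f = (\<lambda>p. (clamp Z (snd p), F (clamp R (fst p))))"
  have "norm (f p - f q) \<le> (1 + L) * norm (p - q)" for p q
  proof -
    have "norm (f p - f q) \<le> \<bar>clamp Z (snd p) - clamp Z (snd q)\<bar>
        + \<bar>F (clamp R (fst p)) - F (clamp R (fst q))\<bar>"
      unfolding f_def by (simp add: norm_Pair) (rule sqrt_sum_squares_le_sum_abs)
    also have "\<dots> \<le> \<bar>snd p - snd q\<bar> + L * \<bar>fst p - fst q\<bar>"
    proof (rule add_mono[OF clamp_lip])
      have "\<bar>F (clamp R (fst p)) - F (clamp R (fst q))\<bar> \<le> L * \<bar>clamp R (fst p) - clamp R (fst q)\<bar>"
        using R by (intro L(2) clamp_in) auto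
      also have "\<dots> \<le> L * \<bar>fst p - fst q\<bar>"
        using L(1) clamp_lip by (simp add: mult_left_mono)
      finally show "\<bar>F (clamp R (fst p)) - F (clamp R (fst q))\<bar> \<le> L * \<bar>fst p - fst q\<bar>" .
    qed
    also have "\<dots> \<le> norm (p - q) + L * norm (p - q)"
    proof -
      have "p - q = (fst p - fst q, snd p - snd q)" by (simp add: prod_eq_iff)
      then show ?thesis
        using L(1) norm_fst_le[of "fst p - fst q" "snd p - snd q"]
          norm_snd_le[of "snd p - snd q" "fst p - fst q"]
        by (intro add_mono mult_left_mono) auto
    qed
    finally show ?thesis by (simp add: algebra_simps)
  qed
  then obtain y where y0: "y 0 = (s0, z0)" and y: "\<And>t. (y has_vector_derivative f (y t)) (at t)"
    using global_solution_Lipschitz[of "1 + L" f "(s0, z0)"] L(1) by auto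
  define s z where "s = (\<lambda>t. fst (y t))" and "z = (\<lambda>t. snd (y t))"
  have s': "(s has_real_derivative clamp Z (z t)) (at t)" for t
    using bounded_linear.has_vector_derivative[OF bounded_linear_fst y, of t]
    by (simp add: has_real_derivative_iff_has_vector_derivative s_def z_def f_def)
  have z': "(z has_real_derivative F (clamp R (s t))) (at t)" for t
    using bounded_linear.has_vector_derivative[OF bounded_linear_snd y, of t]
    by (simp add: has_real_derivative_iff_has_vector_derivative s_def z_def f_def)
  have init: "s 0 = s0" "z 0 = z0" using y0 by (simp_all add: s_def z_def)
  have s_bound: "clamp R (s t) = s t" if "\<bar>t\<bar> < n" for t
  proof -
    have "norm (s t - s 0) \<le> Z * norm (t - 0)"
    proof (rule field_differentiable_bound[of UNIV])
      show "norm (clamp Z (z x)) \<le> Z" for x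
        using clamp_in[of Z "z x"] Z(1) by auto
    qed (use s' in auto)
    also have "\<dots> \<le> Z * n" using that Z(1) by (intro mult_left_mono) auto
    finally have "\<bar>s t\<bar> \<le> R" using init by (auto simp: R_def)
    then show ?thesis by (auto simp: clamp_def)
  qed
  \<comment> \<open>the antiderivative of twice the truncation: \<open>z\<^sup>2\<close> up to the level \<open>Z\<close>, linear beyond\<close>
  define \<kappa> where "\<kappa> = (\<lambda>z. z\<^sup>2 - (max 0 (z - Z))\<^sup>2 - (max 0 (- z - Z))\<^sup>2)"
  have \<kappa>: "(\<kappa> has_real_derivative 2 * clamp Z x) (at x)" for x
  proof -
    have "(\<kappa> has_real_derivative 2 * x - 2 * max 0 (x - Z) * 1 - 2 * max 0 (- x - Z) * (- 1)) (at x)"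
      unfolding \<kappa>_def
      by (intro derivative_intros DERIV_chain2[OF DERIV_positive_part_square])
        (auto intro!: derivative_eq_intros)
    moreover have "2 * x - 2 * max 0 (x - Z) * 1 - 2 * max 0 (- x - Z) * (- 1) = 2 * clamp Z x"
      using Z(1) by (auto simp: clamp_def max_def min_def)
    ultimately show ?thesis by simp
  qed
  have z_bound: "clamp Z (z t) = z t" if t: "\<bar>t\<bar> < n" for t
  proof -
    have "\<kappa> (z t) + V (s t) = \<kappa> (z 0) + V (s 0)"
    proof (rule DERIV_zero_interval[of "{-n<..<n}" "\<lambda>t. \<kappa> (z t) + V (s t)"])
      fix x assume x: "x \<in> {-n<..<n}"
      have "((\<lambda>t. \<kappa> (z t) + V (s t)) has_real_derivative
          2 * clamp Z (z x) * F (clamp R (s x)) + (- 2 * F (s x)) * clamp Z (z x)) (at x)"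
        by (intro derivative_intros DERIV_chain2[OF \<kappa> z'] DERIV_chain2[OF V s'])
      then show "((\<lambda>t. \<kappa> (z t) + V (s t)) has_real_derivative 0) (at x)"
        using s_bound[of x] x by (simp add: algebra_simps abs_less_iff)
    qed (use t in \<open>auto simp: is_interval_1 \<open>0 < n\<close>\<close>)
    also have "\<dots> = E" using z0 by (simp add: init E_def \<kappa>_def)
    finally have "\<kappa> (z t) < Z\<^sup>2" using Vpos[of "s t"] Z(2) by linarith
    moreover have "Z\<^sup>2 \<le> \<kappa> x" if "Z \<le> \<bar>x\<bar>" for x
    proof -
      have "\<kappa> x = 2 * \<bar>x\<bar> * Z - Z\<^sup>2"
        using that Z(1) by (auto simp: \<kappa>_def max_def power2_eq_square algebra_simps abs_if)
      moreover have "Z * Z \<le> \<bar>x\<bar> * Z" using that Z(1) by (intro mult_right_mono) auto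
      ultimately show ?thesis by (simp add: power2_eq_square)
    qed
    ultimately have "\<bar>z t\<bar> < Z" by (meson not_le)
    then show ?thesis by (auto simp: clamp_def)
  qed
  have "(s has_real_derivative z t) (at t) \<and> (z has_real_derivative F (s t)) (at t)" if "\<bar>t\<bar> < n" for t
    using s'[of t] z'[of t] z_bound[OF that] s_bound[OF that] by simp
  then show ?thesis using init by blast
qed

text \<open>The solutions on \<open>(- n, n)\<close> agree on common domains by uniqueness and are glued.\<close>

lemma Newton_global:
  fixes F V :: "real \<Rightarrow> real"
  assumes F: "C_infty F UNIV" and V: "\<And>x. (V has_real_derivative - 2 * F x) (at x)"
    and Vpos: "\<And>x. 0 \<le> V x"
  shows "\<exists>s z. s t0 = s0 \<and> z t0 = z0 \<and> (\<forall>t.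
    (s has_real_derivative z t) (at t) \<and> (z has_real_derivative F (s t)) (at t))"
proof -
  have "\<exists>s z. s 0 = s0 \<and> z 0 = z0 \<and> (\<forall>t. \<bar>t\<bar> < real (Suc n) \<longrightarrow>
    (s has_real_derivative z t) (at t) \<and> (z has_real_derivative F (s t)) (at t))" for n
    by (rule Newton_local[OF assms]) auto
  then obtain S Z where init: "\<And>n. S n 0 = s0" "\<And>n. Z n 0 = z0"
    and sol: "\<And>n t. \<bar>t\<bar> < real (Suc n) \<Longrightarrow> (S n has_real_derivative Z n t) (at t)"
      "\<And>n t. \<bar>t\<bar> < real (Suc n) \<Longrightarrow> (Z n has_real_derivative F (S n t)) (at t)"
    by metis
  have agree: "S m t = S n t \<and> Z m t = Z n t" if "\<bar>t\<bar> < real (Suc m)" "\<bar>t\<bar> < real (Suc n)" for m n t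
  proof (rule Newton_unique[OF _ _ _ F, where ?t0.0 = 0
        and s = "S m" and z = "Z m" and s' = "S n" and z' = "Z n"])
    show "is_interval {x. \<bar>x\<bar> < real (Suc m) \<and> \<bar>x\<bar> < real (Suc n)}"
      by (auto simp: is_interval_1)
  qed (use that in \<open>auto intro: sol simp: init\<close>)
  define m where "m = (\<lambda>t. nat \<lceil>\<bar>t::real\<bar>\<rceil>)"
  have m: "\<bar>t\<bar> < real (Suc (m t))" for t by (simp add: m_def) linarith
  define s z where "s = (\<lambda>t. S (m t) t)" and "z = (\<lambda>t. Z (m t) t)"
  have eq: "s t = S n t" "z t = Z n t" if "\<bar>t\<bar> < real (Suc n)" for n t
    using agree[OF m that] by (auto simp: s_def z_def)
  have s': "(s has_real_derivative z t) (at t)" for t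
  proof (rule has_field_derivative_transform_within_open)
    show "(S (m t) has_real_derivative z t) (at t)" using sol(1)[OF m] by (simp add: z_def)
    show "open {x. \<bar>x\<bar> < real (Suc (m t))}" by (intro open_Collect_less continuous_intros)
  qed (use m eq in auto)
  have z': "(z has_real_derivative F (s t)) (at t)" for t
  proof (rule has_field_derivative_transform_within_open)
    show "(Z (m t) has_real_derivative F (s t)) (at t)" using sol(2)[OF m] by (simp add: s_def)
    show "open {x. \<bar>x\<bar> < real (Suc (m t))}" by (intro open_Collect_less continuous_intros)
  qed (use m eq in auto)
  define s' z' where "s' = (\<lambda>t. s (t - t0))" and "z' = (\<lambda>t. z (t - t0))"
  have "(s' has_real_derivative z' t) (at t) \<and> (z' has_real_derivative F (s' t)) (at t)" for t
    unfolding s'_def z'_def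
  proof -
    have "((\<lambda>t. t - t0) has_real_derivative 1) (at t)" by (auto intro!: derivative_eq_intros)
    from DERIV_chain2[OF s' this] DERIV_chain2[OF z' this]
    show "((\<lambda>t. s (t - t0)) has_real_derivative z (t - t0)) (at t) \<and>
        ((\<lambda>t. z (t - t0)) has_real_derivative F (s (t - t0))) (at t)"
      by simp
  qed
  moreover have "s' t0 = s0" "z' t0 = z0" by (simp_all add: s'_def z'_def s_def z_def init)
  ultimately show ?thesis by blast
qed

section \<open>The semi-inner product space of square integrable functions\<close>

lemma L2_functionsI: "f \<in> borel_measurable M \<Longrightarrow> integrable M (\<lambda>x. (f x)\<^sup>2) \<Longrightarrow> f \<in> L2_functions M"
  by (simp add: L2_functions_def)

lemma L2_measurable: "f \<in> L2_functions M \<Longrightarrow> f \<in> borel_measurable M"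
  by (simp add: L2_functions_def)

lemma L2_mult_integrable:
  assumes "f \<in> L2_functions M" "g \<in> L2_functions M"
  shows "integrable M (\<lambda>x. f x * g x)"
proof (rule Bochner_Integration.integrable_bound)
  show "integrable M (\<lambda>x. (f x)\<^sup>2 + (g x)\<^sup>2)"
    using assms by (auto simp: L2_functions_def)
  show "(\<lambda>x. f x * g x) \<in> borel_measurable M"
    using assms by (intro borel_measurable_times L2_measurable)
  have "\<bar>a * b\<bar> \<le> a\<^sup>2 + b\<^sup>2" for a b :: real
  proof -
    have "2 * \<bar>a\<bar> * \<bar>b\<bar> \<le> \<bar>a\<bar>\<^sup>2 + \<bar>b\<bar>\<^sup>2" by (rule sum_squares_bound)
    moreover have "0 \<le> \<bar>a\<bar> * \<bar>b\<bar>" by simp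
    ultimately show ?thesis unfolding abs_mult power2_abs by linarith
  qed
  then show "AE x in M. norm (f x * g x) \<le> norm ((f x)\<^sup>2 + (g x)\<^sup>2)" by simp
qed

lemma L2_add [simp]:
  assumes "f \<in> L2_functions M" "g \<in> L2_functions M"
  shows "(\<lambda>x. f x + g x) \<in> L2_functions M"
proof (rule L2_functionsI)
  show "(\<lambda>x. f x + g x) \<in> borel_measurable M"
    using assms by (intro borel_measurable_add L2_measurable)
  have "integrable M (\<lambda>x. (f x)\<^sup>2 + (g x)\<^sup>2 + 2 * (f x * g x))"
    using assms L2_mult_integrable[OF assms] by (auto simp: L2_functions_def)
  then show "integrable M (\<lambda>x. (f x + g x)\<^sup>2)" by (simp add: power2_sum mult.assoc)
qed

lemma L2_cmult [simp]: "f \<in> L2_functions M \<Longrightarrow> (\<lambda>x. a * f x) \<in> L2_functions M"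
  by (auto simp: L2_functions_def power_mult_distrib)

lemma L2_zero [simp]: "(\<lambda>x. 0) \<in> L2_functions M"
  by (simp add: L2_functions_def)

lemma L2_diff [simp]:
  assumes "f \<in> L2_functions M" "g \<in> L2_functions M"
  shows "(\<lambda>x. f x - g x) \<in> L2_functions M"
  using L2_add[OF assms(1) L2_cmult[OF assms(2), of "-1"]] by simp

lemma L2_divide [simp]: "f \<in> L2_functions M \<Longrightarrow> (\<lambda>x. f x / a) \<in> L2_functions M"
  using L2_cmult[of f M "1 / a"] by simp

lemma L2_inner_commute: "L2_inner M f g = L2_inner M g f"
  by (simp add: L2_inner_def mult.commute)

lemma L2_inner_add_left [simp]:
  assumes "f \<in> L2_functions M" "g \<in> L2_functions M" "h \<in> L2_functions M"
  shows "L2_inner M (\<lambda>x. f x + g x) h = L2_inner M f h + L2_inner M g h"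
  unfolding L2_inner_def by (simp add: distrib_right L2_mult_integrable assms)

lemma L2_inner_diff_left [simp]:
  assumes "f \<in> L2_functions M" "g \<in> L2_functions M" "h \<in> L2_functions M"
  shows "L2_inner M (\<lambda>x. f x - g x) h = L2_inner M f h - L2_inner M g h"
  unfolding L2_inner_def by (simp add: left_diff_distrib L2_mult_integrable assms)

lemma L2_inner_cmult_left [simp]: "L2_inner M (\<lambda>x. a * f x) g = a * L2_inner M f g"
  by (simp add: L2_inner_def mult.assoc)

lemma L2_inner_divide_left [simp]: "L2_inner M (\<lambda>x. f x / a) g = L2_inner M f g / a"
  using L2_inner_cmult_left[of M "1 / a" f g] by simp

lemma L2_inner_add_right [simp]:
  assumes "f \<in> L2_functions M" "g \<in> L2_functions M" "h \<in> L2_functions M"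
  shows "L2_inner M h (\<lambda>x. f x + g x) = L2_inner M h f + L2_inner M h g"
  using L2_inner_add_left[OF assms] by (simp add: L2_inner_commute)

lemma L2_inner_diff_right [simp]:
  assumes "f \<in> L2_functions M" "g \<in> L2_functions M" "h \<in> L2_functions M"
  shows "L2_inner M h (\<lambda>x. f x - g x) = L2_inner M h f - L2_inner M h g"
  using L2_inner_diff_left[OF assms] by (simp add: L2_inner_commute)

lemma L2_inner_cmult_right [simp]: "L2_inner M g (\<lambda>x. a * f x) = a * L2_inner M g f"
  using L2_inner_cmult_left[of M a f g] by (simp only: L2_inner_commute[of M _ g])

lemma L2_inner_divide_right [simp]: "L2_inner M g (\<lambda>x. f x / a) = L2_inner M g f / a"
  using L2_inner_divide_left[of M f a g] by (simp only: L2_inner_commute[of M _ g])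

lemma L2_inner_zero [simp]: "L2_inner M (\<lambda>x. 0) f = 0" "L2_inner M f (\<lambda>x. 0) = 0"
  by (simp_all add: L2_inner_def)

lemma L2_inner_self_nonneg [simp]: "0 \<le> L2_inner M f f"
  by (simp add: L2_inner_def)

lemma L2_norm_nonneg [simp]: "0 \<le> L2_norm M f"
  by (simp add: L2_norm_def)

lemma L2_norm_power2 [simp]: "(L2_norm M f)\<^sup>2 = L2_inner M f f"
  by (simp add: L2_norm_def)

lemma L2_norm_power2_integral: "(L2_norm M f)\<^sup>2 = (\<integral>x. (f x)\<^sup>2 \<partial>M)"
  unfolding L2_norm_power2 by (simp only: L2_inner_def power2_eq_square)

lemma L2_Cauchy_Schwarz_square:
  assumes f: "f \<in> L2_functions M" and g: "g \<in> L2_functions M"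
  shows "(L2_inner M f g)\<^sup>2 \<le> L2_inner M f f * L2_inner M g g"
proof -
  let ?A = "L2_inner M f f" and ?B = "L2_inner M f g" and ?C = "L2_inner M g g"
  have q: "0 \<le> ?A + 2 * t * ?B + t\<^sup>2 * ?C" for t
  proof -
    have "0 \<le> L2_inner M (\<lambda>x. f x + t * g x) (\<lambda>x. f x + t * g x)" by simp
    then show ?thesis
      using f g by (simp add: L2_inner_commute[of M g f] power2_eq_square algebra_simps)
  qed
  show ?thesis
  proof (cases "?C = 0")
    case True
    have "?B = 0"
    proof (rule ccontr)
      assume "?B \<noteq> 0"
      then show False using q[of "- (?A + 1) / (2 * ?B)"] True by (simp add: field_simps)
    qed
    then show ?thesis by simp
  next
    case False
    then have "0 < ?C" using L2_inner_self_nonneg[of M g] by linarith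
    then show ?thesis
      using q[of "- ?B / ?C"] by (simp add: field_simps power2_eq_square)
  qed
qed

lemma L2_Cauchy_Schwarz:
  assumes "f \<in> L2_functions M" "g \<in> L2_functions M"
  shows "\<bar>L2_inner M f g\<bar> \<le> L2_norm M f * L2_norm M g"
  by (rule power2_le_imp_le)
    (use L2_Cauchy_Schwarz_square[OF assms] in \<open>simp_all add: power_mult_distrib\<close>)

lemma L2_norm_triangle:
  assumes "f \<in> L2_functions M" "g \<in> L2_functions M"
  shows "L2_norm M (\<lambda>x. f x + g x) \<le> L2_norm M f + L2_norm M g"
proof (rule power2_le_imp_le)
  have "(L2_norm M (\<lambda>x. f x + g x))\<^sup>2 = L2_inner M f f + 2 * L2_inner M f g + L2_inner M g g"
    using assms by (simp add: L2_inner_commute[of M g f])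
  also have "\<dots> \<le> (L2_norm M f + L2_norm M g)\<^sup>2"
    using L2_Cauchy_Schwarz[OF assms] by (simp add: power2_sum)
  finally show "(L2_norm M (\<lambda>x. f x + g x))\<^sup>2 \<le> (L2_norm M f + L2_norm M g)\<^sup>2" .
qed simp

lemma L2_norm_cmult [simp]: "L2_norm M (\<lambda>x. a * f x) = \<bar>a\<bar> * L2_norm M f"
proof -
  have "L2_inner M (\<lambda>x. a * f x) (\<lambda>x. a * f x) = a\<^sup>2 * L2_inner M f f"
    by (simp add: power2_eq_square)
  then show ?thesis by (simp add: L2_norm_def real_sqrt_mult)
qed

lemma L2_norm_minus_commute: "L2_norm M (\<lambda>x. f x - g x) = L2_norm M (\<lambda>x. g x - f x)"
  using L2_norm_cmult[of M "-1" "\<lambda>x. f x - g x"] by simp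

lemma L2_norm_zero [simp]: "L2_norm M (\<lambda>x. 0) = 0"
  by (simp add: L2_norm_def)

lemma L2_norm_diff_ineq:
  assumes "f \<in> L2_functions M" "g \<in> L2_functions M"
  shows "\<bar>L2_norm M f - L2_norm M g\<bar> \<le> L2_norm M (\<lambda>x. f x - g x)"
  using L2_norm_triangle[of "\<lambda>x. f x - g x" M g] L2_norm_triangle[of "\<lambda>x. g x - f x" M f] assms
  by (auto simp: L2_norm_minus_commute[of M g f])

lemma L2_norm_eq_0_iff:
  assumes "f \<in> L2_functions M"
  shows "L2_norm M f = 0 \<longleftrightarrow> (AE x in M. f x = 0)"
proof -
  have "integrable M (\<lambda>x. f x * f x)" using L2_mult_integrable[OF assms assms] .
  then have "L2_inner M f f = 0 \<longleftrightarrow> (AE x in M. f x * f x = 0)"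
    unfolding L2_inner_def by (rule integral_nonneg_eq_0_iff_AE) simp
  then show ?thesis by (simp add: L2_norm_def)
qed

lemma L2_norm_diff_eq_0_iff:
  assumes "f \<in> L2_functions M" "g \<in> L2_functions M"
  shows "L2_norm M (\<lambda>x. f x - g x) = 0 \<longleftrightarrow> (AE x in M. f x = g x)"
  using L2_norm_eq_0_iff[of "\<lambda>x. f x - g x" M] assms by simp

lemma L2_inner_cong_AE:
  assumes "f \<in> L2_functions M" "f' \<in> L2_functions M" "g \<in> L2_functions M" "g' \<in> L2_functions M"
    and "AE x in M. f x = f' x" "AE x in M. g x = g' x"
  shows "L2_inner M f g = L2_inner M f' g'"
  unfolding L2_inner_def
proof (rule integral_cong_AE)
  show "AE x in M. f x * g x = f' x * g' x" using assms(5,6) by eventually_elim simp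
qed (intro borel_measurable_times L2_measurable assms)+

subsection \<open>Limits and derivatives of curves\<close>

lemma L2_inner_tendsto:
  assumes "((\<lambda>s. L2_norm M (\<lambda>x. c s x - l x)) \<longlongrightarrow> 0) F" "((\<lambda>s. L2_norm M (\<lambda>x. d s x - m x)) \<longlongrightarrow> 0) F"
    and "\<forall>\<^sub>F s in F. c s \<in> L2_functions M" "\<forall>\<^sub>F s in F. d s \<in> L2_functions M"
    and l: "l \<in> L2_functions M" and m: "m \<in> L2_functions M"
  shows "((\<lambda>s. L2_inner M (c s) (d s)) \<longlongrightarrow> L2_inner M l m) F"
proof (rule Lim_null[THEN iffD2], rule Lim_null_comparison)
  let ?C = "\<lambda>s. L2_norm M (\<lambda>x. c s x - l x)" and ?D = "\<lambda>s. L2_norm M (\<lambda>x. d s x - m x)"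
  have "((\<lambda>s. ?C s * (?D s + L2_norm M m) + L2_norm M l * ?D s) \<longlongrightarrow> 0 * (0 + L2_norm M m) + L2_norm M l * 0) F"
    by (intro tendsto_intros assms(1,2))
  then show "((\<lambda>s. ?C s * (?D s + L2_norm M m) + L2_norm M l * ?D s) \<longlongrightarrow> 0) F" by simp
  show "\<forall>\<^sub>F s in F. norm (L2_inner M (c s) (d s) - L2_inner M l m)
      \<le> ?C s * (?D s + L2_norm M m) + L2_norm M l * ?D s"
    using assms(3,4)
  proof eventually_elim
    fix s assume c: "c s \<in> L2_functions M" and d: "d s \<in> L2_functions M"
    have "L2_inner M (c s) (d s) - L2_inner M l m
        = L2_inner M (\<lambda>x. c s x - l x) (d s) + L2_inner M l (\<lambda>x. d s x - m x)"
      using c d l m by simp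
    also have "norm \<dots> \<le> ?C s * L2_norm M (d s) + L2_norm M l * ?D s"
      using L2_Cauchy_Schwarz[of "\<lambda>x. c s x - l x" M "d s"] L2_Cauchy_Schwarz[of l M "\<lambda>x. d s x - m x"]
        c d l m by (simp add: abs_le_iff)
    also have "\<dots> \<le> ?C s * (?D s + L2_norm M m) + L2_norm M l * ?D s"
      using L2_norm_triangle[of "\<lambda>x. d s x - m x" M m] d m
      by (intro add_right_mono mult_left_mono) auto
    finally show "norm (L2_inner M (c s) (d s) - L2_inner M l m)
      \<le> ?C s * (?D s + L2_norm M m) + L2_norm M l * ?D s" .
  qed
qed

lemma L2_norm_difference_quotient:
  "s \<noteq> t \<Longrightarrow> L2_norm M (\<lambda>x. (f x - g x) / (s - t) - v x) = L2_norm M (\<lambda>x. f x - g x - (s - t) * v x) / \<bar>s - t\<bar>"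
proof -
  assume "s \<noteq> t"
  then have "(\<lambda>x. (f x - g x) / (s - t) - v x) = (\<lambda>x. (1 / (s - t)) * (f x - g x - (s - t) * v x))"
    by (auto simp: fun_eq_iff field_simps)
  then have "L2_norm M (\<lambda>x. (f x - g x) / (s - t) - v x)
      = \<bar>1 / (s - t)\<bar> * L2_norm M (\<lambda>x. f x - g x - (s - t) * v x)"
    by (simp only: L2_norm_cmult)
  then show ?thesis by (simp add: divide_inverse mult.commute)
qed

text \<open>Free of division, this form is the one that passes through reparametrizations.\<close>

lemma has_L2_derivative_iff:
  "has_L2_derivative M c v t S \<longleftrightarrow>
    (\<forall>e>0. \<exists>d>0. \<forall>s\<in>S. \<bar>s - t\<bar> < d \<longrightarrow>
      L2_norm M (\<lambda>x. c s x - c t x - (s - t) * v x) \<le> e * \<bar>s - t\<bar>)" (is "_ \<longleftrightarrow> ?R")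
proof
  assume l: "has_L2_derivative M c v t S"
  show ?R
  proof (intro allI impI)
    fix e :: real assume "e > 0"
    then obtain d where "d > 0" and d: "\<And>s. s \<in> S \<Longrightarrow> 0 < \<bar>s - t\<bar> \<Longrightarrow> \<bar>s - t\<bar> < d \<Longrightarrow>
        L2_norm M (\<lambda>x. (c s x - c t x) / (s - t) - v x) < e"
      using l unfolding has_L2_derivative_def Lim_within dist_real_def by force
    have "L2_norm M (\<lambda>x. c s x - c t x - (s - t) * v x) \<le> e * \<bar>s - t\<bar>"
      if "s \<in> S" "\<bar>s - t\<bar> < d" for s
    proof (cases "s = t")
      case False
      then have "0 < \<bar>s - t\<bar>" by simp
      moreover from d[OF that(1) this that(2)]
      have "L2_norm M (\<lambda>x. c s x - c t x - (s - t) * v x) / \<bar>s - t\<bar> < e"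
        unfolding L2_norm_difference_quotient[OF False] .
      ultimately show ?thesis by (metis less_imp_le pos_divide_less_eq)
    qed simp
    then show "\<exists>d>0. \<forall>s\<in>S. \<bar>s - t\<bar> < d \<longrightarrow>
      L2_norm M (\<lambda>x. c s x - c t x - (s - t) * v x) \<le> e * \<bar>s - t\<bar>"
      using \<open>d > 0\<close> by blast
  qed
next
  assume r: ?R
  show "has_L2_derivative M c v t S"
    unfolding has_L2_derivative_def Lim_within dist_real_def
  proof (intro allI impI)
    fix e :: real assume "e > 0"
    then have "e / 2 > 0" by simp
    then obtain d where "d > 0" and d: "\<And>s. s \<in> S \<Longrightarrow> \<bar>s - t\<bar> < d \<Longrightarrow>
        L2_norm M (\<lambda>x. c s x - c t x - (s - t) * v x) \<le> e / 2 * \<bar>s - t\<bar>"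
      using r by blast
    have "\<bar>L2_norm M (\<lambda>x. (c s x - c t x) / (s - t) - v x) - 0\<bar> < e"
      if s: "s \<in> S" "0 < \<bar>s - t\<bar>" "\<bar>s - t\<bar> < d" for s
    proof -
      have "s \<noteq> t" using s(2) by auto
      have "L2_norm M (\<lambda>x. (c s x - c t x) / (s - t) - v x) \<le> e / 2"
        using d[OF s(1,3)] s(2)
        unfolding L2_norm_difference_quotient[OF \<open>s \<noteq> t\<close>] by (simp add: field_simps)
      then show ?thesis using \<open>e > 0\<close> by simp
    qed
    then show "\<exists>d>0. \<forall>s\<in>S. 0 < \<bar>s - t\<bar> \<and> \<bar>s - t\<bar> < d \<longrightarrow>
        \<bar>L2_norm M (\<lambda>x. (c s x - c t x) / (s - t) - v x) - 0\<bar> < e"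
      using \<open>d > 0\<close> by blast
  qed
qed

lemma has_L2_derivative_continuous:
  assumes "has_L2_derivative M c v t S" "t \<in> S" "\<And>s. s \<in> S \<Longrightarrow> c s \<in> L2_functions M"
    and v: "v \<in> L2_functions M"
  shows "((\<lambda>s. L2_norm M (\<lambda>x. c s x - c t x)) \<longlongrightarrow> 0) (at t within S)"
proof (rule Lim_null_comparison)
  let ?Q = "\<lambda>s. L2_norm M (\<lambda>x. (c s x - c t x) / (s - t) - v x)"
  have "((\<lambda>s. \<bar>s - t\<bar> * (?Q s + L2_norm M v)) \<longlongrightarrow> \<bar>t - t\<bar> * (0 + L2_norm M v)) (at t within S)"
    using assms(1) unfolding has_L2_derivative_def by (intro tendsto_intros)
  then show "((\<lambda>s. \<bar>s - t\<bar> * (?Q s + L2_norm M v)) \<longlongrightarrow> 0) (at t within S)" by simp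
  have "norm (L2_norm M (\<lambda>x. c s x - c t x)) \<le> \<bar>s - t\<bar> * (?Q s + L2_norm M v)"
    if s: "s \<in> S" "s \<noteq> t" for s
  proof -
    have "L2_norm M (\<lambda>x. (c s x - c t x - (s - t) * v x) + (s - t) * v x)
        \<le> L2_norm M (\<lambda>x. c s x - c t x - (s - t) * v x) + L2_norm M (\<lambda>x. (s - t) * v x)"
      using s assms by (intro L2_norm_triangle) auto
    moreover have "(\<lambda>x. (c s x - c t x - (s - t) * v x) + (s - t) * v x) = (\<lambda>x. c s x - c t x)"
      by (simp add: fun_eq_iff)
    ultimately show ?thesis
      using s(2) unfolding L2_norm_difference_quotient[OF s(2)] by (simp add: distrib_left)
  qed
  then show "\<forall>\<^sub>F s in at t within S. norm (L2_norm M (\<lambda>x. c s x - c t x)) \<le> \<bar>s - t\<bar> * (?Q s + L2_norm M v)"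
    by (auto simp: eventually_at intro!: exI[of _ 1])
qed

lemma L2_inner_has_derivative:
  assumes c: "has_L2_derivative M c v t S" "\<And>s. s \<in> S \<Longrightarrow> c s \<in> L2_functions M" "v \<in> L2_functions M"
    and d: "has_L2_derivative M d w t S" "\<And>s. s \<in> S \<Longrightarrow> d s \<in> L2_functions M" "w \<in> L2_functions M"
    and "t \<in> S"
  shows "((\<lambda>s. L2_inner M (c s) (d s)) has_real_derivative
    L2_inner M v (d t) + L2_inner M (c t) w) (at t within S)"
proof -
  have ev: "\<forall>\<^sub>F s in at t within S. s \<in> S \<and> s \<noteq> t"
    by (auto simp: eventually_at intro!: exI[of _ 1])
  let ?Q = "\<lambda>c s x. (c s x - c t x) / (s - t)"
  have "((\<lambda>s. L2_inner M (?Q c s) (d s)) \<longlongrightarrow> L2_inner M v (d t)) (at t within S)"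
  proof (rule L2_inner_tendsto)
    show "((\<lambda>s. L2_norm M (\<lambda>x. d s x - d t x)) \<longlongrightarrow> 0) (at t within S)"
      using d \<open>t \<in> S\<close> by (intro has_L2_derivative_continuous)
    show "\<forall>\<^sub>F s in at t within S. (\<lambda>x. ?Q c s x) \<in> L2_functions M"
      "\<forall>\<^sub>F s in at t within S. d s \<in> L2_functions M"
      using ev by (eventually_elim, use c d \<open>t \<in> S\<close> in simp)+
  qed (use c d \<open>t \<in> S\<close> in \<open>auto simp: has_L2_derivative_def\<close>)
  moreover have "((\<lambda>s. L2_inner M (c t) (?Q d s)) \<longlongrightarrow> L2_inner M (c t) w) (at t within S)"
  proof (rule L2_inner_tendsto)
    show "\<forall>\<^sub>F s in at t within S. (\<lambda>x. ?Q d s x) \<in> L2_functions M"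
      using ev by (eventually_elim) (use c d \<open>t \<in> S\<close> in simp)
  qed (use c d \<open>t \<in> S\<close> in \<open>auto simp: has_L2_derivative_def\<close>)
  ultimately have "((\<lambda>s. L2_inner M (?Q c s) (d s) + L2_inner M (c t) (?Q d s)) \<longlongrightarrow>
      L2_inner M v (d t) + L2_inner M (c t) w) (at t within S)"
    by (rule tendsto_add)
  moreover have "\<forall>\<^sub>F s in at t within S. L2_inner M (?Q c s) (d s) + L2_inner M (c t) (?Q d s)
      = (L2_inner M (c s) (d s) - L2_inner M (c t) (d t)) / (s - t)"
    using ev
  proof eventually_elim
    fix s assume "s \<in> S \<and> s \<noteq> t"
    then show "L2_inner M (?Q c s) (d s) + L2_inner M (c t) (?Q d s)
      = (L2_inner M (c s) (d s) - L2_inner M (c t) (d t)) / (s - t)"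
      using c d \<open>t \<in> S\<close> by (simp add: add_divide_distrib[symmetric])
  qed
  ultimately show ?thesis
    unfolding has_field_derivative_iff by (simp cong: tendsto_cong)
qed

lemma has_L2_derivative_add:
  assumes "has_L2_derivative M c v t S" "\<And>s. s \<in> S \<Longrightarrow> c s \<in> L2_functions M" "v \<in> L2_functions M"
    and "has_L2_derivative M d w t S" "\<And>s. s \<in> S \<Longrightarrow> d s \<in> L2_functions M" "w \<in> L2_functions M"
    and "t \<in> S"
  shows "has_L2_derivative M (\<lambda>s x. c s x + d s x) (\<lambda>x. v x + w x) t S"
  unfolding has_L2_derivative_def
proof (rule Lim_null_comparison)
  let ?Q = "\<lambda>c v s. L2_norm M (\<lambda>x. (c s x - c t x) / (s - t) - v x)"
  have "((\<lambda>s. ?Q c v s + ?Q d w s) \<longlongrightarrow> 0 + 0) (at t within S)"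
    using assms unfolding has_L2_derivative_def by (intro tendsto_add)
  then show "((\<lambda>s. ?Q c v s + ?Q d w s) \<longlongrightarrow> 0) (at t within S)" by simp
  have "norm (L2_norm M (\<lambda>x. (c s x + d s x - (c t x + d t x)) / (s - t) - (v x + w x))) \<le> ?Q c v s + ?Q d w s"
    if "s \<in> S" for s
  proof -
    have "(\<lambda>x. (c s x + d s x - (c t x + d t x)) / (s - t) - (v x + w x))
      = (\<lambda>x. ((c s x - c t x) / (s - t) - v x) + ((d s x - d t x) / (s - t) - w x))"
      by (auto simp: fun_eq_iff add_divide_distrib diff_divide_distrib)
    then show ?thesis
      using L2_norm_triangle[of "\<lambda>x. (c s x - c t x) / (s - t) - v x" M "\<lambda>x. (d s x - d t x) / (s - t) - w x"]
        assms that by simp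
  qed
  then show "\<forall>\<^sub>F s in at t within S. norm (L2_norm M (\<lambda>x. (c s x + d s x - (c t x + d t x)) / (s - t) - (v x + w x)))
      \<le> ?Q c v s + ?Q d w s"
    by (auto simp: eventually_at intro!: exI[of _ 1])
qed

lemma has_L2_derivative_scale:
  assumes "(X has_real_derivative X') (at t within S)"
  shows "has_L2_derivative M (\<lambda>s x. X s * f x) (\<lambda>x. X' * f x) t S"
proof -
  have "((\<lambda>s. \<bar>(X s - X t) / (s - t) - X'\<bar> * L2_norm M f) \<longlongrightarrow> \<bar>X' - X'\<bar> * L2_norm M f) (at t within S)"
    using assms unfolding has_field_derivative_iff by (intro tendsto_intros)
  moreover have "(\<lambda>x. (X s * f x - X t * f x) / (s - t) - X' * f x)
      = (\<lambda>x. ((X s - X t) / (s - t) - X') * f x)" for s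
    by (auto simp: fun_eq_iff left_diff_distrib diff_divide_distrib)
  ultimately show ?thesis by (simp add: has_L2_derivative_def)
qed

lemma has_L2_derivative_const: "has_L2_derivative M (\<lambda>s. f) (\<lambda>x. 0) t S"
  by (simp add: has_L2_derivative_def)

lemma has_L2_derivative_compose:
  assumes c: "has_L2_derivative M c v (\<eta> t) T" "\<And>s. s \<in> T \<Longrightarrow> c s \<in> L2_functions M" "v \<in> L2_functions M"
    and \<eta>: "(\<eta> has_real_derivative \<eta>') (at t within S)" "\<eta> ` S \<subseteq> T" "t \<in> S"
  shows "has_L2_derivative M (\<lambda>s. c (\<eta> s)) (\<lambda>x. \<eta>' * v x) t S"
  unfolding has_L2_derivative_iff
proof (intro allI impI)
  fix e :: real assume "e > 0"
  define B where "B = \<bar>\<eta>'\<bar> + 1"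
  define e1 where "e1 = e / (2 * B)"
  define e2 where "e2 = min 1 (e / (2 * (L2_norm M v + 1)))"
  have B: "0 < B" by (simp add: B_def)
  have v1: "0 < L2_norm M v + 1" by (simp add: add_nonneg_pos)
  have e12: "e1 > 0" "e2 > 0" using \<open>e > 0\<close> B v1 by (auto simp: e1_def e2_def)
  obtain d1 where "d1 > 0" and d1: "\<And>s. s \<in> T \<Longrightarrow> \<bar>s - \<eta> t\<bar> < d1 \<Longrightarrow>
      L2_norm M (\<lambda>x. c s x - c (\<eta> t) x - (s - \<eta> t) * v x) \<le> e1 * \<bar>s - \<eta> t\<bar>"
    using c(1) \<open>e1 > 0\<close> unfolding has_L2_derivative_iff by blast
  have "(\<eta> has_derivative (\<lambda>h. \<eta>' * h)) (at t within S)"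
    using \<eta>(1) by (simp add: has_field_derivative_def)
  then obtain d2 where "d2 > 0" and d2: "\<And>s. s \<in> S \<Longrightarrow> \<bar>s - t\<bar> < d2 \<Longrightarrow>
      \<bar>\<eta> s - \<eta> t - \<eta>' * (s - t)\<bar> \<le> e2 * \<bar>s - t\<bar>"
    using \<open>e2 > 0\<close> unfolding has_derivative_within_alt by (metis real_norm_def)
  have lip: "\<bar>\<eta> s - \<eta> t\<bar> \<le> B * \<bar>s - t\<bar>" if "s \<in> S" "\<bar>s - t\<bar> < d2" for s
  proof -
    have "\<bar>\<eta> s - \<eta> t\<bar> \<le> \<bar>\<eta> s - \<eta> t - \<eta>' * (s - t)\<bar> + \<bar>\<eta>' * (s - t)\<bar>" by simp
    also have "\<dots> \<le> 1 * \<bar>s - t\<bar> + \<bar>\<eta>'\<bar> * \<bar>s - t\<bar>"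
    proof (rule add_mono)
      have "e2 * \<bar>s - t\<bar> \<le> 1 * \<bar>s - t\<bar>" by (rule mult_right_mono) (auto simp: e2_def)
      then show "\<bar>\<eta> s - \<eta> t - \<eta>' * (s - t)\<bar> \<le> 1 * \<bar>s - t\<bar>" using d2[OF that] by linarith
    qed (simp add: abs_mult)
    finally show ?thesis by (simp add: B_def algebra_simps)
  qed
  have "L2_norm M (\<lambda>x. c (\<eta> s) x - c (\<eta> t) x - (s - t) * (\<eta>' * v x)) \<le> e * \<bar>s - t\<bar>"
    if s: "s \<in> S" "\<bar>s - t\<bar> < min d2 (d1 / B)" for s
  proof -
    have "B * \<bar>s - t\<bar> < d1" using s(2) B by (simp add: field_simps)
    then have near: "\<bar>\<eta> s - \<eta> t\<bar> < d1" using lip[of s] s by linarith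
    have T: "\<eta> s \<in> T" "\<eta> t \<in> T" using s \<eta> by auto
    have "(\<lambda>x. c (\<eta> s) x - c (\<eta> t) x - (s - t) * (\<eta>' * v x))
        = (\<lambda>x. (c (\<eta> s) x - c (\<eta> t) x - (\<eta> s - \<eta> t) * v x) + (\<eta> s - \<eta> t - \<eta>' * (s - t)) * v x)"
      by (auto simp: fun_eq_iff algebra_simps)
    then have "L2_norm M (\<lambda>x. c (\<eta> s) x - c (\<eta> t) x - (s - t) * (\<eta>' * v x))
        \<le> L2_norm M (\<lambda>x. c (\<eta> s) x - c (\<eta> t) x - (\<eta> s - \<eta> t) * v x)
          + \<bar>\<eta> s - \<eta> t - \<eta>' * (s - t)\<bar> * L2_norm M v"
      using L2_norm_triangle[of "\<lambda>x. c (\<eta> s) x - c (\<eta> t) x - (\<eta> s - \<eta> t) * v x" M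
          "\<lambda>x. (\<eta> s - \<eta> t - \<eta>' * (s - t)) * v x"] c T by simp
    also have "\<dots> \<le> e1 * (B * \<bar>s - t\<bar>) + (e2 * \<bar>s - t\<bar>) * (L2_norm M v + 1)"
    proof (rule add_mono)
      have "L2_norm M (\<lambda>x. c (\<eta> s) x - c (\<eta> t) x - (\<eta> s - \<eta> t) * v x) \<le> e1 * \<bar>\<eta> s - \<eta> t\<bar>"
        by (rule d1[OF T(1) near])
      also have "\<dots> \<le> e1 * (B * \<bar>s - t\<bar>)"
        using lip[of s] s e12 by (intro mult_left_mono) auto
      finally show "L2_norm M (\<lambda>x. c (\<eta> s) x - c (\<eta> t) x - (\<eta> s - \<eta> t) * v x) \<le> e1 * (B * \<bar>s - t\<bar>)" .
      show "\<bar>\<eta> s - \<eta> t - \<eta>' * (s - t)\<bar> * L2_norm M v \<le> (e2 * \<bar>s - t\<bar>) * (L2_norm M v + 1)"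
        using d2[of s] s e12 by (intro mult_mono) auto
    qed
    also have "\<dots> \<le> e / 2 * \<bar>s - t\<bar> + e / 2 * \<bar>s - t\<bar>"
    proof (rule add_mono)
      show "e1 * (B * \<bar>s - t\<bar>) \<le> e / 2 * \<bar>s - t\<bar>"
        using B by (simp add: e1_def)
      have "e2 * (L2_norm M v + 1) \<le> e / (2 * (L2_norm M v + 1)) * (L2_norm M v + 1)"
        using v1 by (intro mult_right_mono) (auto simp: e2_def)
      also have "\<dots> = e / 2" using v1 by (simp add: field_simps)
      finally show "(e2 * \<bar>s - t\<bar>) * (L2_norm M v + 1) \<le> e / 2 * \<bar>s - t\<bar>"
        using mult_right_mono[of "e2 * (L2_norm M v + 1)" "e / 2" "\<bar>s - t\<bar>"] by (simp add: mult_ac)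
    qed
    finally show ?thesis by simp
  qed
  then show "\<exists>d>0. \<forall>s\<in>S. \<bar>s - t\<bar> < d \<longrightarrow>
      L2_norm M (\<lambda>x. c (\<eta> s) x - c (\<eta> t) x - (s - t) * (\<eta>' * v x)) \<le> e * \<bar>s - t\<bar>"
    using \<open>d1 > 0\<close> \<open>d2 > 0\<close> B by (intro exI[of _ "min d2 (d1 / B)"]) auto
qed

subsection \<open>Completeness\<close>

context finite_measure
begin

lemma L2_const [simp]: "(\<lambda>x. a) \<in> L2_functions M"
  by (simp add: L2_functions_def)

text \<open>The Riesz-Fischer argument: along a subsequence the increments are summable in \<open>L\<^sup>1\<close>, which
  gives a pointwise limit, and Fatou's lemma turns the Cauchy property into convergence to it.\<close>

lemma L2_complete:
  assumes F: "\<And>n. F n \<in> L2_functions M"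
    and Cauchy: "\<And>e. 0 < e \<Longrightarrow> \<exists>n0. \<forall>m\<ge>n0. \<forall>n\<ge>n0. L2_norm M (\<lambda>x. F m x - F n x) < e"
  shows "\<exists>g\<in>L2_functions M. (\<lambda>n. L2_norm M (\<lambda>x. F n x - g x)) \<longlonglongrightarrow> 0"
proof -
  have "\<exists>n0. \<forall>m\<ge>n0. \<forall>n\<ge>n0. L2_norm M (\<lambda>x. F m x - F n x) < (1 / 2) ^ k" for k
    by (rule Cauchy) simp
  then obtain K where K: "\<And>k m n. K k \<le> m \<Longrightarrow> K k \<le> n \<Longrightarrow> L2_norm M (\<lambda>x. F m x - F n x) < (1 / 2) ^ k"
    by metis
  \<comment> \<open>a monotone sequence with \<open>r k \<ge> K k\<close> and \<open>r k \<ge> k\<close>\<close>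
  define r where "r = (\<lambda>k. (\<Sum>i\<le>k. K i) + k)"
  have r: "K k \<le> r k" "r k \<le> r (Suc k)" "k \<le> r k" for k
    by (auto simp: r_def intro: member_le_sum trans_le_add1)
  define h where "h = (\<lambda>k x. \<bar>F (r (Suc k)) x - F (r k) x\<bar>)"
  have meas [measurable]: "F n \<in> borel_measurable M" for n by (intro L2_measurable F)
  have hL2: "h k \<in> L2_functions M" for k
    unfolding h_def using L2_diff[OF F F, of "r (Suc k)" "r k"] by (simp add: L2_functions_def)
  have hint: "integrable M (h k)" for k
    using L2_mult_integrable[OF hL2 L2_const, of k 1] by simp
  define C where "C = L2_norm M (\<lambda>x. 1)"
  have hbound: "(\<integral>x. h k x \<partial>M) \<le> C * (1 / 2) ^ k" for k
  proof -
    have "(\<integral>x. h k x \<partial>M) = L2_inner M (h k) (\<lambda>x. 1)" by (simp add: L2_inner_def)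
    also have "\<dots> \<le> L2_norm M (h k) * C"
      using L2_Cauchy_Schwarz[OF hL2[of k] L2_const[of 1]] by (simp add: C_def abs_le_iff)
    also have "L2_norm M (h k) = L2_norm M (\<lambda>x. F (r (Suc k)) x - F (r k) x)"
      by (simp add: L2_norm_def L2_inner_def h_def)
    also have "\<dots> * C \<le> (1 / 2) ^ k * C"
      using K[of k "r (Suc k)" "r k"] r[of k] by (intro mult_right_mono) (auto simp: C_def)
    finally show ?thesis by (simp add: mult.commute)
  qed
  have "(\<integral>\<^sup>+x. (\<Sum>k. ennreal (h k x)) \<partial>M) = (\<Sum>k. \<integral>\<^sup>+x. ennreal (h k x) \<partial>M)"
    by (rule nn_integral_suminf) (simp add: h_def)
  also have "\<dots> \<le> (\<Sum>k. ennreal (C * (1 / 2) ^ k))"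
  proof (rule suminf_le)
    fix k
    have "(\<integral>\<^sup>+x. ennreal (h k x) \<partial>M) = ennreal (\<integral>x. h k x \<partial>M)"
      by (rule nn_integral_eq_integral[OF hint]) (simp add: h_def)
    then show "(\<integral>\<^sup>+x. ennreal (h k x) \<partial>M) \<le> ennreal (C * (1 / 2) ^ k)"
      using hbound[of k] by (simp add: ennreal_leI)
  qed auto
  also have "\<dots> = ennreal (\<Sum>k. C * (1 / 2) ^ k)"
    by (rule suminf_ennreal2) (auto simp: C_def intro!: summable_mult summable_geometric)
  finally have "(\<integral>\<^sup>+x. (\<Sum>k. ennreal (h k x)) \<partial>M) \<noteq> \<infinity>"
    by (metis ennreal_less_top infinity_ennreal_def leD)
  then have "AE x in M. (\<Sum>k. ennreal (h k x)) \<noteq> \<infinity>"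
    by (intro nn_integral_noteq_infinite) (auto simp: h_def)
  then have conv: "AE x in M. convergent (\<lambda>n. F (r n) x)"
  proof eventually_elim
    fix x assume "(\<Sum>k. ennreal (h k x)) \<noteq> \<infinity>"
    then have "summable (\<lambda>k. h k x)"
      by (intro summable_suminf_not_top) (auto simp: h_def)
    then have "summable (\<lambda>k. F (r (Suc k)) x - F (r k) x)"
      unfolding h_def by (rule summable_rabs_cancel)
    then have "convergent (\<lambda>n. \<Sum>k<n. F (r (Suc k)) x - F (r k) x)"
      by (simp add: summable_iff_convergent)
    then have "convergent (\<lambda>n. F (r n) x - F (r 0) x)"
      by (simp only: sum_lessThan_telescope[of "\<lambda>n. F (r n) x"])
    then have "convergent (\<lambda>n. F (r 0) x + (F (r n) x - F (r 0) x))"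
      by (intro convergent_add convergent_const)
    then show "convergent (\<lambda>n. F (r n) x)" by simp
  qed
  define g where "g = (\<lambda>x. lim (\<lambda>n. F (r n) x))"
  have [measurable]: "g \<in> borel_measurable M" unfolding g_def by measurable
  have lim: "AE x in M. (\<lambda>n. F (r n) x) \<longlonglongrightarrow> g x"
    using conv by eventually_elim (simp add: g_def convergent_LIMSEQ_iff)
  have Fatou: "(\<integral>\<^sup>+x. ennreal ((F n x - g x)\<^sup>2) \<partial>M) \<le> ennreal (e\<^sup>2)"
    if "\<And>k. n0 \<le> k \<Longrightarrow> L2_norm M (\<lambda>x. F n x - F k x) < e" for n n0 and e :: real
  proof -
    have "(\<integral>\<^sup>+x. ennreal ((F n x - g x)\<^sup>2) \<partial>M)
        = (\<integral>\<^sup>+x. liminf (\<lambda>k. ennreal ((F n x - F (r k) x)\<^sup>2)) \<partial>M)"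
    proof (rule nn_integral_cong_AE)
      show "AE x in M. ennreal ((F n x - g x)\<^sup>2) = liminf (\<lambda>k. ennreal ((F n x - F (r k) x)\<^sup>2))"
        using lim
      proof eventually_elim
        fix x assume "(\<lambda>n. F (r n) x) \<longlonglongrightarrow> g x"
        then have "(\<lambda>k. ennreal ((F n x - F (r k) x)\<^sup>2)) \<longlonglongrightarrow> ennreal ((F n x - g x)\<^sup>2)"
          by (intro tendsto_intros tendsto_ennrealI)
        then show "ennreal ((F n x - g x)\<^sup>2) = liminf (\<lambda>k. ennreal ((F n x - F (r k) x)\<^sup>2))"
          by (intro lim_imp_Liminf[symmetric]) auto
      qed
    qed
    also have "\<dots> \<le> liminf (\<lambda>k. \<integral>\<^sup>+x. ennreal ((F n x - F (r k) x)\<^sup>2) \<partial>M)"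
      by (rule nn_integral_liminf) simp
    also have "\<dots> \<le> ennreal (e\<^sup>2)"
    proof (rule Liminf_le)
      have "(\<integral>\<^sup>+x. ennreal ((F n x - F (r k) x)\<^sup>2) \<partial>M) \<le> ennreal (e\<^sup>2)" if "n0 \<le> k" for k
      proof -
        have "(\<integral>\<^sup>+x. ennreal ((F n x - F (r k) x)\<^sup>2) \<partial>M) = ennreal (\<integral>x. (F n x - F (r k) x)\<^sup>2 \<partial>M)"
          using L2_diff[OF F F, of n "r k"] by (intro nn_integral_eq_integral) (auto simp: L2_functions_def)
        also have "(\<integral>x. (F n x - F (r k) x)\<^sup>2 \<partial>M) = (L2_norm M (\<lambda>x. F n x - F (r k) x))\<^sup>2"
          by (rule L2_norm_power2_integral[symmetric])
        also have "\<dots> \<le> e\<^sup>2"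
          using \<open>\<And>k. n0 \<le> k \<Longrightarrow> L2_norm M (\<lambda>x. F n x - F k x) < e\<close>[of "r k"] that r(3)[of k]
          by (intro power_mono) auto
        finally show ?thesis by (simp add: ennreal_leI)
      qed
      then show "\<forall>\<^sub>F k in sequentially. (\<integral>\<^sup>+x. ennreal ((F n x - F (r k) x)\<^sup>2) \<partial>M) \<le> ennreal (e\<^sup>2)"
        by (rule eventually_sequentiallyI)
    qed simp
    finally show ?thesis .
  qed
  have dL2: "(\<lambda>x. F n x - g x) \<in> L2_functions M \<and> L2_norm M (\<lambda>x. F n x - g x) \<le> e"
    if "\<And>k. n0 \<le> k \<Longrightarrow> L2_norm M (\<lambda>x. F n x - F k x) < e" "0 \<le> e" for n n0 e
  proof -
    have le: "(\<integral>\<^sup>+x. ennreal ((F n x - g x)\<^sup>2) \<partial>M) \<le> ennreal (e\<^sup>2)"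
      using Fatou that(1) by blast
    have int: "integrable M (\<lambda>x. (F n x - g x)\<^sup>2)"
      using le le_less_trans[OF le ennreal_less_top] by (intro integrableI_nonneg) auto
    have "ennreal (\<integral>x. (F n x - g x)\<^sup>2 \<partial>M) \<le> ennreal (e\<^sup>2)"
      using le nn_integral_eq_integral[OF int] by simp
    then have "(L2_norm M (\<lambda>x. F n x - g x))\<^sup>2 \<le> e\<^sup>2"
      unfolding L2_norm_power2_integral by (simp add: ennreal_le_iff)
    then show ?thesis using int that(2) by (auto simp: L2_functions_def intro: power2_le_imp_le[OF _ that(2)])
  qed
  have "g \<in> L2_functions M"
  proof -
    obtain n0 where "\<forall>m\<ge>n0. \<forall>n\<ge>n0. L2_norm M (\<lambda>x. F m x - F n x) < 1" using Cauchy[of 1] by auto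
    then have "(\<lambda>x. F n0 x - g x) \<in> L2_functions M" using dL2[of n0 n0 1] by auto
    then have "(\<lambda>x. F n0 x - (F n0 x - g x)) \<in> L2_functions M" by (rule L2_diff[OF F])
    then show ?thesis by simp
  qed
  moreover have "(\<lambda>n. L2_norm M (\<lambda>x. F n x - g x)) \<longlonglongrightarrow> 0"
  proof (rule LIMSEQ_I)
    fix e :: real assume "0 < e"
    then obtain n0 where n0: "\<forall>m\<ge>n0. \<forall>n\<ge>n0. L2_norm M (\<lambda>x. F m x - F n x) < e / 2"
      using Cauchy[of "e / 2"] by auto
    have "norm (L2_norm M (\<lambda>x. F n x - g x) - 0) < e" if "n0 \<le> n" for n
      using dL2[of n0 n "e / 2"] n0 that \<open>0 < e\<close> by auto
    then show "\<exists>no. \<forall>n\<ge>no. norm (L2_norm M (\<lambda>x. F n x - g x) - 0) < e" by blast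
  qed
  ultimately show ?thesis by blast
qed

end

section \<open>The radial coordinate\<close>

lemma C_infty_inverse_comp:
  assumes "C_infty f S" "open S" "\<And>x. x \<in> S \<Longrightarrow> 0 < f x"
  shows "C_infty (\<lambda>x. inverse (f x :: real)) S"
  by (rule C_infty_compose[OF C_infty_inverse assms(1,2)]) (use assms(3) in auto)

lemma C_infty_sqrt_comp:
  assumes "C_infty f S" "open S" "\<And>x. x \<in> S \<Longrightarrow> 0 < f x"
  shows "C_infty (\<lambda>x. sqrt (f x)) S"
  by (rule C_infty_compose[OF C_infty_sqrt assms(1,2)]) (use assms(3) in auto)

lemma C_infty_divide:
  fixes f g :: "'a::euclidean_space \<Rightarrow> real"
  assumes "C_infty f S" "C_infty g S" "open S" "\<And>x. x \<in> S \<Longrightarrow> 0 < g x"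
  shows "C_infty (\<lambda>x. f x / g x) S"
  unfolding divide_inverse by (intro C_infty_mult C_infty_inverse_comp assms)

lemma C_infty_power:
  fixes f :: "'a::euclidean_space \<Rightarrow> real"
  assumes "C_infty f S" "open S"
  shows "C_infty (\<lambda>x. f x ^ n) S"
  by (induction n) (simp_all add: C_infty_const C_infty_mult assms)

lemma C_infty_power2: "open S \<Longrightarrow> C_infty (power2 :: real \<Rightarrow> real) S"
  using C_infty_power[OF C_infty_ident, of S 2] by simp

lemma filterlim_W_imp_exists:
  fixes w :: "real \<Rightarrow> real"
  assumes "filterlim w at_bot (at_right 0)" "filterlim w at_top at_top"
  shows "\<exists>r>0. w r \<le> s" and "\<exists>R>max 0 r. s \<le> w R"
proof -
  have "\<forall>\<^sub>F x in at_right 0. w x \<le> s"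
    using assms(1) by (simp add: filterlim_at_bot)
  then have "\<forall>\<^sub>F x in at_right 0. w x \<le> s \<and> 0 < x"
    using eventually_at_right_less by (rule eventually_conj)
  then show "\<exists>r>0. w r \<le> s"
    using eventually_happens'[OF trivial_limit_at_right_real] by blast
  have "\<forall>\<^sub>F x in at_top. s \<le> w x"
    using assms(2) by (simp add: filterlim_at_top)
  then have "\<forall>\<^sub>F x in at_top. s \<le> w x \<and> max 0 r < x"
    using eventually_gt_at_top by (rule eventually_conj)
  then show "\<exists>R>max 0 r. s \<le> w R"
    using eventually_happens'[OF trivial_limit_at_top_linorder] by blast
qed

locale radial =
  fixes C1 C2 :: "real \<Rightarrow> real"
  assumes C1_smooth: "C_infty C1 {0<..}" and C2_smooth: "C_infty C2 {0<..}"
    and C1_pos: "\<And>m. 0 < m \<Longrightarrow> 0 < C1 m"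
    and C2_gt: "\<And>m. 0 < m \<Longrightarrow> - (1 / m) * C1 m < C2 m"
    and W_bot: "filterlim (W C1 C2) at_bot (at_right 0)"
    and W_top: "filterlim (W C1 C2) at_top at_top"
begin

abbreviation "w \<equiv> W C1 C2"
abbreviation "g \<equiv> g2 C1 C2"
abbreviation "C1' \<equiv> deriv C1"
abbreviation "C2' \<equiv> deriv C2"

lemma C1_deriv: "0 < m \<Longrightarrow> (C1 has_real_derivative C1' m) (at m)"
  and C2_deriv: "0 < m \<Longrightarrow> (C2 has_real_derivative C2' m) (at m)"
  using C_infty_deriv(1)[OF C1_smooth] C_infty_deriv(1)[OF C2_smooth] by auto

lemma C12_pos: "0 < m \<Longrightarrow> 0 < C1 m + C2 m * m"
  using C2_gt[of m] by (simp add: field_simps)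

lemma g_pos: "0 < r \<Longrightarrow> 0 < g r"
  using C12_pos[of "r\<^sup>2"] by (simp add: g2_def)

lemma C1_square_smooth: "C_infty (\<lambda>r. C1 (r\<^sup>2)) {0<..}"
  by (rule C_infty_compose[OF C1_smooth]) (auto intro: C_infty_power2)

lemma C1'_square_smooth: "C_infty (\<lambda>r. C1' (r\<^sup>2)) {0<..}"
  by (rule C_infty_compose[OF C_infty_deriv(2)[OF C1_smooth]])
    (auto intro: C_infty_power2)

lemma C2_square_smooth: "C_infty (\<lambda>r. C2 (r\<^sup>2)) {0<..}"
  by (rule C_infty_compose[OF C2_smooth]) (auto intro: C_infty_power2)

lemma g_smooth: "C_infty g {0<..}"
  unfolding g2_def[abs_def]
  by (intro C_infty_mult C_infty_const C_infty_add C1_square_smooth C2_square_smooth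
      C_infty_power C_infty_ident) auto

lemma C1_square_deriv: "0 < r \<Longrightarrow> ((\<lambda>r. C1 (r\<^sup>2)) has_real_derivative C1' (r\<^sup>2) * (2 * r)) (at r)"
  by (rule DERIV_chain2[OF C1_deriv]) (auto intro!: derivative_eq_intros)

lemma C2_square_deriv: "0 < r \<Longrightarrow> ((\<lambda>r. C2 (r\<^sup>2)) has_real_derivative C2' (r\<^sup>2) * (2 * r)) (at r)"
  by (rule DERIV_chain2[OF C2_deriv]) (auto intro!: derivative_eq_intros)

lemma g_deriv:
  assumes "0 < r"
  shows "(g has_real_derivative 4 * (2 * r * C1' (r\<^sup>2) + 2 * r ^ 3 * C2' (r\<^sup>2) + 2 * r * C2 (r\<^sup>2))) (at r)"
proof -
  have "(g has_real_derivative 4 * (C1' (r\<^sup>2) * (2 * r)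
      + (C2' (r\<^sup>2) * (2 * r) * r\<^sup>2 + C2 (r\<^sup>2) * (2 * r)))) (at r)"
    unfolding g2_def[abs_def]
    by (auto intro!: derivative_eq_intros C1_square_deriv[OF assms] C2_square_deriv[OF assms])
  then show ?thesis by (simp add: power2_eq_square power3_eq_cube algebra_simps)
qed

lemma W_deriv:
  assumes "0 < r"
  shows "(w has_real_derivative sqrt (g r)) (at r)"
proof -
  define a b where "a = min 1 r / 2" and "b = max 1 r + 1"
  have ab: "0 < a" "a < r" "r < b" "a < 1" "1 < b" using assms by (auto simp: a_def b_def min_def)
  have "continuous_on {a..b} (\<lambda>\<rho>. sqrt (g \<rho>))"
    using ab(1) by (intro continuous_intros continuous_on_subset[OF C_infty_continuous[OF g_smooth]]) auto
  then have "(w has_vector_derivative sqrt (g r)) (at r within {a..b})"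
    unfolding W_def[abs_def] by (intro interval_integral_FTC2) (use ab in auto)
  then show ?thesis
    using ab by (subst (asm) at_within_interior)
      (auto simp: interior_atLeastAtMost_real has_real_derivative_iff_has_vector_derivative)
qed

lemma W_strict_mono:
  assumes "0 < r" "r < R"
  shows "w r < w R"
  using assms by (intro DERIV_pos_imp_increasing[OF assms(2)]) (meson W_deriv g_pos less_le_trans real_sqrt_gt_zero)

lemma W_mono_iff: "0 < r \<Longrightarrow> 0 < R \<Longrightarrow> w r \<le> w R \<longleftrightarrow> r \<le> R"
  using W_strict_mono by (metis leD le_less_linear order.order_iff_strict)

lemma W_surj: "\<exists>r>0. w r = s"
proof -
  obtain r where r: "0 < r" "w r \<le> s" using filterlim_W_imp_exists(1)[OF W_bot W_top] by blast
  obtain R where R: "max 0 r < R" "s \<le> w R" using filterlim_W_imp_exists(2)[OF W_bot W_top] by blast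
  have "\<exists>x\<ge>r. x \<le> R \<and> w x = s"
    using r R by (intro IVT) (auto intro!: DERIV_isCont[OF W_deriv])
  then obtain x where "r \<le> x" "w x = s" by blast
  then show ?thesis using r(1) by (intro exI[of _ x]) simp
qed

definition rho :: "real \<Rightarrow> real" where
  "rho s = (SOME r. 0 < r \<and> w r = s)"

lemma rho_pos [simp]: "0 < rho s" and W_rho [simp]: "w (rho s) = s"
  using someI_ex[OF W_surj[of s]] by (auto simp: rho_def Bex_def)

lemma rho_nonzero [simp]: "rho s \<noteq> 0"
  using rho_pos[of s] by linarith

lemma rho_W: "0 < r \<Longrightarrow> rho (w r) = r"
  by (metis W_mono_iff W_rho order_antisym order_refl rho_pos)

lemma rho_deriv: "(rho has_real_derivative inverse (sqrt (g (rho s)))) (at s)"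
proof (rule DERIV_inverse_function[of w])
  show "(w has_real_derivative sqrt (g (rho s))) (at (rho s))" by (intro W_deriv rho_pos)
  show "sqrt (g (rho s)) \<noteq> 0" using g_pos[OF rho_pos, of s] by simp
  show "s - 1 < s" "s < s + 1" by auto
  define d where "d = rho s / 2"
  have "0 < d" by (simp add: d_def)
  have pos: "0 < z" if "\<bar>z - rho s\<bar> \<le> d" for z
    using that rho_pos[of s] unfolding d_def abs_le_iff by linarith
  have "isCont rho (w (rho s))"
  proof (rule isCont_inverse_function[OF \<open>0 < d\<close>, where f = w and x = "rho s"])
    fix z assume "\<bar>z - rho s\<bar> \<le> d"
    then have "0 < z" by (rule pos)
    then show "rho (w z) = z" "isCont w z" by (auto intro: rho_W DERIV_isCont[OF W_deriv])
  qed
  then show "isCont rho s" by simp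
qed simp

text \<open>By bootstrapping: the derivative of the inverse function is a smooth function of its value.\<close>

lemma rho_smooth: "C_infty rho UNIV"
proof (rule C_infty_bootstrap)
  show "Ck_on k (\<lambda>s. inverse (sqrt (g (rho s)))) UNIV" if "Ck_on k rho UNIV" for k
  proof -
    have "C_infty (\<lambda>r. inverse (sqrt (g r))) {0<..}"
      by (intro C_infty_inverse_comp C_infty_sqrt_comp g_smooth) (auto simp: g_pos)
    then show ?thesis
      by (intro Ck_on_compose[where T = "{0<..}" and g = rho and f = "\<lambda>r. inverse (sqrt (g r))", OF _ _ _ _ that])
        (auto simp: C_infty_def)
  qed
qed (auto intro: rho_deriv)

lemma W_range: "0 < r \<Longrightarrow> \<bar>w r\<bar> \<le> B \<Longrightarrow> r \<in> {rho (- B)..rho B}"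
  using W_mono_iff[of "rho (- B)" r] W_mono_iff[of r "rho B"] by (simp add: abs_le_iff)

lemma coefficient_bounds:
  assumes "0 < a"
  shows "\<exists>k>0. \<exists>K>0. \<forall>r\<in>{a..b}. k\<^sup>2 \<le> 4 * C1 (r\<^sup>2) \<and> k\<^sup>2 \<le> g r \<and> 4 * C1 (r\<^sup>2) \<le> K\<^sup>2 \<and> g r \<le> K\<^sup>2"
proof (cases "a \<le> b")
  case False
  then show ?thesis by (auto intro!: exI[of _ 1])
next
  case True
  define lo where "lo r = min (4 * C1 (r\<^sup>2)) (g r)" for r
  define hi where "hi r = max (4 * C1 (r\<^sup>2)) (g r)" for r
  have cont: "continuous_on {a..b} (\<lambda>r. C1 (r\<^sup>2))" "continuous_on {a..b} g"
    using assms by (intro continuous_on_subset[OF C_infty_continuous[OF C1_square_smooth]]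
        continuous_on_subset[OF C_infty_continuous[OF g_smooth]]; force)+
  then have "continuous_on {a..b} lo" "continuous_on {a..b} hi"
    unfolding lo_def[abs_def] hi_def[abs_def] by (intro continuous_intros; simp)+
  moreover have "{a..b} \<noteq> {}" using True by simp
  ultimately obtain p q where p: "p \<in> {a..b}" "\<And>r. r \<in> {a..b} \<Longrightarrow> lo p \<le> lo r"
    and q: "q \<in> {a..b}" "\<And>r. r \<in> {a..b} \<Longrightarrow> hi r \<le> hi q"
    using continuous_attains_inf[OF compact_Icc, of a b lo] continuous_attains_sup[OF compact_Icc, of a b hi]
    by blast
  have "0 < lo p" "0 < hi q"
    using p(1) q(1) assms C1_pos[of "p\<^sup>2"] C1_pos[of "q\<^sup>2"] g_pos[of p] g_pos[of q]
    by (auto simp: lo_def hi_def less_max_iff_disj)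
  moreover have "(sqrt (lo p))\<^sup>2 \<le> 4 * C1 (r\<^sup>2) \<and> (sqrt (lo p))\<^sup>2 \<le> g r
      \<and> 4 * C1 (r\<^sup>2) \<le> (sqrt (hi q))\<^sup>2 \<and> g r \<le> (sqrt (hi q))\<^sup>2" if "r \<in> {a..b}" for r
    using p(2)[OF that] q(2)[OF that] calculation by (simp add: lo_def[of r] hi_def[of r])
  ultimately show ?thesis by (meson real_sqrt_gt_zero)
qed

text \<open>In terms of \<open>s = W (r)\<close> and \<open>J = (C1 r\<^sup>2 \<theta>')\<^sup>2\<close> the energy of a geodesic is \<open>s'\<^sup>2 + potential J s\<close>; so
  its radial equation is \<open>s'' = radial_force J r\<close>, the force being minus half of the derivative of the
  potential.\<close>

definition potential :: "real \<Rightarrow> real \<Rightarrow> real" where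
  "potential J s = 4 * J / ((rho s)\<^sup>2 * C1 ((rho s)\<^sup>2))"

definition radial_force :: "real \<Rightarrow> real \<Rightarrow> real" where
  "radial_force J r = 4 * J * (C1 (r\<^sup>2) + r\<^sup>2 * C1' (r\<^sup>2)) / ((C1 (r\<^sup>2))\<^sup>2 * r ^ 3 * sqrt (g r))"

lemma radial_force_smooth: "C_infty (\<lambda>s. radial_force J (rho s)) UNIV"
proof (rule C_infty_compose[OF _ rho_smooth])
  show "C_infty (radial_force J) {0<..}"
    unfolding radial_force_def[abs_def]
    by (intro C_infty_divide C_infty_mult C_infty_const C_infty_add C1_square_smooth C1'_square_smooth
        C_infty_power C_infty_ident C_infty_sqrt_comp g_smooth)
      (auto intro!: mult_pos_pos zero_less_power C1_pos simp: g_pos)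
qed auto

lemma potential_nonneg: "0 \<le> J \<Longrightarrow> 0 \<le> potential J s"
  using C1_pos[of "(rho s)\<^sup>2"] by (auto simp: potential_def intro!: divide_nonneg_pos)

lemma potential_deriv: "(potential J has_real_derivative - 2 * radial_force J (rho s)) (at s)"
proof -
  let ?r = "rho s"
  have pos: "0 < ?r" "0 < C1 (?r\<^sup>2)" "0 < sqrt (g ?r)"
    using C1_pos g_pos by auto
  have "((\<lambda>r. 4 * J / (r\<^sup>2 * C1 (r\<^sup>2))) has_real_derivative
      - (4 * J * (2 * ?r * C1 (?r\<^sup>2) + ?r\<^sup>2 * (C1' (?r\<^sup>2) * (2 * ?r)))) / (?r\<^sup>2 * C1 (?r\<^sup>2))\<^sup>2) (at ?r)"
  proof -
    have "((\<lambda>r. r\<^sup>2 * C1 (r\<^sup>2)) has_real_derivative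
        2 * ?r * C1 (?r\<^sup>2) + ?r\<^sup>2 * (C1' (?r\<^sup>2) * (2 * ?r))) (at ?r)"
      by (auto intro!: derivative_eq_intros C1_square_deriv[OF rho_pos])
    from DERIV_divide[OF DERIV_const[of "4 * J"] this]
    show ?thesis using pos by (simp add: power2_eq_square)
  qed
  from DERIV_chain2[OF this rho_deriv]
  have "(potential J has_real_derivative
      - (4 * J * (2 * ?r * C1 (?r\<^sup>2) + ?r\<^sup>2 * (C1' (?r\<^sup>2) * (2 * ?r)))) / (?r\<^sup>2 * C1 (?r\<^sup>2))\<^sup>2
        * inverse (sqrt (g ?r))) (at s)"
    unfolding potential_def[abs_def] .
  moreover have "- (4 * J * (2 * ?r * C1 (?r\<^sup>2) + ?r\<^sup>2 * (C1' (?r\<^sup>2) * (2 * ?r)))) / (?r\<^sup>2 * C1 (?r\<^sup>2))\<^sup>2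
        * inverse (sqrt (g ?r)) = - 2 * radial_force J ?r"
    using pos unfolding radial_force_def
    by (simp add: divide_simps) (simp add: eval_nat_numeral algebra_simps)
  ultimately show ?thesis by simp
qed

end

section \<open>The geodesic distance\<close>

lemma derivative_bound_integral:
  fixes f f' g :: "real \<Rightarrow> real"
  assumes f: "\<And>x. x \<in> {0..1} \<Longrightarrow> (f has_real_derivative f' x) (at x within {0..1})"
    and le: "\<And>x. x \<in> {0..1} \<Longrightarrow> \<bar>f' x\<bar> \<le> g x" and g: "continuous_on {0..1} g" and t: "t \<in> {0..1}"
  shows "\<bar>f t - f 0\<bar> \<le> integral {0..1} g"
proof -
  have sub: "{0..t} \<subseteq> {0..1}" using t by auto
  have int: "g integrable_on {0..t}" "g integrable_on {0..1}"
    using g continuous_on_subset[OF g sub] by (auto intro: integrable_continuous_real)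
  have "(f' has_integral (f t - f 0)) {0..t}"
  proof (rule fundamental_theorem_of_calculus)
    fix x assume "x \<in> {0..t}"
    then show "(f has_vector_derivative f' x) (at x within {0..t})"
      using has_field_derivative_subset[OF f sub, of x] sub
      by (auto simp: has_real_derivative_iff_has_vector_derivative)
  qed (use t in auto)
  then have "norm (f t - f 0) \<le> integral {0..t} g"
    using integral_norm_bound_integral[of f' "{0..t}" g] int(1) le sub
    by (auto simp: integral_unique has_integral_integrable)
  also have "\<dots> \<le> integral {0..1} g"
    using sub int by (rule integral_subset_le) (use le in force)
  finally show ?thesis by simp
qed

lemma integral_reparametrize:
  fixes f \<eta> \<eta>' :: "real \<Rightarrow> real"
  assumes f: "continuous_on {0..1} f" and \<eta>: "\<eta> ` {0..1} \<subseteq> {0..1}"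
    and d: "\<And>t. t \<in> {0..1} \<Longrightarrow> (\<eta> has_real_derivative \<eta>' t) (at t within {0..1})"
  shows "((\<lambda>t. \<eta>' t * f (\<eta> t)) has_integral (integral {0..\<eta> 1} f - integral {0..\<eta> 0} f)) {0..1}"
proof (rule fundamental_theorem_of_calculus)
  fix t :: real assume t: "t \<in> {0..1}"
  have A: "((\<lambda>u. integral {0..u} f) has_real_derivative f u) (at u within {0..1})" if "u \<in> {0..1}" for u
    using integral_has_vector_derivative[OF f that]
    by (simp add: has_real_derivative_iff_has_vector_derivative)
  have "\<eta> t \<in> {0..1}" using \<eta> t by blast
  then have "((\<lambda>u. integral {0..u} f) has_real_derivative f (\<eta> t)) (at (\<eta> t) within \<eta> ` {0..1})"
    by (intro has_field_derivative_subset[OF A \<eta>])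
  then have "((\<lambda>t. integral {0..\<eta> t} f) has_real_derivative f (\<eta> t) * \<eta>' t) (at t within {0..1})"
    using DERIV_image_chain[OF _ d[OF t]] by (simp add: comp_def)
  then show "((\<lambda>t. integral {0..\<eta> t} f) has_vector_derivative \<eta>' t * f (\<eta> t)) (at t within {0..1})"
    by (simp add: has_real_derivative_iff_has_vector_derivative mult.commute)
qed simp

lemma metric_G_cmult:
  "metric_G M C1 C2 f (\<lambda>x. a * h x) (\<lambda>x. a * h x) = a\<^sup>2 * metric_G M C1 C2 f h h"
  by (simp add: metric_G_def power2_eq_square algebra_simps)

locale L2_radial = finite_measure M + radial C1 C2 for M :: "'m measure" and C1 C2
begin

abbreviation "L2 \<equiv> L2_functions M"
abbreviation "L2nz \<equiv> L2_nonzero_functions M"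
abbreviation "ip \<equiv> L2_inner M"
abbreviation "nrm \<equiv> L2_norm M"
abbreviation "G \<equiv> metric_G M C1 C2"
abbreviation "gdist \<equiv> geodesic_dist M G"
abbreviation "speed c v t \<equiv> sqrt (G (c t) (v t) (v t))"

lemma L2nz_iff: "f \<in> L2nz \<longleftrightarrow> f \<in> L2 \<and> 0 < nrm f"
  using L2_norm_eq_0_iff[of f M] L2_norm_nonneg[of M f]
  by (auto simp: L2_nonzero_functions_def order.strict_iff_order)

lemma G_cong_AE:
  assumes "f \<in> L2" "f' \<in> L2" "AE x in M. f x = f' x" "h \<in> L2" "k \<in> L2"
  shows "G f h k = G f' h k"
  using L2_inner_cong_AE[OF assms(1,2) assms(4,4) assms(3)] L2_inner_cong_AE[OF assms(1,2) assms(5,5) assms(3)]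
    L2_inner_cong_AE[OF assms(1,2) assms(1,2) assms(3,3)]
  by (simp add: metric_G_def)

text \<open>The metric splits orthogonally into its radial part, with weight \<open>g2\<close>, and its spherical
  part, with weight \<open>4 C1\<close>; the two-sided bounds compare each weight with a constant.\<close>

lemma G_split:
  assumes "f \<in> L2nz"
  shows "G f h h = 4 * C1 ((nrm f)\<^sup>2) * (ip h h - (ip f h / nrm f)\<^sup>2) + g (nrm f) * (ip f h / nrm f)\<^sup>2"
proof -
  have r: "ip f f \<noteq> 0" using assms by (simp add: L2nz_iff L2_norm_def)
  show ?thesis
    unfolding metric_G_def g2_def power_divide L2_norm_power2 using r
    by (simp add: field_simps power2_eq_square)
qed

lemma radial_part_le:
  assumes "f \<in> L2nz" "h \<in> L2"
  shows "(ip f h / nrm f)\<^sup>2 \<le> ip h h"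
proof -
  have "0 < ip f f" using assms(1) by (simp add: L2nz_iff L2_norm_def)
  then show ?thesis
    using L2_Cauchy_Schwarz_square[of f M h] assms by (simp add: L2nz_iff power_divide field_simps)
qed

lemma G_ge_radial:
  assumes "f \<in> L2nz" "h \<in> L2"
  shows "g (nrm f) * (ip f h / nrm f)\<^sup>2 \<le> G f h h"
  using radial_part_le[OF assms] C1_pos[of "(nrm f)\<^sup>2"] assms(1)
  unfolding G_split[OF assms(1)] by (simp add: L2nz_iff del: L2_norm_power2)

lemma G_lower:
  assumes "f \<in> L2nz" "h \<in> L2" "k\<^sup>2 \<le> 4 * C1 ((nrm f)\<^sup>2)" "k\<^sup>2 \<le> g (nrm f)"
  shows "k\<^sup>2 * ip h h \<le> G f h h"
proof -
  let ?p = "(ip f h / nrm f)\<^sup>2"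
  have "k\<^sup>2 * ip h h = k\<^sup>2 * (ip h h - ?p) + k\<^sup>2 * ?p" by (simp add: algebra_simps)
  also have "\<dots> \<le> 4 * C1 ((nrm f)\<^sup>2) * (ip h h - ?p) + g (nrm f) * ?p"
    using radial_part_le[OF assms(1,2)] assms(3,4) by (intro add_mono mult_right_mono) auto
  finally show ?thesis by (simp add: G_split[OF assms(1)])
qed

lemma G_upper:
  assumes "f \<in> L2nz" "h \<in> L2" "4 * C1 ((nrm f)\<^sup>2) \<le> K\<^sup>2" "g (nrm f) \<le> K\<^sup>2"
  shows "G f h h \<le> K\<^sup>2 * ip h h"
proof -
  let ?p = "(ip f h / nrm f)\<^sup>2"
  have "G f h h \<le> K\<^sup>2 * (ip h h - ?p) + K\<^sup>2 * ?p"
    unfolding G_split[OF assms(1)]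
    using radial_part_le[OF assms(1,2)] assms(3,4) by (intro add_mono mult_right_mono) auto
  then show ?thesis by (simp add: algebra_simps)
qed

lemma G_nonneg: "f \<in> L2nz \<Longrightarrow> h \<in> L2 \<Longrightarrow> 0 \<le> G f h h"
  using G_ge_radial[of f h] g_pos[of "nrm f"]
  by (meson L2nz_iff less_imp_le mult_nonneg_nonneg order_trans zero_le_power2)

subsection \<open>Paths\<close>

lemma pathD:
  assumes "L2_C1_path M c v" "t \<in> {0..1}"
  shows "c t \<in> L2nz" "c t \<in> L2" "0 < nrm (c t)" "v t \<in> L2" "has_L2_derivative M c (v t) t {0..1}"
    "((\<lambda>s. nrm (\<lambda>x. v s x - v t x)) \<longlongrightarrow> 0) (at t within {0..1})"
  using assms unfolding L2_C1_path_def by (auto simp: L2nz_iff)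

lemma speed_continuous:
  assumes p: "L2_C1_path M c v"
  shows "continuous_on {0..1} (speed c v)"
  unfolding continuous_on_def
proof
  fix t :: real assume t: "t \<in> {0..1}"
  have ev: "\<forall>\<^sub>F s in at t within {0..1}. s \<in> {0..1}"
    by (auto simp: eventually_at intro!: exI[of _ 1])
  have c: "((\<lambda>s. nrm (\<lambda>x. c s x - c t x)) \<longlongrightarrow> 0) (at t within {0..1})"
    by (rule has_L2_derivative_continuous[OF pathD(5)[OF p t] t pathD(2)[OF p] pathD(4)[OF p t]])
  have ev': "\<forall>\<^sub>F s in at t within {0..1}. c s \<in> L2" "\<forall>\<^sub>F s in at t within {0..1}. v s \<in> L2"
    using ev by (eventually_elim, use pathD[OF p] in blast)+
  note lim = L2_inner_tendsto[OF c c ev'(1,1)] L2_inner_tendsto[OF c pathD(6)[OF p t] ev']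
    L2_inner_tendsto[OF pathD(6)[OF p t] pathD(6)[OF p t] ev'(2,2)]
  have pos: "0 < ip (c t) (c t)" using pathD(3)[OF p t] by (simp add: L2_norm_def)
  have lim': "((\<lambda>s. ip (c s) (c s)) \<longlongrightarrow> ip (c t) (c t)) (at t within {0..1})"
    "((\<lambda>s. ip (c s) (v s)) \<longlongrightarrow> ip (c t) (v t)) (at t within {0..1})"
    "((\<lambda>s. ip (v s) (v s)) \<longlongrightarrow> ip (v t) (v t)) (at t within {0..1})"
    using pathD[OF p t] by (auto intro!: lim)
  have "((\<lambda>s. C1 (ip (c s) (c s))) \<longlongrightarrow> C1 (ip (c t) (c t))) (at t within {0..1})"
    "((\<lambda>s. C2 (ip (c s) (c s))) \<longlongrightarrow> C2 (ip (c t) (c t))) (at t within {0..1})"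
    using DERIV_isCont[OF C1_deriv[OF pos]] DERIV_isCont[OF C2_deriv[OF pos]] lim'(1)
    by (auto intro: isCont_tendsto_compose)
  then show "(speed c v \<longlongrightarrow> speed c v t) (at t within {0..1})"
    unfolding metric_G_def L2_norm_power2 using lim' by (intro tendsto_intros)
qed

lemma path_length_nonneg: "L2_C1_path M c v \<Longrightarrow> 0 \<le> path_length G c v"
  unfolding path_length_def
  by (intro integral_nonneg integrable_continuous_real speed_continuous)
    (auto intro!: G_nonneg dest: pathD)

text \<open>The derivative of \<open>W\<close> of the norm is, up to sign, the length of the radial part of the velocity.\<close>

lemma W_variation_le_length:
  assumes p: "L2_C1_path M c v" and t: "t \<in> {0..1}"
  shows "\<bar>w (nrm (c t)) - w (nrm (c 0))\<bar> \<le> path_length G c v"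
  unfolding path_length_def
proof (rule derivative_bound_integral[where f' = "\<lambda>t. sqrt (g (nrm (c t))) * (ip (c t) (v t) / nrm (c t))"])
  fix t :: real assume t: "t \<in> {0..1}"
  note P = pathD[OF p t]
  have pos: "0 < ip (c t) (c t)" using P(3) by (simp add: L2_norm_def)
  have "((\<lambda>s. ip (c s) (c s)) has_real_derivative ip (v t) (c t) + ip (c t) (v t)) (at t within {0..1})"
    using pathD[OF p] t by (intro L2_inner_has_derivative) auto
  from DERIV_chain2[where f = sqrt and g = "\<lambda>s. ip (c s) (c s)", OF DERIV_real_sqrt[OF pos] this]
  have "((\<lambda>s. sqrt (ip (c s) (c s))) has_real_derivative
      inverse (sqrt (ip (c t) (c t))) / 2 * (ip (v t) (c t) + ip (c t) (v t))) (at t within {0..1})" .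
  then have "((\<lambda>s. nrm (c s)) has_real_derivative ip (c t) (v t) / nrm (c t)) (at t within {0..1})"
    unfolding L2_norm_def L2_inner_commute[of M "v t" "c t"] by (simp add: field_simps)
  from DERIV_chain2[where f = w and g = "\<lambda>s. nrm (c s)", OF W_deriv[OF P(3)] this]
  show "((\<lambda>s. w (nrm (c s))) has_real_derivative
      sqrt (g (nrm (c t))) * (ip (c t) (v t) / nrm (c t))) (at t within {0..1})" .
  have "\<bar>sqrt (g (nrm (c t))) * (ip (c t) (v t) / nrm (c t))\<bar>
      = sqrt (g (nrm (c t)) * (ip (c t) (v t) / nrm (c t))\<^sup>2)"
    using g_pos[OF P(3)] by (simp add: real_sqrt_mult abs_mult)
  also have "\<dots> \<le> speed c v t" using G_ge_radial[OF P(1,4)] by simp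
  finally show "\<bar>sqrt (g (nrm (c t))) * (ip (c t) (v t) / nrm (c t))\<bar> \<le> speed c v t" .
qed (use t speed_continuous[OF p] in auto)

text \<open>Pairing with the fixed vector \<open>c 1 - c 0\<close> reduces the estimate to the fundamental theorem of
  calculus for real functions.\<close>

lemma displacement_le_length:
  assumes p: "L2_C1_path M c v" and "0 < k"
    and k: "\<And>t. t \<in> {0..1} \<Longrightarrow> k\<^sup>2 \<le> 4 * C1 ((nrm (c t))\<^sup>2) \<and> k\<^sup>2 \<le> g (nrm (c t))"
  shows "k * nrm (\<lambda>x. c 1 x - c 0 x) \<le> path_length G c v"
proof -
  define e where "e = (\<lambda>x. c 1 x - c 0 x)"
  have L2: "c 0 \<in> L2" "c 1 \<in> L2" using pathD(2)[OF p] by auto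
  then have e: "e \<in> L2" by (simp add: e_def)
  have "\<bar>ip (c 1) e - ip (c 0) e\<bar> \<le> integral {0..1} (\<lambda>t. nrm e / k * speed c v t)"
  proof (rule derivative_bound_integral[where f' = "\<lambda>t. ip (v t) e"])
    fix t :: real assume t: "t \<in> {0..1}"
    note P = pathD[OF p t]
    have "((\<lambda>s. ip (c s) e) has_real_derivative ip (v t) e + ip (c t) (\<lambda>x. 0)) (at t within {0..1})"
      using pathD[OF p] t e by (intro L2_inner_has_derivative has_L2_derivative_const) auto
    then show "((\<lambda>s. ip (c s) e) has_real_derivative ip (v t) e) (at t within {0..1})" by simp
    have "sqrt (k\<^sup>2 * ip (v t) (v t)) \<le> speed c v t"
      using G_lower[OF P(1,4)] k[OF t] by simp
    then have "k * nrm (v t) \<le> speed c v t"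
      using \<open>0 < k\<close> by (simp add: real_sqrt_mult L2_norm_def)
    then have "nrm (v t) * nrm e \<le> nrm e / k * speed c v t"
      using \<open>0 < k\<close> mult_right_mono[of "k * nrm (v t)" "speed c v t" "nrm e"] by (simp add: field_simps)
    then show "\<bar>ip (v t) e\<bar> \<le> nrm e / k * speed c v t"
      using L2_Cauchy_Schwarz[OF P(4) e] by linarith
  qed (intro continuous_on_mult continuous_on_const speed_continuous[OF p], simp)
  also have "\<dots> = nrm e / k * path_length G c v" by (simp add: path_length_def)
  also have "ip (c 1) e - ip (c 0) e = (nrm e)\<^sup>2"
    using L2 e unfolding L2_norm_power2 by (subst (3) e_def) (simp add: e_def)
  finally have "nrm e * (k * nrm e) \<le> nrm e * path_length G c v"
    using \<open>0 < k\<close> by (simp add: field_simps power2_eq_square)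
  then have "nrm e = 0 \<or> k * nrm e \<le> path_length G c v"
    using L2_norm_nonneg[of M e] by (metis mult_le_cancel_left_pos order.not_eq_order_implies_strict)
  then show ?thesis using path_length_nonneg[OF p] unfolding e_def by auto
qed

text \<open>A bound on the length confines \<open>W\<close> of the norm to a bounded interval, hence the norm to a
  compact subset of the positive half line, where the metric is comparable to the \<open>L\<^sup>2\<close> one. This
  is where the divergence of \<open>W\<close> at both ends enters.\<close>

lemma displacement_bound:
  "\<exists>k>0. \<forall>c v. L2_C1_path M c v \<and> \<bar>w (nrm (c 0))\<bar> + path_length G c v \<le> B
    \<longrightarrow> k * nrm (\<lambda>x. c 1 x - c 0 x) \<le> path_length G c v"
proof -
  obtain k where k: "0 < k" "\<And>r. r \<in> {rho (- B)..rho B} \<Longrightarrow> k\<^sup>2 \<le> 4 * C1 (r\<^sup>2) \<and> k\<^sup>2 \<le> g r"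
    using coefficient_bounds[OF rho_pos, of "- B" "rho B"] by blast
  have "k * nrm (\<lambda>x. c 1 x - c 0 x) \<le> path_length G c v"
    if p: "L2_C1_path M c v" and B: "\<bar>w (nrm (c 0))\<bar> + path_length G c v \<le> B" for c v
  proof (rule displacement_le_length[OF p k(1)])
    fix t :: real assume t: "t \<in> {0..1}"
    have "\<bar>w (nrm (c t))\<bar> \<le> B" using W_variation_le_length[OF p t] B by linarith
    then have "nrm (c t) \<in> {rho (- B)..rho B}" using pathD(3)[OF p t] by (intro W_range)
    then show "k\<^sup>2 \<le> 4 * C1 ((nrm (c t))\<^sup>2) \<and> k\<^sup>2 \<le> g (nrm (c t))" by (rule k(2))
  qed
  then show ?thesis using k(1) by blast
qed

lemma path_reparametrize:
  assumes p: "L2_C1_path M c v" and \<eta>: "\<eta> ` {0..1} \<subseteq> {0..1}"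
    and d: "\<And>t. t \<in> {0..1} \<Longrightarrow> (\<eta> has_real_derivative \<eta>' t) (at t within {0..1})"
    and cont: "continuous_on {0..1} \<eta>'"
  shows "L2_C1_path M (\<lambda>t. c (\<eta> t)) (\<lambda>t x. \<eta>' t * v (\<eta> t) x)"
  unfolding L2_C1_path_def
proof (intro ballI conjI)
  fix t :: real assume t: "t \<in> {0..1}"
  then have \<eta>t: "\<eta> s \<in> {0..1}" if "s \<in> {0..1}" for s using \<eta> that by blast
  note P = pathD[OF p \<eta>t[OF t]]
  show "c (\<eta> t) \<in> L2nz" "(\<lambda>x. \<eta>' t * v (\<eta> t) x) \<in> L2" using P by auto
  show "has_L2_derivative M (\<lambda>t. c (\<eta> t)) (\<lambda>x. \<eta>' t * v (\<eta> t) x) t {0..1}"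
    using pathD[OF p] P t \<eta> by (intro has_L2_derivative_compose[where T = "{0..1}"] d) auto
  have ev: "\<forall>\<^sub>F s in at t within {0..1}. s \<in> {0..1}"
    by (auto simp: eventually_at intro!: exI[of _ 1])
  have "continuous (at (\<eta> t) within {0..1}) (\<lambda>u. nrm (\<lambda>x. v u x - v (\<eta> t) x))"
    using P(6) by (simp add: continuous_within)
  moreover have "\<forall>\<^sub>F s in at t within {0..1}. \<eta> s \<in> {0..1}"
    using ev by eventually_elim (rule \<eta>t)
  moreover have "(\<eta> \<longlongrightarrow> \<eta> t) (at t within {0..1})"
    using DERIV_continuous[OF d[OF t]] by (simp add: continuous_within)
  ultimately have "((\<lambda>s. nrm (\<lambda>x. v (\<eta> s) x - v (\<eta> t) x)) \<longlongrightarrow> nrm (\<lambda>x. v (\<eta> t) x - v (\<eta> t) x)) (at t within {0..1})"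
    by (rule continuous_within_tendsto_compose)
  then have v: "((\<lambda>s. nrm (\<lambda>x. v (\<eta> s) x - v (\<eta> t) x)) \<longlongrightarrow> 0) (at t within {0..1})" by simp
  have \<eta>': "(\<eta>' \<longlongrightarrow> \<eta>' t) (at t within {0..1})"
    using cont t by (simp add: continuous_on_def)
  show "((\<lambda>s. nrm (\<lambda>x. \<eta>' s * v (\<eta> s) x - \<eta>' t * v (\<eta> t) x)) \<longlongrightarrow> 0) (at t within {0..1})"
  proof (rule Lim_null_comparison)
    let ?b = "\<lambda>s. \<bar>\<eta>' s\<bar> * nrm (\<lambda>x. v (\<eta> s) x - v (\<eta> t) x) + \<bar>\<eta>' s - \<eta>' t\<bar> * nrm (v (\<eta> t))"
    have "(?b \<longlongrightarrow> \<bar>\<eta>' t\<bar> * 0 + \<bar>\<eta>' t - \<eta>' t\<bar> * nrm (v (\<eta> t))) (at t within {0..1})"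
      by (intro tendsto_intros v \<eta>')
    then show "(?b \<longlongrightarrow> 0) (at t within {0..1})" by simp
    show "\<forall>\<^sub>F s in at t within {0..1}. norm (nrm (\<lambda>x. \<eta>' s * v (\<eta> s) x - \<eta>' t * v (\<eta> t) x)) \<le> ?b s"
      using ev
    proof eventually_elim
      fix s :: real assume s: "s \<in> {0..1}"
      have "(\<lambda>x. \<eta>' s * v (\<eta> s) x - \<eta>' t * v (\<eta> t) x)
          = (\<lambda>x. \<eta>' s * (v (\<eta> s) x - v (\<eta> t) x) + (\<eta>' s - \<eta>' t) * v (\<eta> t) x)"
        by (auto simp: fun_eq_iff algebra_simps)
      then show "norm (nrm (\<lambda>x. \<eta>' s * v (\<eta> s) x - \<eta>' t * v (\<eta> t) x)) \<le> ?b s"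
        using L2_norm_triangle[of "\<lambda>x. \<eta>' s * (v (\<eta> s) x - v (\<eta> t) x)" M "\<lambda>x. (\<eta>' s - \<eta>' t) * v (\<eta> t) x"]
          pathD(4)[OF p \<eta>t[OF s]] P(4) by simp
    qed
  qed
qed

lemma path_reverse:
  assumes p: "L2_C1_path M c v"
  shows "L2_C1_path M (\<lambda>t. c (1 - t)) (\<lambda>t x. - 1 * v (1 - t) x)"
    and "path_length G (\<lambda>t. c (1 - t)) (\<lambda>t x. - 1 * v (1 - t) x) = path_length G c v"
proof -
  have d: "((\<lambda>t::real. 1 - t) has_real_derivative - 1) (at t within {0..1})" for t
    by (auto intro!: derivative_eq_intros)
  have im: "(\<lambda>t::real. 1 - t) ` {0..1} \<subseteq> {0..1}" by auto
  show "L2_C1_path M (\<lambda>t. c (1 - t)) (\<lambda>t x. - 1 * v (1 - t) x)"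
    by (rule path_reparametrize[OF p im d]) auto
  have "((\<lambda>t. - 1 * speed c v (1 - t)) has_integral
      (integral {0..1 - 1} (speed c v) - integral {0..1 - 0} (speed c v))) {0..1}"
    by (rule integral_reparametrize[OF speed_continuous[OF p] im d])
  then have "((\<lambda>t. - (- 1 * speed c v (1 - t))) has_integral - (- path_length G c v)) {0..1}"
    unfolding path_length_def by (intro has_integral_neg) simp
  then have "integral {0..1} (\<lambda>t. speed c v (1 - t)) = path_length G c v"
    by (intro integral_unique) simp
  then show "path_length G (\<lambda>t. c (1 - t)) (\<lambda>t x. - 1 * v (1 - t) x) = path_length G c v"
    unfolding path_length_def metric_G_cmult by simp
qed

text \<open>Two paths are joined without case distinctions as \<open>c1 (\<eta>1 t) + c2 (\<eta>2 t) - c1 1\<close>, where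
  \<open>\<eta>1\<close> stops at time \<open>1/2\<close> and \<open>\<eta>2\<close> starts there, both with velocity zero. So the joined path is
  again \<open>C\<^sup>1\<close>, and the endpoints need to agree only almost everywhere.\<close>

lemma path_concat:
  assumes p1: "L2_C1_path M c1 v1" and p2: "L2_C1_path M c2 v2"
    and joint: "AE x in M. c1 1 x = c2 0 x"
  shows "\<exists>c v. L2_C1_path M c v \<and> (AE x in M. c 0 x = c1 0 x) \<and> (AE x in M. c 1 x = c2 1 x)
    \<and> path_length G c v = path_length G c1 v1 + path_length G c2 v2"
proof -
  define \<eta>1 where "\<eta>1 = (\<lambda>t::real. 1 - 4 * (max 0 (1 / 2 - t))\<^sup>2)"
  define \<eta>2 where "\<eta>2 = (\<lambda>t::real. 4 * (max 0 (t - 1 / 2))\<^sup>2)"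
  define \<eta>1' where "\<eta>1' = (\<lambda>t::real. 8 * max 0 (1 / 2 - t))"
  define \<eta>2' where "\<eta>2' = (\<lambda>t::real. 8 * max 0 (t - 1 / 2))"
  have sq: "(max 0 x)\<^sup>2 \<le> 1 / 4" if "x \<le> 1 / 2" for x :: real
    using power_mono[of "max 0 x" "1 / 2" 2] that by (simp add: power2_eq_square)
  have im: "\<eta>1 ` {0..1} \<subseteq> {0..1}" "\<eta>2 ` {0..1} \<subseteq> {0..1}"
  proof -
    show "\<eta>1 ` {0..1} \<subseteq> {0..1}"
    proof clarify
      fix t :: real assume "t \<in> {0..1}"
      then show "\<eta>1 t \<in> {0..1}" using sq[of "1 / 2 - t"] by (simp add: \<eta>1_def)
    qed
    show "\<eta>2 ` {0..1} \<subseteq> {0..1}"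
    proof clarify
      fix t :: real assume "t \<in> {0..1}"
      then show "\<eta>2 t \<in> {0..1}" using sq[of "t - 1 / 2"] by (simp add: \<eta>2_def)
    qed
  qed
  have d1: "(\<eta>1 has_real_derivative \<eta>1' t) (at t within {0..1})" for t
  proof -
    have "((\<lambda>t. (max 0 (1 / 2 - t))\<^sup>2) has_real_derivative 2 * max 0 (1 / 2 - t) * (- 1)) (at t within {0..1})"
      by (rule DERIV_chain2[OF DERIV_positive_part_square]) (auto intro!: derivative_eq_intros)
    from DERIV_diff[OF DERIV_const DERIV_cmult[OF this, of 4], of 1]
    show ?thesis unfolding \<eta>1_def \<eta>1'_def by simp
  qed
  have d2: "(\<eta>2 has_real_derivative \<eta>2' t) (at t within {0..1})" for t
  proof -
    have "((\<lambda>t. (max 0 (t - 1 / 2))\<^sup>2) has_real_derivative 2 * max 0 (t - 1 / 2) * 1) (at t within {0..1})"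
      by (rule DERIV_chain2[OF DERIV_positive_part_square]) (auto intro!: derivative_eq_intros)
    from DERIV_cmult[OF this, of 4] show ?thesis unfolding \<eta>2_def \<eta>2'_def by simp
  qed
  have c': "continuous_on {0..1} \<eta>1'" "continuous_on {0..1} \<eta>2'"
    unfolding \<eta>1'_def \<eta>2'_def by (auto intro!: continuous_intros)
  note q1 = path_reparametrize[OF p1 im(1) d1 c'(1)] and q2 = path_reparametrize[OF p2 im(2) d2 c'(2)]
  define c where "c = (\<lambda>t x. (c1 (\<eta>1 t) x + c2 (\<eta>2 t) x) + - 1 * c1 1 x)"
  define v where "v = (\<lambda>t x. \<eta>1' t * v1 (\<eta>1 t) x + \<eta>2' t * v2 (\<eta>2 t) x)"
  have one: "c1 1 \<in> L2" "c2 0 \<in> L2" using pathD(2)[OF p1, of 1] pathD(2)[OF p2, of 0] by auto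
  have cL2: "c t \<in> L2" "v t \<in> L2" if "t \<in> {0..1}" for t
    using pathD(2,4)[OF q1 that] pathD(2,4)[OF q2 that] one by (auto simp: c_def v_def)
  have first: "AE x in M. c t x = c1 (\<eta>1 t) x" "\<eta>2' t = 0" if "t \<le> 1 / 2" for t
  proof -
    have "\<eta>2 t = 0" using that by (simp add: \<eta>2_def)
    then show "AE x in M. c t x = c1 (\<eta>1 t) x"
      using joint by (auto simp: c_def elim!: eventually_mono)
    show "\<eta>2' t = 0" using that by (simp add: \<eta>2'_def)
  qed
  have second: "c t = c2 (\<eta>2 t)" "\<eta>1' t = 0" if "1 / 2 \<le> t" for t
  proof -
    have "\<eta>1 t = 1" using that by (simp add: \<eta>1_def)
    then show "c t = c2 (\<eta>2 t)" by (simp add: c_def)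
    show "\<eta>1' t = 0" using that by (simp add: \<eta>1'_def)
  qed
  have path: "L2_C1_path M c v"
    unfolding L2_C1_path_def
  proof (intro ballI conjI)
    fix t :: real assume t: "t \<in> {0..1}"
    note Q1 = pathD[OF q1 t] and Q2 = pathD[OF q2 t]
    show "c t \<in> L2nz"
    proof (cases "t \<le> 1 / 2")
      case True
      have "nrm (c t) = nrm (c1 (\<eta>1 t))"
        unfolding L2_norm_def
        using L2_inner_cong_AE[OF cL2(1)[OF t] Q1(2) cL2(1)[OF t] Q1(2) first(1)[OF True] first(1)[OF True]]
        by simp
      then show ?thesis using Q1(3) cL2[OF t] by (simp add: L2nz_iff)
    next
      case False
      then show ?thesis using second(1)[of t] Q2(1) by simp
    qed
    show "v t \<in> L2" by (rule cL2[OF t])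
    have "has_L2_derivative M (\<lambda>s x. (c1 (\<eta>1 s) x + c2 (\<eta>2 s) x) + - 1 * c1 1 x)
        (\<lambda>x. (\<eta>1' t * v1 (\<eta>1 t) x + \<eta>2' t * v2 (\<eta>2 t) x) + 0) t {0..1}"
      by (rule has_L2_derivative_add[OF has_L2_derivative_add[OF Q1(5) _ Q1(4) Q2(5) _ Q2(4) t] _
            L2_add[OF Q1(4) Q2(4)] has_L2_derivative_const _ L2_zero t])
        (use pathD(2)[OF q1] pathD(2)[OF q2] one L2_cmult[OF one(1), of "- 1"] in simp_all)
    then show "has_L2_derivative M c (v t) t {0..1}" by (simp add: c_def[abs_def] v_def)
    show "((\<lambda>s. nrm (\<lambda>x. v s x - v t x)) \<longlongrightarrow> 0) (at t within {0..1})"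
    proof (rule Lim_null_comparison)
      let ?b = "\<lambda>s. nrm (\<lambda>x. \<eta>1' s * v1 (\<eta>1 s) x - \<eta>1' t * v1 (\<eta>1 t) x)
        + nrm (\<lambda>x. \<eta>2' s * v2 (\<eta>2 s) x - \<eta>2' t * v2 (\<eta>2 t) x)"
      show "(?b \<longlongrightarrow> 0) (at t within {0..1})"
        using tendsto_add[OF Q1(6) Q2(6)] by simp
      have "norm (nrm (\<lambda>x. v s x - v t x)) \<le> ?b s" if s: "s \<in> {0..1}" for s
      proof -
        have "(\<lambda>x. v s x - v t x) = (\<lambda>x. (\<eta>1' s * v1 (\<eta>1 s) x - \<eta>1' t * v1 (\<eta>1 t) x)
            + (\<eta>2' s * v2 (\<eta>2 s) x - \<eta>2' t * v2 (\<eta>2 t) x))"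
          by (auto simp: v_def fun_eq_iff)
        then show ?thesis
          using L2_norm_triangle[OF L2_diff[OF pathD(4)[OF q1 s] Q1(4)] L2_diff[OF pathD(4)[OF q2 s] Q2(4)]]
          by simp
      qed
      then show "\<forall>\<^sub>F s in at t within {0..1}. norm (nrm (\<lambda>x. v s x - v t x)) \<le> ?b s"
        by (auto simp: eventually_at intro!: exI[of _ 1])
    qed
  qed
  have "path_length G c v = integral {0..1} (\<lambda>t. \<eta>1' t * speed c1 v1 (\<eta>1 t) + \<eta>2' t * speed c2 v2 (\<eta>2 t))"
    unfolding path_length_def
  proof (rule integral_cong)
    fix t :: real assume t: "t \<in> {0..1}"
    note Q1 = pathD[OF q1 t] and Q2 = pathD[OF q2 t]
    show "speed c v t = \<eta>1' t * speed c1 v1 (\<eta>1 t) + \<eta>2' t * speed c2 v2 (\<eta>2 t)"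
    proof (cases "t \<le> 1 / 2")
      case True
      have "v t = (\<lambda>x. \<eta>1' t * v1 (\<eta>1 t) x)" using first(2)[OF True] by (simp add: v_def)
      then have "G (c t) (v t) (v t) = (\<eta>1' t)\<^sup>2 * G (c1 (\<eta>1 t)) (v1 (\<eta>1 t)) (v1 (\<eta>1 t))"
        using G_cong_AE[OF cL2(1)[OF t] Q1(2) first(1)[OF True] cL2(2)[OF t] cL2(2)[OF t]]
        by (simp add: metric_G_cmult)
      then show ?thesis
        using first(2)[OF True] by (simp add: real_sqrt_mult \<eta>1'_def)
    next
      case False
      then have half: "1 / 2 \<le> t" by simp
      have "v t = (\<lambda>x. \<eta>2' t * v2 (\<eta>2 t) x)" using second(2)[OF half] by (simp add: v_def)
      then have "G (c t) (v t) (v t) = (\<eta>2' t)\<^sup>2 * G (c2 (\<eta>2 t)) (v2 (\<eta>2 t)) (v2 (\<eta>2 t))"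
        using second(1)[OF half] by (simp add: metric_G_cmult)
      then show ?thesis
        using second(2)[OF half] by (simp add: real_sqrt_mult \<eta>2'_def)
    qed
  qed
  moreover have l1: "((\<lambda>t. \<eta>1' t * speed c1 v1 (\<eta>1 t)) has_integral path_length G c1 v1) {0..1}"
    using integral_reparametrize[OF speed_continuous[OF p1] im(1) d1]
    by (simp add: path_length_def \<eta>1_def power2_eq_square)
  moreover have l2: "((\<lambda>t. \<eta>2' t * speed c2 v2 (\<eta>2 t)) has_integral path_length G c2 v2) {0..1}"
    using integral_reparametrize[OF speed_continuous[OF p2] im(2) d2]
    by (simp add: path_length_def \<eta>2_def power2_eq_square)
  ultimately have "path_length G c v = path_length G c1 v1 + path_length G c2 v2"
    using integral_unique[OF has_integral_add[OF l1 l2]] by simp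
  moreover have "AE x in M. c 0 x = c1 0 x"
    using first(1)[of 0] by (simp add: \<eta>1_def power2_eq_square)
  moreover have "c 1 = c2 1" using second(1)[of 1] by (simp add: \<eta>2_def power2_eq_square)
  ultimately show ?thesis using path by (intro exI[of _ c] exI[of _ v]) auto
qed

lemma segment_path:
  assumes f: "f \<in> L2" and h: "h \<in> L2"
    and nz: "\<And>t. t \<in> {0..1} \<Longrightarrow> 0 < nrm (\<lambda>x. f x + t * (h x - f x))"
  shows "L2_C1_path M (\<lambda>t x. f x + t * (h x - f x)) (\<lambda>t x. h x - f x)"
  unfolding L2_C1_path_def
proof (intro ballI conjI)
  fix t :: real assume t: "t \<in> {0..1}"
  show "(\<lambda>x. f x + t * (h x - f x)) \<in> L2nz" using nz[OF t] f h by (simp add: L2nz_iff)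
  have d: "has_L2_derivative M (\<lambda>t x. t * (h x - f x)) (\<lambda>x. 1 * (h x - f x)) t {0..1}"
    by (rule has_L2_derivative_scale[OF DERIV_ident])
  have "has_L2_derivative M (\<lambda>t x. f x + t * (h x - f x)) (\<lambda>x. 0 + 1 * (h x - f x)) t {0..1}"
    by (rule has_L2_derivative_add[OF has_L2_derivative_const f L2_zero d _ _ t]) (use f h in simp_all)
  then show "has_L2_derivative M (\<lambda>t x. f x + t * (h x - f x)) (\<lambda>x. h x - f x) t {0..1}" by simp
qed (use f h in auto)


subsection \<open>Metric axioms and completeness\<close>

lemma L2_class_iff: "h \<in> L2_class M f \<longleftrightarrow> h \<in> L2 \<and> (AE x in M. h x = f x)"
  by (simp add: L2_class_def)

lemma L2_class_eq:
  assumes "AE x in M. f x = h x"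
  shows "L2_class M f = L2_class M h"
proof -
  have "(AE x in M. u x = f x) \<longleftrightarrow> (AE x in M. u x = h x)" for u
    using assms by (auto elim: eventually_elim2)
  then show ?thesis by (auto simp: L2_class_iff)
qed

lemma L2_nonzeroI: "f \<in> L2nz \<Longrightarrow> L2_class M f \<in> L2_nonzero M"
  by (simp add: L2_nonzero_def)

lemma nrm_cong_AE: "f \<in> L2 \<Longrightarrow> h \<in> L2 \<Longrightarrow> AE x in M. f x = h x \<Longrightarrow> nrm f = nrm h"
  unfolding L2_norm_def using L2_inner_cong_AE[of f M h f h] by simp

lemma L2_nonzeroE:
  assumes "P \<in> L2_nonzero M"
  obtains f where "f \<in> L2nz" "P = L2_class M f"
  using assms by (auto simp: L2_nonzero_def)

lemma L2_nonzero_memD: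
  assumes "P \<in> L2_nonzero M" "f \<in> P"
  shows "f \<in> L2nz" "P = L2_class M f"
proof -
  obtain h where h: "h \<in> L2nz" "P = L2_class M h" using assms(1) by (rule L2_nonzeroE)
  then have f: "f \<in> L2" "AE x in M. f x = h x" using assms(2) by (auto simp: L2_class_iff)
  then show "f \<in> L2nz" using h nrm_cong_AE[of f h] by (simp add: L2nz_iff)
  show "P = L2_class M f" using f(2) h(2) L2_class_eq by metis
qed

lemma noncollinear_segment_path:
  assumes f: "f \<in> L2nz" and h: "h \<in> L2" and nc: "\<nexists>a. AE x in M. h x = a * f x"
  shows "L2_C1_path M (\<lambda>t x. f x + t * (h x - f x)) (\<lambda>t x. h x - f x)"
proof (rule segment_path)
  show fL2: "f \<in> L2" using f by (simp add: L2nz_iff)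
  fix t :: real
  show "0 < nrm (\<lambda>x. f x + t * (h x - f x))"
  proof (rule ccontr)
    assume "\<not> 0 < nrm (\<lambda>x. f x + t * (h x - f x))"
    then have "nrm (\<lambda>x. f x + t * (h x - f x)) = 0"
      using L2_norm_nonneg[of M "\<lambda>x. f x + t * (h x - f x)"] by linarith
    then have ae: "AE x in M. f x + t * (h x - f x) = 0"
      using L2_norm_eq_0_iff[of "\<lambda>x. f x + t * (h x - f x)" M] fL2 h by simp
    show False
    proof (cases "t = 0")
      case True
      then have "AE x in M. f x = 0" using ae by simp
      then show False using f by (simp add: L2_nonzero_functions_def)
    next
      case False
      have "AE x in M. h x = (t - 1) / t * f x"
        using ae by eventually_elim (use False in \<open>simp add: field_simps\<close>)
      then show False using nc by blast
    qed
  qed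
qed fact

end

text \<open>Two disjoint sets of positive measure make \<open>L\<^sup>2\<close> at least two-dimensional, so that the
  complement of the origin is connected and the distance of two nonzero elements is finite.\<close>

locale L2_radial_connected = L2_radial +
  assumes two_sets: "\<exists>A B. A \<in> sets M \<and> B \<in> sets M \<and> A \<inter> B = {} \<and> 0 < emeasure M A \<and> 0 < emeasure M B"
begin

lemma noncollinear_exists:
  assumes f: "f \<in> L2nz"
  shows "\<exists>h\<in>L2. \<nexists>a. AE x in M. h x = a * f x"
proof (rule ccontr)
  assume neg: "\<not> ?thesis"
  obtain A B where AB: "A \<in> sets M" "B \<in> sets M" "A \<inter> B = {}" "0 < emeasure M A" "0 < emeasure M B"
    using two_sets by blast
  have ind: "indicat_real S \<in> L2" if "S \<in> sets M" for S
  proof (rule L2_functionsI)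
    have "(\<lambda>x. (indicat_real S x)\<^sup>2) = indicat_real S" by (auto simp: fun_eq_iff indicator_def)
    moreover have "integrable M (indicat_real S)"
      using that by (intro integrable_real_indicator) (simp_all add: less_top[symmetric])
    ultimately show "integrable M (\<lambda>x. (indicat_real S x)\<^sup>2)" by simp
  qed (use that in simp)
  have null: "\<not> (AE x in M. x \<notin> S)" if "S \<in> sets M" "0 < emeasure M S" for S
    using that by (metis AE_iff_null_sets less_numeral_extra(3) null_setsD1)
  obtain a where a: "AE x in M. indicat_real A x = a * f x" using neg ind[OF AB(1)] by blast
  obtain b where b: "AE x in M. indicat_real B x = b * f x" using neg ind[OF AB(2)] by blast
  show False
  proof (cases "b = 0")
    case True
    have "AE x in M. x \<notin> B" using b by eventually_elim (use True in \<open>auto simp: indicator_def\<close>)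
    then show False using null AB by blast
  next
    case False
    have "AE x in M. x \<notin> A" using a b
    proof eventually_elim
      fix x assume x: "indicat_real A x = a * f x" "indicat_real B x = b * f x"
      show "x \<notin> A"
      proof
        assume "x \<in> A"
        then have "x \<notin> B" using AB(3) by blast
        then show False using x False \<open>x \<in> A\<close> by simp
      qed
    qed
    then show False using null AB by blast
  qed
qed

text \<open>Collinear elements are joined through a third one outside their line.\<close>

lemma paths_connect:
  assumes f: "f \<in> L2nz" and h: "h \<in> L2nz"
  shows "\<exists>c v. L2_C1_path M c v \<and> c 0 \<in> L2_class M f \<and> c 1 \<in> L2_class M h"
proof -
  have L2: "f \<in> L2" "h \<in> L2" using f h by (auto simp: L2nz_iff)
  show ?thesis
  proof (cases "\<exists>a. AE x in M. h x = a * f x")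
    case False
    from noncollinear_segment_path[OF f L2(2) this] show ?thesis
      using L2 by (intro exI[of _ "\<lambda>t x. f x + t * (h x - f x)"] exI[of _ "\<lambda>t x. h x - f x"])
        (simp add: L2_class_iff)
  next
    case True
    then obtain a where a: "AE x in M. h x = a * f x" by blast
    obtain u where u: "u \<in> L2" "\<nexists>a. AE x in M. u x = a * f x"
      using noncollinear_exists[OF f] by blast
    have "\<not> (AE x in M. u x = 0)" using u(2) by (metis (no_types, lifting) eventually_mono mult_zero_left)
    then have unz: "u \<in> L2nz" using u(1) by (simp add: L2_nonzero_functions_def)
    have "\<nexists>b. AE x in M. h x = b * u x"
    proof
      assume "\<exists>b. AE x in M. h x = b * u x"
      then obtain b where b: "AE x in M. h x = b * u x" by blast
      have "b \<noteq> 0"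
      proof
        assume "b = 0"
        then have "AE x in M. h x = 0" using b by simp
        then show False using h by (simp add: L2_nonzero_functions_def)
      qed
      have "AE x in M. u x = a / b * f x"
        using a b by eventually_elim (use \<open>b \<noteq> 0\<close> in \<open>simp add: field_simps\<close>)
      then show False using u(2) by blast
    qed
    from path_concat[OF noncollinear_segment_path[OF f u] noncollinear_segment_path[OF unz L2(2) this]]
    obtain c v where c: "L2_C1_path M c v" "AE x in M. c 0 x = f x" "AE x in M. c 1 x = h x"
      by auto
    then show ?thesis using pathD(2)[OF c(1), of 0] pathD(2)[OF c(1), of 1]
      by (intro exI[of _ c] exI[of _ v]) (auto simp: L2_class_iff)
  qed
qed

definition lengths :: "('a \<Rightarrow> real) set \<Rightarrow> ('a \<Rightarrow> real) set \<Rightarrow> real set" where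
  "lengths P Q = {path_length G c v | c v. L2_C1_path M c v \<and> c 0 \<in> P \<and> c 1 \<in> Q}"

lemma gdist_eq: "P \<in> L2_nonzero M \<Longrightarrow> Q \<in> L2_nonzero M \<Longrightarrow> gdist P Q = Inf (lengths P Q)"
  by (simp add: geodesic_dist_def lengths_def)

lemma lengths_nonempty:
  assumes "P \<in> L2_nonzero M" "Q \<in> L2_nonzero M"
  shows "lengths P Q \<noteq> {}"
proof -
  obtain f h where "f \<in> L2nz" "P = L2_class M f" "h \<in> L2nz" "Q = L2_class M h"
    using L2_nonzeroE[OF assms(1)] L2_nonzeroE[OF assms(2)] by metis
  then show ?thesis using paths_connect[of f h] by (auto simp: lengths_def)
qed

lemma lengths_bdd: "bdd_below (lengths P Q)"
  by (auto simp: lengths_def bdd_below_def intro!: exI[of _ 0] path_length_nonneg)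

lemma gdist_le:
  assumes "P \<in> L2_nonzero M" "Q \<in> L2_nonzero M" "L2_C1_path M c v" "c 0 \<in> P" "c 1 \<in> Q"
  shows "gdist P Q \<le> path_length G c v"
  unfolding gdist_eq[OF assms(1,2)] using assms(3-5)
  by (intro cInf_lower lengths_bdd) (auto simp: lengths_def)

lemma gdist_less:
  assumes "P \<in> L2_nonzero M" "Q \<in> L2_nonzero M" "gdist P Q < d"
  obtains c v where "L2_C1_path M c v" "c 0 \<in> P" "c 1 \<in> Q" "path_length G c v < d"
proof -
  have "\<exists>x\<in>lengths P Q. x < d"
    using assms(3) cInf_lessD[OF lengths_nonempty[OF assms(1,2)]] unfolding gdist_eq[OF assms(1,2)] by blast
  then show ?thesis using that by (auto simp: lengths_def)
qed

lemma gdist_nonneg: "0 \<le> gdist P Q"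
proof (cases "P \<in> L2_nonzero M \<and> Q \<in> L2_nonzero M")
  case True
  then show ?thesis unfolding gdist_eq[OF conjunct1[OF True] conjunct2[OF True]]
    by (intro cInf_greatest lengths_nonempty) (auto simp: lengths_def path_length_nonneg)
qed (auto simp: geodesic_dist_def)

lemma gdist_commute: "gdist P Q = gdist Q P"
proof -
  have "lengths P Q \<subseteq> lengths Q P" for P Q
  proof
    fix l assume "l \<in> lengths P Q"
    then obtain c v where "l = path_length G c v" "L2_C1_path M c v" "c 0 \<in> P" "c 1 \<in> Q"
      by (auto simp: lengths_def)
    then show "l \<in> lengths Q P"
      using path_reverse[of c v] unfolding lengths_def
      by (intro CollectI exI[of _ "\<lambda>t. c (1 - t)"] exI[of _ "\<lambda>t x. - 1 * v (1 - t) x"]) simp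
  qed
  then have "lengths P Q = lengths Q P" by blast
  then show ?thesis
    by (cases "P \<in> L2_nonzero M \<and> Q \<in> L2_nonzero M") (auto simp: gdist_eq, auto simp: geodesic_dist_def)
qed

lemma gdist_self:
  assumes "P \<in> L2_nonzero M"
  shows "gdist P P = 0"
proof -
  obtain f where f: "f \<in> L2nz" "P = L2_class M f" using assms by (rule L2_nonzeroE)
  have fL2: "f \<in> L2" using f(1) by (simp add: L2nz_iff)
  have p: "L2_C1_path M (\<lambda>t. f) (\<lambda>t x. 0)"
    using f(1) by (simp add: L2_C1_path_def has_L2_derivative_const)
  have "path_length G (\<lambda>t. f) (\<lambda>t x. 0) = 0"
    by (simp add: path_length_def metric_G_def)
  then have "gdist P P \<le> 0"
    using gdist_le[OF assms assms p] fL2 f(2) by (simp add: L2_class_iff)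
  then show ?thesis using gdist_nonneg[of P P] by simp
qed

lemma gdist_triangle:
  assumes P: "P \<in> L2_nonzero M" and Q: "Q \<in> L2_nonzero M" and R: "R \<in> L2_nonzero M"
  shows "gdist P R \<le> gdist P Q + gdist Q R"
proof (rule field_le_epsilon)
  fix e :: real assume "0 < e"
  then obtain c1 v1 where p1: "L2_C1_path M c1 v1" "c1 0 \<in> P" "c1 1 \<in> Q" "path_length G c1 v1 < gdist P Q + e / 2"
    using gdist_less[OF P Q, of "gdist P Q + e / 2"] by auto
  obtain c2 v2 where p2: "L2_C1_path M c2 v2" "c2 0 \<in> Q" "c2 1 \<in> R" "path_length G c2 v2 < gdist Q R + e / 2"
    using gdist_less[OF Q R, of "gdist Q R + e / 2"] \<open>0 < e\<close> by auto
  have "c1 1 \<in> L2_class M (c2 0)" using p1(3) L2_nonzero_memD(2)[OF Q p2(2)] by simp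
  then have "AE x in M. c1 1 x = c2 0 x" by (simp add: L2_class_iff)
  from path_concat[OF p1(1) p2(1) this]
  obtain c v where c: "L2_C1_path M c v" "AE x in M. c 0 x = c1 0 x" "AE x in M. c 1 x = c2 1 x"
    "path_length G c v = path_length G c1 v1 + path_length G c2 v2" by blast
  have "c 0 \<in> P" "c 1 \<in> R"
    using c pathD(2)[OF c(1), of 0] pathD(2)[OF c(1), of 1]
      L2_nonzero_memD(2)[OF P p1(2)] L2_nonzero_memD(2)[OF R p2(3)] by (simp_all add: L2_class_iff)
  from gdist_le[OF P R c(1) this] show "gdist P R \<le> gdist P Q + gdist Q R + e"
    using c(4) p1(4) p2(4) by linarith
qed

text \<open>The bound \<open>1\<close> on the distance only serves to confine the competing paths to a shell that depends
  on the starting point alone.\<close>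

lemma gdist_lower:
  "\<exists>k>0. \<forall>f\<in>L2nz. \<forall>h\<in>L2nz. \<bar>w (nrm f)\<bar> \<le> B \<and> gdist (L2_class M f) (L2_class M h) < 1
    \<longrightarrow> k * nrm (\<lambda>x. h x - f x) \<le> gdist (L2_class M f) (L2_class M h)"
proof -
  obtain k where k: "0 < k" "\<And>c v. L2_C1_path M c v \<Longrightarrow> \<bar>w (nrm (c 0))\<bar> + path_length G c v \<le> B + 1 \<Longrightarrow>
      k * nrm (\<lambda>x. c 1 x - c 0 x) \<le> path_length G c v"
    using displacement_bound[of "B + 1"] by blast
  have "k * nrm (\<lambda>x. h x - f x) \<le> gdist (L2_class M f) (L2_class M h)"
    if f: "f \<in> L2nz" and h: "h \<in> L2nz" and B: "\<bar>w (nrm f)\<bar> \<le> B"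
      and lt: "gdist (L2_class M f) (L2_class M h) < 1" for f h
  proof (rule ccontr)
    assume "\<not> ?thesis"
    then have "gdist (L2_class M f) (L2_class M h) < min 1 (k * nrm (\<lambda>x. h x - f x))" using lt by simp
    then obtain c v where c: "L2_C1_path M c v" "c 0 \<in> L2_class M f" "c 1 \<in> L2_class M h"
      "path_length G c v < min 1 (k * nrm (\<lambda>x. h x - f x))"
      using gdist_less[OF L2_nonzeroI[OF f] L2_nonzeroI[OF h]] by blast
    have L2: "f \<in> L2" "h \<in> L2" "c 0 \<in> L2" "c 1 \<in> L2" and ae: "AE x in M. c 0 x = f x" "AE x in M. c 1 x = h x"
      using f h c by (auto simp: L2nz_iff L2_class_iff)
    have "AE x in M. c 1 x - c 0 x = h x - f x" using ae by eventually_elim simp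
    then have "nrm (\<lambda>x. c 1 x - c 0 x) = nrm (\<lambda>x. h x - f x)"
      using L2 by (intro nrm_cong_AE) auto
    moreover have "nrm (c 0) = nrm f" using L2 ae by (intro nrm_cong_AE) auto
    ultimately show False using k(2)[OF c(1)] c(4) B by simp
  qed
  then show ?thesis using k(1) by blast
qed

lemma gdist_W:
  assumes f: "f \<in> L2nz" and h: "h \<in> L2nz"
  shows "\<bar>w (nrm h) - w (nrm f)\<bar> \<le> gdist (L2_class M f) (L2_class M h)"
proof (rule ccontr)
  assume "\<not> ?thesis"
  then obtain c v where c: "L2_C1_path M c v" "c 0 \<in> L2_class M f" "c 1 \<in> L2_class M h"
    "path_length G c v < \<bar>w (nrm h) - w (nrm f)\<bar>"
    using gdist_less[OF L2_nonzeroI[OF f] L2_nonzeroI[OF h]] by (metis not_le)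
  have "nrm (c 0) = nrm f" "nrm (c 1) = nrm h"
    using c f h by (auto intro!: nrm_cong_AE simp: L2nz_iff L2_class_iff)
  then show False using W_variation_le_length[OF c(1), of 1] c(4) by simp
qed

text \<open>Elements close to \<open>f\<close> are joined to it by a segment inside the shell
  \<open>\<parallel>f\<parallel> / 2 \<le> r \<le> 2 \<parallel>f\<parallel>\<close>, where the metric is bounded by a multiple of the \<open>L\<^sup>2\<close> one.\<close>

lemma gdist_upper:
  assumes f: "f \<in> L2nz"
  shows "\<exists>K>0. \<forall>h\<in>L2. nrm (\<lambda>x. h x - f x) < nrm f / 2 \<longrightarrow>
    h \<in> L2nz \<and> gdist (L2_class M f) (L2_class M h) \<le> K * nrm (\<lambda>x. h x - f x)"
proof -
  have fL2: "f \<in> L2" and f0: "0 < nrm f" using f by (auto simp: L2nz_iff)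
  obtain K where K: "0 < K" "\<And>r. r \<in> {nrm f / 2..2 * nrm f} \<Longrightarrow> 4 * C1 (r\<^sup>2) \<le> K\<^sup>2 \<and> g r \<le> K\<^sup>2"
    using coefficient_bounds[of "nrm f / 2" "2 * nrm f"] f0 by auto
  have "h \<in> L2nz \<and> gdist (L2_class M f) (L2_class M h) \<le> K * nrm (\<lambda>x. h x - f x)"
    if h: "h \<in> L2" and near: "nrm (\<lambda>x. h x - f x) < nrm f / 2" for h
  proof -
    define e where "e = (\<lambda>x. h x - f x)"
    have e: "e \<in> L2" using h fL2 by (simp add: e_def)
    have range: "nrm (\<lambda>x. f x + t * (h x - f x)) \<in> {nrm f / 2..2 * nrm f}" if t: "t \<in> {0..1}" for t
    proof -
      have "\<bar>nrm (\<lambda>x. f x + t * e x) - nrm f\<bar> \<le> nrm (\<lambda>x. f x + t * e x - f x)"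
        using fL2 e by (intro L2_norm_diff_ineq) auto
      also have "\<dots> = t * nrm e" using t by simp
      also have "\<dots> \<le> 1 * nrm e" using t by (intro mult_right_mono) auto
      also have "\<dots> < nrm f / 2" using near by (simp add: e_def)
      finally show ?thesis using f0 unfolding e_def atLeastAtMost_iff by linarith
    qed
    have p: "L2_C1_path M (\<lambda>t x. f x + t * (h x - f x)) (\<lambda>t x. h x - f x)"
      by (rule segment_path[OF fL2 h]) (use range f0 in force)
    have hnz: "h \<in> L2nz" using range[of 1] h f0 by (auto simp: L2nz_iff)
    have "path_length G (\<lambda>t x. f x + t * (h x - f x)) (\<lambda>t x. h x - f x)
        \<le> integral {0..1} (\<lambda>t::real. K * nrm e)"
      unfolding path_length_def
    proof (rule integral_le)
      fix t :: real assume t: "t \<in> {0..1}"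
      have "G (\<lambda>x. f x + t * (h x - f x)) (\<lambda>x. h x - f x) (\<lambda>x. h x - f x) \<le> K\<^sup>2 * ip e e"
        using G_upper[OF pathD(1,4)[OF p t]] K(2)[OF range[OF t]] by (simp add: e_def)
      then have "sqrt (G (\<lambda>x. f x + t * (h x - f x)) (\<lambda>x. h x - f x) (\<lambda>x. h x - f x)) \<le> sqrt (K\<^sup>2 * ip e e)"
        by simp
      also have "\<dots> = K * nrm e" using K(1) by (simp add: real_sqrt_mult L2_norm_def)
      finally show "sqrt (G (\<lambda>x. f x + t * (h x - f x)) (\<lambda>x. h x - f x) (\<lambda>x. h x - f x)) \<le> K * nrm e" .
    qed (use integrable_continuous_real[OF speed_continuous[OF p]] in \<open>simp_all add: integrable_const_ivl\<close>)
    also have "\<dots> = K * nrm e" by simp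
    finally have "gdist (L2_class M f) (L2_class M h) \<le> K * nrm e"
      using gdist_le[OF L2_nonzeroI[OF f] L2_nonzeroI[OF hnz] p] fL2 h by (simp add: L2_class_iff)
    then show ?thesis using hnz by (simp add: e_def)
  qed
  then show ?thesis using K(1) by blast
qed

theorem geodesic_dist_metric: "Metric_space (L2_nonzero M) gdist"
proof
  show "gdist P Q = 0 \<longleftrightarrow> P = Q" if P: "P \<in> L2_nonzero M" and Q: "Q \<in> L2_nonzero M" for P Q
  proof
    assume zero: "gdist P Q = 0"
    obtain f h where f: "f \<in> L2nz" "P = L2_class M f" and h: "h \<in> L2nz" "Q = L2_class M h"
      using P Q by (metis L2_nonzeroE)
    have L2: "f \<in> L2" "h \<in> L2" using f h by (auto simp: L2nz_iff)
    obtain k where "0 < k" "k * nrm (\<lambda>x. h x - f x) \<le> gdist P Q"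
      using gdist_lower[of "\<bar>w (nrm f)\<bar>"] f h zero by fastforce
    then have "nrm (\<lambda>x. h x - f x) = 0"
      using zero L2_norm_nonneg[of M "\<lambda>x. h x - f x"] by (simp add: mult_le_0_iff)
    then have "AE x in M. h x = f x" using L2_norm_diff_eq_0_iff[OF L2(2,1)] by blast
    then show "P = Q" using f h L2_class_eq by metis
  qed (use P gdist_self in simp)
qed (use gdist_nonneg gdist_commute gdist_triangle in auto)

text \<open>The values of \<open>W\<close> along a Cauchy sequence are bounded, so its members have norms bounded away
  from zero and the two distances are comparable along it.\<close>

theorem geodesic_dist_mcomplete: "Metric_space.mcomplete (L2_nonzero M) gdist"
proof -
  interpret D: Metric_space "L2_nonzero M" gdist by (rule geodesic_dist_metric)
  have "\<exists>P. limitin D.mtopology \<sigma> P sequentially" if \<sigma>: "D.MCauchy \<sigma>" for \<sigma>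
  proof -
    have mem: "\<sigma> n \<in> L2_nonzero M" for n using \<sigma> by (auto simp: D.MCauchy_def)
    have Cau: "\<exists>N. \<forall>n n'. N \<le> n \<longrightarrow> N \<le> n' \<longrightarrow> gdist (\<sigma> n) (\<sigma> n') < e" if "0 < e" for e
      using \<sigma> that by (auto simp: D.MCauchy_def)
    have "\<exists>f. f \<in> L2nz \<and> \<sigma> n = L2_class M f" for n using mem[of n] by (auto elim: L2_nonzeroE)
    then obtain F where F: "\<And>n. F n \<in> L2nz" "\<And>n. \<sigma> n = L2_class M (F n)" by metis
    have FL2: "F n \<in> L2" for n using F by (simp add: L2nz_iff)
    obtain N where N: "\<And>n n'. N \<le> n \<Longrightarrow> N \<le> n' \<Longrightarrow> gdist (\<sigma> n) (\<sigma> n') < 1"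
      using Cau[of 1] by auto
    define B where "B = \<bar>w (nrm (F N))\<bar> + 1"
    have B: "\<bar>w (nrm (F n))\<bar> \<le> B" if "N \<le> n" for n
      using gdist_W[OF F(1)[of N] F(1)[of n]] N[of N n] that F(2) by (simp add: B_def)
    obtain k where k: "0 < k" "\<And>f h. f \<in> L2nz \<Longrightarrow> h \<in> L2nz \<Longrightarrow> \<bar>w (nrm f)\<bar> \<le> B \<Longrightarrow>
        gdist (L2_class M f) (L2_class M h) < 1 \<Longrightarrow>
        k * nrm (\<lambda>x. h x - f x) \<le> gdist (L2_class M f) (L2_class M h)"
      using gdist_lower[of B] by blast
    have "\<exists>n0. \<forall>m\<ge>n0. \<forall>n\<ge>n0. nrm (\<lambda>x. F m x - F n x) < e" if "0 < e" for e
    proof -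
      have "0 < k * e" using k(1) that by simp
      then obtain n1 where n1: "\<And>n n'. n1 \<le> n \<Longrightarrow> n1 \<le> n' \<Longrightarrow> gdist (\<sigma> n) (\<sigma> n') < k * e"
        using Cau by blast
      have "nrm (\<lambda>x. F m x - F n x) < e" if "max N n1 \<le> m" "max N n1 \<le> n" for m n
      proof -
        have "k * nrm (\<lambda>x. F m x - F n x) \<le> gdist (\<sigma> n) (\<sigma> m)"
          using k(2)[OF F(1)[of n] F(1)[of m] B[of n]] N[of n m] that F(2) by simp
        also have "\<dots> < k * e" using n1 that by simp
        finally show ?thesis using k(1) by simp
      qed
      then show ?thesis by blast
    qed
    from L2_complete[OF FL2 this] obtain f where f: "f \<in> L2"
      and lim: "(\<lambda>n. nrm (\<lambda>x. F n x - f x)) \<longlonglongrightarrow> 0" by auto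
    have "(\<lambda>n. nrm (F n)) \<longlonglongrightarrow> nrm f"
    proof (rule Lim_null[THEN iffD2], rule Lim_null_comparison[OF _ lim])
      show "\<forall>\<^sub>F n in sequentially. norm (nrm (F n) - nrm f) \<le> nrm (\<lambda>x. F n x - f x)"
        using L2_norm_diff_ineq[OF FL2 f] by simp
    qed
    moreover have "\<forall>\<^sub>F n in sequentially. rho (- B) \<le> nrm (F n)"
      unfolding eventually_sequentially
      using W_range[of "nrm (F n)" B for n] B F(1) by (intro exI[of _ N]) (fastforce simp: L2nz_iff)
    ultimately have "rho (- B) \<le> nrm f"
      using tendsto_lowerbound sequentially_bot by blast
    then have fnz: "f \<in> L2nz" using f less_le_trans[OF rho_pos] by (simp add: L2nz_iff)
    obtain K where K: "0 < K" "\<And>h. h \<in> L2 \<Longrightarrow> nrm (\<lambda>x. h x - f x) < nrm f / 2 \<Longrightarrow>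
        gdist (L2_class M f) (L2_class M h) \<le> K * nrm (\<lambda>x. h x - f x)"
      using gdist_upper[OF fnz] by blast
    have "\<exists>N. \<forall>n\<ge>N. \<sigma> n \<in> L2_nonzero M \<and> gdist (\<sigma> n) (L2_class M f) < e" if "0 < e" for e
    proof -
      have "0 < min (nrm f / 2) (e / K)" using fnz K(1) that by (simp add: L2nz_iff)
      from LIMSEQ_D[OF lim this] obtain n0 where
        n0: "\<And>n. n0 \<le> n \<Longrightarrow> nrm (\<lambda>x. F n x - f x) < min (nrm f / 2) (e / K)"
        by auto
      have "gdist (\<sigma> n) (L2_class M f) < e" if "n0 \<le> n" for n
      proof -
        have "gdist (\<sigma> n) (L2_class M f) \<le> K * nrm (\<lambda>x. F n x - f x)"
          using K(2)[OF FL2[of n]] n0[OF that] F(2) by (simp add: gdist_commute[of "L2_class M (F n)"])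
        also have "\<dots> < e" using n0[OF that] K(1) by (simp add: field_simps)
        finally show ?thesis .
      qed
      then show ?thesis using mem by blast
    qed
    then show ?thesis
      using L2_nonzeroI[OF fnz] by (auto simp: D.limit_metric_sequentially)
  qed
  then show ?thesis by (simp add: D.mcomplete_def)
qed

end

section \<open>The geodesic equation\<close>

text \<open>\<open>T\<close> is the space in which a geodesic and its velocity live and whose elements test the geodesic
  equation: all of \<open>L\<^sup>2\<close>, or the smooth functions. In the second case \<open>T\<close> is not complete
  and the metric is weak.\<close>

locale geodesic_setting = L2_radial M C1 C2 for M :: "'m measure" and C1 C2 +
  fixes T :: "('m \<Rightarrow> real) set"
  assumes T_L2: "T \<subseteq> L2_functions M"
    and T_lincomb: "\<And>f h a b. f \<in> T \<Longrightarrow> h \<in> T \<Longrightarrow> (\<lambda>x. a * f x + b * h x) \<in> T"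
begin

text \<open>Geodesics together with their velocity \<open>v\<close> and acceleration \<open>u\<close>, the common content of geodesics
  in \<open>L\<^sup>2\<close> and of smooth geodesics.\<close>

definition motion ::
    "real set \<Rightarrow> (real \<Rightarrow> 'm \<Rightarrow> real) \<Rightarrow> (real \<Rightarrow> 'm \<Rightarrow> real) \<Rightarrow> (real \<Rightarrow> 'm \<Rightarrow> real) \<Rightarrow> bool" where
  "motion I c v u \<longleftrightarrow> open I \<and> is_interval I \<and>
    (\<forall>t\<in>I. c t \<in> T \<and> v t \<in> T \<and> u t \<in> L2 \<and> 0 < nrm (c t) \<and>
      has_L2_derivative M c (v t) t I \<and> has_L2_derivative M v (u t) t I \<and>
      geodesic_equation_at G T c v t)"

lemma motionD:
  assumes "motion I c v u" "t \<in> I"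
  shows "open I" "is_interval I" "c t \<in> T" "v t \<in> T" "c t \<in> L2" "v t \<in> L2" "u t \<in> L2" "0 < nrm (c t)"
    "has_L2_derivative M c (v t) t I" "has_L2_derivative M v (u t) t I"
    "geodesic_equation_at G T c v t" "0 < ip (c t) (c t)"
  using assms T_L2 by (auto simp: motion_def L2_norm_def)

lemma metric_position_derivative:
  assumes f: "f \<in> L2" "0 < ip f f" and h: "h \<in> L2" and k: "k \<in> L2"
  shows "((\<lambda>\<epsilon>. G (\<lambda>x. f x + \<epsilon> * k x) h h) has_real_derivative
    8 * (C1' (ip f f) * ip f k * ip h h + C2' (ip f f) * ip f k * (ip f h)\<^sup>2
      + C2 (ip f f) * ip f h * ip h k)) (at 0)"
proof -
  define A where "A = (\<lambda>\<epsilon>. ip f f + 2 * \<epsilon> * ip f k + \<epsilon>\<^sup>2 * ip k k)"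
  have A: "(A has_real_derivative 2 * ip f k) (at 0)"
    unfolding A_def by (auto intro!: derivative_eq_intros)
  have A0: "A 0 = ip f f" by (simp add: A_def)
  have eq: "G (\<lambda>x. f x + \<epsilon> * k x) h h = 4 * C1 (A \<epsilon>) * ip h h + 4 * C2 (A \<epsilon>) * (ip f h + \<epsilon> * ip h k)\<^sup>2" for \<epsilon>
  proof -
    have "(nrm (\<lambda>x. f x + \<epsilon> * k x))\<^sup>2 = A \<epsilon>"
      unfolding L2_norm_power2 using f h k
      by (simp add: A_def L2_inner_commute[of M k f] power2_eq_square algebra_simps)
    moreover have "ip (\<lambda>x. f x + \<epsilon> * k x) h = ip f h + \<epsilon> * ip h k"
      using f h k by (simp add: L2_inner_commute[of M k h])
    ultimately show ?thesis by (simp add: metric_G_def power2_eq_square)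
  qed
  have C: "((\<lambda>\<epsilon>. C1 (A \<epsilon>)) has_real_derivative C1' (ip f f) * (2 * ip f k)) (at 0)"
    "((\<lambda>\<epsilon>. C2 (A \<epsilon>)) has_real_derivative C2' (ip f f) * (2 * ip f k)) (at 0)"
    using DERIV_chain2[where f = C1 and g = A, OF _ A] DERIV_chain2[where f = C2 and g = A, OF _ A]
      C1_deriv[OF f(2)] C2_deriv[OF f(2)] A0 by simp_all
  show ?thesis
    unfolding eq
    by (auto intro!: derivative_eq_intros C simp: A0 power2_eq_square algebra_simps)
qed

context
  fixes I c v u t
  assumes mot: "motion I c v u" and t: "t \<in> I"
begin

lemma inner_derivative:
  assumes "has_L2_derivative M d d' t I" "\<And>s. s \<in> I \<Longrightarrow> d s \<in> L2" "d' \<in> L2"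
    and "has_L2_derivative M e e' t I" "\<And>s. s \<in> I \<Longrightarrow> e s \<in> L2" "e' \<in> L2"
  shows "((\<lambda>s. ip (d s) (e s)) has_real_derivative ip d' (e t) + ip (d t) e') (at t)"
  using L2_inner_has_derivative[OF assms t] at_within_open[OF t motionD(1)[OF mot t]] by simp

lemma motion_derivatives:
  shows "((\<lambda>s. ip (c s) (c s)) has_real_derivative 2 * ip (c t) (v t)) (at t)"
    and "((\<lambda>s. ip (c s) (v s)) has_real_derivative ip (v t) (v t) + ip (c t) (u t)) (at t)"
    and "((\<lambda>s. ip (v s) (v s)) has_real_derivative 2 * ip (v t) (u t)) (at t)"
    and "k \<in> L2 \<Longrightarrow> ((\<lambda>s. ip (c s) k) has_real_derivative ip (v t) k) (at t)"
    and "k \<in> L2 \<Longrightarrow> ((\<lambda>s. ip (v s) k) has_real_derivative ip (u t) k) (at t)"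
proof -
  note c = motionD(9)[OF mot t] motionD(5)[OF mot] motionD(6)[OF mot t]
  note v = motionD(10)[OF mot t] motionD(6)[OF mot] motionD(7)[OF mot t]
  show "((\<lambda>s. ip (c s) (c s)) has_real_derivative 2 * ip (c t) (v t)) (at t)"
    using inner_derivative[OF c c] by (simp add: L2_inner_commute[of M "v t"])
  show "((\<lambda>s. ip (c s) (v s)) has_real_derivative ip (v t) (v t) + ip (c t) (u t)) (at t)"
    by (rule inner_derivative[OF c v])
  show "((\<lambda>s. ip (v s) (v s)) has_real_derivative 2 * ip (v t) (u t)) (at t)"
    using inner_derivative[OF v v] by (simp add: L2_inner_commute[of M "u t"])
  show "((\<lambda>s. ip (c s) k) has_real_derivative ip (v t) k) (at t)" if "k \<in> L2"
    using inner_derivative[OF c has_L2_derivative_const that L2_zero] by simp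
  show "((\<lambda>s. ip (v s) k) has_real_derivative ip (u t) k) (at t)" if "k \<in> L2"
    using inner_derivative[OF v has_L2_derivative_const that L2_zero] by simp
qed

text \<open>Carrying out the differentiations, the geodesic equation expresses the tested acceleration by
  the tested velocity and position. The coefficients depend only on the inner products of position
  and velocity, once the radial acceleration \<open>ip (c t) (u t)\<close> is expressed by them in the next lemma.\<close>

lemma acceleration_equation:
  assumes k: "k \<in> T"
  defines "\<sigma> \<equiv> ip (c t) (c t)" and "p \<equiv> ip (c t) (v t)" and "q \<equiv> ip (v t) (v t)"
  shows "C1 \<sigma> * ip (u t) k = - 2 * C1' \<sigma> * p * ip (v t) k
    - (C2' \<sigma> * p\<^sup>2 + C2 \<sigma> * (q + ip (c t) (u t)) - C1' \<sigma> * q) * ip (c t) k"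
proof -
  note D = motionD[OF mot t]
  have kL2: "k \<in> L2" using k T_L2 by blast
  have pos: "0 < \<sigma>" using D(12) by (simp add: \<sigma>_def)
  obtain Q where Q: "((\<lambda>\<epsilon>. G (\<lambda>x. c t x + \<epsilon> * k x) (v t) (v t)) has_real_derivative Q) (at 0)"
    and Q2: "((\<lambda>s. G (c s) (v s) k) has_real_derivative (Q / 2)) (at t)"
    using D(11) k unfolding geodesic_equation_at_def by blast
  have Q': "Q = 8 * (C1' \<sigma> * ip (c t) k * q + C2' \<sigma> * ip (c t) k * p\<^sup>2 + C2 \<sigma> * p * ip (v t) k)"
    unfolding \<sigma>_def p_def q_def
    by (rule DERIV_unique[OF Q metric_position_derivative[OF D(5,12,6) kL2]])
  note d = motion_derivatives(1-3) motion_derivatives(4,5)[OF kL2]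
  have C: "((\<lambda>s. C1 (ip (c s) (c s))) has_real_derivative C1' \<sigma> * (2 * p)) (at t)"
    "((\<lambda>s. C2 (ip (c s) (c s))) has_real_derivative C2' \<sigma> * (2 * p)) (at t)"
    using DERIV_chain2[where f = C1 and g = "\<lambda>s. ip (c s) (c s)", OF C1_deriv[OF D(12)] d(1)]
      DERIV_chain2[where f = C2 and g = "\<lambda>s. ip (c s) (c s)", OF C2_deriv[OF D(12)] d(1)]
    by (simp_all add: \<sigma>_def p_def)
  have "((\<lambda>s. G (c s) (v s) k) has_real_derivative
      4 * (C1' \<sigma> * (2 * p) * ip (v t) k + C1 \<sigma> * ip (u t) k)
      + 4 * (C2' \<sigma> * (2 * p) * p * ip (c t) k + C2 \<sigma> * (q + ip (c t) (u t)) * ip (c t) k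
        + C2 \<sigma> * p * ip (v t) k)) (at t)"
    unfolding metric_G_def L2_norm_power2
    by (auto intro!: derivative_eq_intros C d simp: \<sigma>_def[symmetric] p_def[symmetric] q_def[symmetric] algebra_simps)
  from DERIV_unique[OF Q2 this] show ?thesis
    unfolding Q' by (simp add: power2_eq_square algebra_simps)
qed

text \<open>The component of the acceleration along \<open>c\<close>; the factor \<open>C1 + C2 \<sigma>\<close> that is inverted here
  is positive because the metric is.\<close>

lemma radial_acceleration:
  defines "\<sigma> \<equiv> ip (c t) (c t)" and "p \<equiv> ip (c t) (v t)" and "q \<equiv> ip (v t) (v t)"
  shows "ip (c t) (u t) =
    - (2 * C1' \<sigma> * p\<^sup>2 + \<sigma> * (C2' \<sigma> * p\<^sup>2 + C2 \<sigma> * q - C1' \<sigma> * q)) / (C1 \<sigma> + C2 \<sigma> * \<sigma>)"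
proof -
  have pos: "0 < C1 \<sigma> + C2 \<sigma> * \<sigma>" using C12_pos motionD(12)[OF mot t] by (simp add: \<sigma>_def)
  have "C1 \<sigma> * ip (c t) (u t) = - 2 * C1' \<sigma> * p * p
    - (C2' \<sigma> * p\<^sup>2 + C2 \<sigma> * (q + ip (c t) (u t)) - C1' \<sigma> * q) * \<sigma>"
    using acceleration_equation[OF motionD(3)[OF mot t]]
    by (simp add: \<sigma>_def p_def q_def L2_inner_commute[of M "u t"] L2_inner_commute[of M "v t" "c t"])
  then have "ip (c t) (u t) * (C1 \<sigma> + C2 \<sigma> * \<sigma>)
      = - (2 * C1' \<sigma> * p\<^sup>2 + \<sigma> * (C2' \<sigma> * p\<^sup>2 + C2 \<sigma> * q - C1' \<sigma> * q))"
    by (simp add: power2_eq_square algebra_simps)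
  then show ?thesis using pos by (simp add: eq_divide_eq)
qed

end

text \<open>For \<open>h = f'\<close> in polar coordinates this is \<open>(C1 r\<^sup>2 \<theta>')\<^sup>2\<close>: up to the factor 16, the square of the
  Noether charge of rotations in the plane of \<open>f\<close> and \<open>h\<close>.\<close>

definition angular_momentum_sq :: "('m \<Rightarrow> real) \<Rightarrow> ('m \<Rightarrow> real) \<Rightarrow> real" where
  "angular_momentum_sq f h = (C1 (ip f f))\<^sup>2 * (ip f f * ip h h - (ip f h)\<^sup>2)"

lemma angular_momentum_conserved:
  assumes mot: "motion I c v u" and "t \<in> I" "t0 \<in> I"
  shows "angular_momentum_sq (c t) (v t) = angular_momentum_sq (c t0) (v t0)"
proof (rule DERIV_zero_interval[of I "\<lambda>t. angular_momentum_sq (c t) (v t)"])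
  show "is_interval I" by (rule motionD(2)[OF assms(1,2)])
  fix t assume t: "t \<in> I"
  define \<sigma> p q where "\<sigma> = ip (c t) (c t)" and "p = ip (c t) (v t)" and "q = ip (v t) (v t)"
  note D = motionD[OF mot t] and d = motion_derivatives[OF mot t]
  define X Y where "X = ip (v t) (u t)" and "Y = ip (c t) (u t)"
  define lam where "lam = C2' \<sigma> * p\<^sup>2 + C2 \<sigma> * (q + Y) - C1' \<sigma> * q"
  have EY: "C1 \<sigma> * Y = - 2 * C1' \<sigma> * p * p - lam * \<sigma>"
    using acceleration_equation[OF mot t D(3)]
    by (simp add: \<sigma>_def p_def q_def Y_def lam_def L2_inner_commute[of M "u t"] L2_inner_commute[of M "v t" "c t"])
  have EX: "C1 \<sigma> * X = - 2 * C1' \<sigma> * p * q - lam * p"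
    using acceleration_equation[OF mot t D(4)]
    by (simp add: \<sigma>_def p_def q_def X_def Y_def lam_def L2_inner_commute[of M "u t" "v t"])
  have C: "((\<lambda>s. C1 (ip (c s) (c s))) has_real_derivative C1' \<sigma> * (2 * p)) (at t)"
    using DERIV_chain2[where f = C1 and g = "\<lambda>s. ip (c s) (c s)", OF C1_deriv[OF D(12)] d(1)]
    by (simp add: \<sigma>_def p_def)
  have "((\<lambda>s. angular_momentum_sq (c s) (v s)) has_real_derivative
      2 * C1 \<sigma> * (C1' \<sigma> * (2 * p)) * (\<sigma> * q - p\<^sup>2) + (C1 \<sigma>)\<^sup>2 * (2 * p * q + \<sigma> * (2 * X) - 2 * p * (q + Y))) (at t)"
    unfolding angular_momentum_sq_def
    by (auto intro!: derivative_eq_intros C d(1-3)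
        simp: \<sigma>_def[symmetric] p_def[symmetric] q_def[symmetric] X_def[symmetric] Y_def[symmetric])
  also have "2 * C1 \<sigma> * (C1' \<sigma> * (2 * p)) * (\<sigma> * q - p\<^sup>2) + (C1 \<sigma>)\<^sup>2 * (2 * p * q + \<sigma> * (2 * X) - 2 * p * (q + Y))
      = 2 * C1 \<sigma> * (2 * C1' \<sigma> * p * (\<sigma> * q - p\<^sup>2) + \<sigma> * (C1 \<sigma> * X) - p * (C1 \<sigma> * Y))"
    by (simp add: power2_eq_square algebra_simps)
  also have "\<dots> = 0" unfolding EX EY by (simp add: power2_eq_square algebra_simps)
  finally show "((\<lambda>s. angular_momentum_sq (c s) (v s)) has_real_derivative 0) (at t)" .
qed fact+

text \<open>The radial motion is Newton's equation in the coordinate \<open>s = W (r)\<close>. The derivative of \<open>C2\<close>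
  cancels because \<open>W' = sqrt g2\<close>.\<close>

lemma radial_Newton:
  assumes mot: "motion I c v u" and t: "t \<in> I"
  shows "((\<lambda>s. w (nrm (c s))) has_real_derivative sqrt (g (nrm (c t))) * (ip (c t) (v t) / nrm (c t))) (at t)"
    and "((\<lambda>s. sqrt (g (nrm (c s))) * (ip (c s) (v s) / nrm (c s))) has_real_derivative
      radial_force (angular_momentum_sq (c t) (v t)) (nrm (c t))) (at t)"
proof -
  note D = motionD[OF mot t] and d = motion_derivatives[OF mot t]
  define r p q Y where "r = nrm (c t)" and "p = ip (c t) (v t)" and "q = ip (v t) (v t)" and "Y = ip (c t) (u t)"
  have r: "0 < r" "ip (c t) (c t) = r\<^sup>2" using D(8) by (simp_all add: r_def)
  from DERIV_chain2[where f = sqrt and g = "\<lambda>s. ip (c s) (c s)", OF DERIV_real_sqrt[OF D(12)] d(1)]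
  have nd: "((\<lambda>s. nrm (c s)) has_real_derivative p / r) (at t)"
    unfolding L2_norm_def r_def p_def by (simp add: field_simps)
  from DERIV_chain2[where f = w and g = "\<lambda>s. nrm (c s)", OF W_deriv[OF D(8)] nd]
  show "((\<lambda>s. w (nrm (c s))) has_real_derivative sqrt (g (nrm (c t))) * (ip (c t) (v t) / nrm (c t))) (at t)"
    by (simp add: r_def p_def)
  define S where "S = sqrt (g r)"
  have S: "0 < S" "S\<^sup>2 = 4 * (C1 (r\<^sup>2) + C2 (r\<^sup>2) * r\<^sup>2)"
    using g_pos[OF r(1)] by (simp_all add: S_def g2_def)
  define g' where "g' = 4 * (2 * r * C1' (r\<^sup>2) + 2 * r ^ 3 * C2' (r\<^sup>2) + 2 * r * C2 (r\<^sup>2))"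
  have "((\<lambda>s. g (nrm (c s))) has_real_derivative g' * (p / r)) (at t)"
    using DERIV_chain2[where f = g and g = "\<lambda>s. nrm (c s)", OF g_deriv[OF D(8)] nd]
    by (simp add: g'_def r_def)
  from DERIV_chain2[where f = sqrt and g = "\<lambda>s. g (nrm (c s))", OF DERIV_real_sqrt[OF g_pos[OF D(8)]] this]
  have Sd: "((\<lambda>s. sqrt (g (nrm (c s)))) has_real_derivative g' * (p / r) / (2 * S)) (at t)"
    by (simp add: S_def r_def field_simps)
  have "((\<lambda>s. ip (c s) (v s) / nrm (c s)) has_real_derivative ((q + Y) * r - p * (p / r)) / (r * r)) (at t)"
    using DERIV_divide[OF d(2) nd] D(8) by (simp add: r_def p_def q_def Y_def)
  from DERIV_mult[OF Sd this]
  have "((\<lambda>s. sqrt (g (nrm (c s))) * (ip (c s) (v s) / nrm (c s))) has_real_derivative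
      g' * (p / r) / (2 * S) * (p / r) + ((q + Y) * r - p * (p / r)) / (r * r) * S) (at t)"
    by (simp add: S_def r_def p_def)
  also have "g' * (p / r) / (2 * S) * (p / r) + ((q + Y) * r - p * (p / r)) / (r * r) * S
      = radial_force (angular_momentum_sq (c t) (v t)) r"
  proof -
    have "(g' * (p / r) / (2 * S) * (p / r) + ((q + Y) * r - p * (p / r)) / (r * r) * S) * (r ^ 3 * S)
        = g' * p\<^sup>2 * r / 2 + S\<^sup>2 * ((q + Y) * r\<^sup>2 - p\<^sup>2)"
      using r(1) S(1) by (simp add: field_simps power2_eq_square power3_eq_cube)
    also have "\<dots> = 4 * ((r\<^sup>2 * q - p\<^sup>2) * (C1 (r\<^sup>2) + r\<^sup>2 * C1' (r\<^sup>2)))"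
    proof -
      have "C1 (r\<^sup>2) * Y = - 2 * C1' (r\<^sup>2) * p * p
          - (C2' (r\<^sup>2) * p\<^sup>2 + C2 (r\<^sup>2) * (q + Y) - C1' (r\<^sup>2) * q) * r\<^sup>2"
        using acceleration_equation[OF mot t D(3)] unfolding r(2)
        by (simp add: p_def q_def Y_def L2_inner_commute[of M "u t"] L2_inner_commute[of M "v t" "c t"])
      then have Y: "C1 (r\<^sup>2) * Y + C2 (r\<^sup>2) * r\<^sup>2 * Y = - 2 * C1' (r\<^sup>2) * p * p
          - (C2' (r\<^sup>2) * p\<^sup>2 + C2 (r\<^sup>2) * q - C1' (r\<^sup>2) * q) * r\<^sup>2"
        by (simp add: algebra_simps)
      have "g' * p\<^sup>2 * r / 2 + S\<^sup>2 * ((q + Y) * r\<^sup>2 - p\<^sup>2)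
          = g' * p\<^sup>2 * r / 2 + 4 * (C1 (r\<^sup>2) + C2 (r\<^sup>2) * r\<^sup>2) * (q * r\<^sup>2 - p\<^sup>2)
            + 4 * r\<^sup>2 * (C1 (r\<^sup>2) * Y + C2 (r\<^sup>2) * r\<^sup>2 * Y)"
        unfolding S(2) by (simp add: algebra_simps)
      also have "\<dots> = 4 * ((r\<^sup>2 * q - p\<^sup>2) * (C1 (r\<^sup>2) + r\<^sup>2 * C1' (r\<^sup>2)))"
        unfolding Y g'_def by (simp add: algebra_simps eval_nat_numeral)
      finally show ?thesis .
    qed
    finally have "g' * (p / r) / (2 * S) * (p / r) + ((q + Y) * r - p * (p / r)) / (r * r) * S
        = 4 * ((r\<^sup>2 * q - p\<^sup>2) * (C1 (r\<^sup>2) + r\<^sup>2 * C1' (r\<^sup>2))) / (r ^ 3 * S)"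
      using r(1) S(1) by (simp add: eq_divide_eq)
    also have "\<dots> = radial_force (angular_momentum_sq (c t) (v t)) r"
      unfolding radial_force_def angular_momentum_sq_def r(2) p_def[symmetric] q_def[symmetric] S_def[symmetric]
      using r(1) S(1) C1_pos[of "r\<^sup>2"] by (simp add: field_simps)
    finally show ?thesis .
  qed
  finally show "((\<lambda>s. sqrt (g (nrm (c s))) * (ip (c s) (v s) / nrm (c s))) has_real_derivative
      radial_force (angular_momentum_sq (c t) (v t)) (nrm (c t))) (at t)"
    by (simp add: r_def)
qed


subsection \<open>Uniqueness\<close>

text \<open>Newton's equation determines the norms. Once these are known, the coefficients of
  the equation for the acceleration are known functions of time, so the difference of two geodesics
  solves a linear equation and Gronwall's inequality applies.\<close>

lemma motion_unique:
  assumes m: "motion I c v u" and m': "motion I c' v' u'" and t0: "t0 \<in> I" and t: "t \<in> I"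
    and init: "AE x in M. c t0 x = c' t0 x" "AE x in M. v t0 x = v' t0 x"
  shows "AE x in M. c t x = c' t x"
proof -
  note D = motionD[OF m] and D' = motionD[OF m']
  note int = D(2)[OF t0]
  define J where "J = angular_momentum_sq (c t0) (v t0)"
  have ip0: "ip (c t0) (c t0) = ip (c' t0) (c' t0)" "ip (c t0) (v t0) = ip (c' t0) (v' t0)"
    "ip (v t0) (v t0) = ip (v' t0) (v' t0)"
    using D(5,6)[OF t0] D'(5,6)[OF t0] init by (auto intro!: L2_inner_cong_AE)
  then have nrm0: "nrm (c t0) = nrm (c' t0)" by (simp add: L2_norm_def)
  have J: "angular_momentum_sq (c s) (v s) = J" "angular_momentum_sq (c' s) (v' s) = J" if "s \<in> I" for s
    using angular_momentum_conserved[OF m that t0] angular_momentum_conserved[OF m' that t0] ip0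
    by (simp_all add: J_def angular_momentum_sq_def)
  have newton: "w (nrm (c s)) = w (nrm (c' s)) \<and>
      sqrt (g (nrm (c s))) * (ip (c s) (v s) / nrm (c s)) = sqrt (g (nrm (c' s))) * (ip (c' s) (v' s) / nrm (c' s))"
    if s: "s \<in> I" for s
  proof (rule Newton_unique[OF int t0 s radial_force_smooth[of J], where s = "\<lambda>s. w (nrm (c s))"
        and s' = "\<lambda>s. w (nrm (c' s))" and z = "\<lambda>s. sqrt (g (nrm (c s))) * (ip (c s) (v s) / nrm (c s))"
        and z' = "\<lambda>s. sqrt (g (nrm (c' s))) * (ip (c' s) (v' s) / nrm (c' s))"])
    fix s assume s: "s \<in> I"
    show "((\<lambda>s. w (nrm (c s))) has_real_derivative sqrt (g (nrm (c s))) * (ip (c s) (v s) / nrm (c s))) (at s)"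
      "((\<lambda>s. w (nrm (c' s))) has_real_derivative sqrt (g (nrm (c' s))) * (ip (c' s) (v' s) / nrm (c' s))) (at s)"
      by (rule radial_Newton(1)[OF m s] radial_Newton(1)[OF m' s])+
    show "((\<lambda>s. sqrt (g (nrm (c s))) * (ip (c s) (v s) / nrm (c s))) has_real_derivative
        radial_force J (rho (w (nrm (c s))))) (at s)"
      using radial_Newton(2)[OF m s] J[OF s] rho_W[OF D(8)[OF s]] by simp
    show "((\<lambda>s. sqrt (g (nrm (c' s))) * (ip (c' s) (v' s) / nrm (c' s))) has_real_derivative
        radial_force J (rho (w (nrm (c' s))))) (at s)"
      using radial_Newton(2)[OF m' s] J[OF s] rho_W[OF D'(8)[OF s]] by simp
  qed (use nrm0 ip0 in simp_all)
  have nrm_eq: "nrm (c s) = nrm (c' s)" if "s \<in> I" for s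
    using newton[OF that] rho_W[OF D(8)[OF that]] rho_W[OF D'(8)[OF that]] by metis
  define \<sigma> p q where "\<sigma> = (\<lambda>s. ip (c s) (c s))" and "p = (\<lambda>s. ip (c s) (v s))" and "q = (\<lambda>s. ip (v s) (v s))"
  have \<sigma>0: "0 < \<sigma> s" if "s \<in> I" for s using D(12)[OF that] by (simp add: \<sigma>_def)
  have \<sigma>': "ip (c' s) (c' s) = \<sigma> s" if "s \<in> I" for s
    using nrm_eq[OF that] unfolding \<sigma>_def by (metis L2_norm_power2)
  have p': "ip (c' s) (v' s) = p s" if "s \<in> I" for s
  proof -
    have "sqrt (g (nrm (c s))) \<noteq> 0" "nrm (c s) \<noteq> 0" using g_pos[OF D(8)[OF that]] D(8)[OF that] by auto
    then show ?thesis using newton[OF that] nrm_eq[OF that] by (simp add: p_def)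
  qed
  have q': "ip (v' s) (v' s) = q s" if "s \<in> I" for s
  proof -
    have "(C1 (\<sigma> s))\<^sup>2 * (\<sigma> s * q s - (p s)\<^sup>2) = (C1 (\<sigma> s))\<^sup>2 * (\<sigma> s * ip (v' s) (v' s) - (p s)\<^sup>2)"
      using J[OF that] unfolding angular_momentum_sq_def \<sigma>'[OF that] p'[OF that]
      by (simp add: \<sigma>_def p_def q_def)
    then show ?thesis using C1_pos[OF \<sigma>0[OF that]] \<sigma>0[OF that] by simp
  qed
  define Y where "Y = (\<lambda>s. - (2 * C1' (\<sigma> s) * (p s)\<^sup>2 + \<sigma> s * (C2' (\<sigma> s) * (p s)\<^sup>2 + C2 (\<sigma> s) * q s
      - C1' (\<sigma> s) * q s)) / (C1 (\<sigma> s) + C2 (\<sigma> s) * \<sigma> s))"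
  have Y: "ip (c s) (u s) = Y s" "ip (c' s) (u' s) = Y s" if "s \<in> I" for s
    using radial_acceleration[OF m that] radial_acceleration[OF m' that] \<sigma>'[OF that] p'[OF that] q'[OF that]
    by (simp_all add: Y_def \<sigma>_def p_def q_def)
  define A where "A = (\<lambda>s. - 2 * C1' (\<sigma> s) * p s / C1 (\<sigma> s))"
  define l where "l = (\<lambda>s. C2' (\<sigma> s) * (p s)\<^sup>2 + C2 (\<sigma> s) * (q s + Y s) - C1' (\<sigma> s) * q s)"
  define B where "B = (\<lambda>s. - l s / C1 (\<sigma> s))"
  have acc: "ip (u s) k = A s * ip (v s) k + B s * ip (c s) k"
    "ip (u' s) k = A s * ip (v' s) k + B s * ip (c' s) k" if s: "s \<in> I" and k: "k \<in> T" for s k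
  proof -
    have C: "0 < C1 (\<sigma> s)" using C1_pos[OF \<sigma>0[OF s]] .
    have solve: "U = (- 2 * a1 * a2 / b) * x - l / b * y"
      if "b * U = - 2 * a1 * a2 * x - l * y" "0 < b" for a1 a2 b l x y U :: real
    proof -
      have "U = (- 2 * a1 * a2 * x - l * y) / b" using that by (simp add: eq_divide_eq mult.commute)
      then show ?thesis by (simp add: diff_divide_distrib)
    qed
    have "C1 (\<sigma> s) * ip (u s) k = - 2 * C1' (\<sigma> s) * p s * ip (v s) k - l s * ip (c s) k"
      using acceleration_equation[OF m s k] Y(1)[OF s] by (simp add: l_def \<sigma>_def p_def q_def)
    from solve[OF this C] show "ip (u s) k = A s * ip (v s) k + B s * ip (c s) k"
      by (simp add: A_def B_def)
    have "C1 (\<sigma> s) * ip (u' s) k = - 2 * C1' (\<sigma> s) * p s * ip (v' s) k - l s * ip (c' s) k"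
      using acceleration_equation[OF m' s k] Y(2)[OF s] by (simp add: l_def \<sigma>'[OF s] p'[OF s] q'[OF s])
    from solve[OF this C] show "ip (u' s) k = A s * ip (v' s) k + B s * ip (c' s) k"
      by (simp add: A_def B_def)
  qed
  have cont: "continuous_on I \<sigma>" "continuous_on I p" "continuous_on I q"
    unfolding \<sigma>_def p_def q_def
    using motion_derivatives(1-3)[OF m, THEN DERIV_isCont] by (auto intro!: continuous_at_imp_continuous_on)
  have comp: "continuous_on I (\<lambda>s. f (\<sigma> s))" if "continuous_on {0<..} f" for f :: "real \<Rightarrow> real"
    by (rule continuous_on_compose2[OF that cont(1)]) (use \<sigma>0 in auto)
  note cC = comp[OF C_infty_continuous[OF C1_smooth]] comp[OF C_infty_continuous[OF C2_smooth]]
    comp[OF C_infty_continuous[OF C_infty_deriv(2)[OF C1_smooth]]]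
    comp[OF C_infty_continuous[OF C_infty_deriv(2)[OF C2_smooth]]]
  have C12: "C1 (\<sigma> s) + C2 (\<sigma> s) * \<sigma> s \<noteq> 0" "C1 (\<sigma> s) \<noteq> 0" if "s \<in> I" for s
    using C12_pos[OF \<sigma>0[OF that]] C1_pos[OF \<sigma>0[OF that]] by auto
  have contY: "continuous_on I Y"
    unfolding Y_def by (intro continuous_intros cont cC ballI C12) auto
  have contA: "continuous_on I A" unfolding A_def by (intro continuous_intros cont cC ballI C12) auto
  have contB: "continuous_on I B" unfolding B_def l_def by (intro continuous_intros cont cC contY ballI C12) auto
  define d e f where "d = (\<lambda>s x. c s x - c' s x)" and "e = (\<lambda>s x. v s x - v' s x)" and "f = (\<lambda>s x. u s x - u' s x)"
  have L2: "d s \<in> L2" "e s \<in> L2" "f s \<in> L2" if "s \<in> I" for s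
    using D(5-7)[OF that] D'(5-7)[OF that] by (auto simp: d_def e_def f_def)
  have dd: "has_L2_derivative M d (e s) s I" "has_L2_derivative M e (f s) s I" if s: "s \<in> I" for s
  proof -
    have diff: "has_L2_derivative M (\<lambda>s x. a s x - b s x) (\<lambda>x. a' x - b' x) s I"
      if "has_L2_derivative M a a' s I" "\<And>s. s \<in> I \<Longrightarrow> a s \<in> L2" "a' \<in> L2"
        "has_L2_derivative M b b' s I" "\<And>s. s \<in> I \<Longrightarrow> b s \<in> L2" "b' \<in> L2" for a a' b b'
    proof -
      have "has_L2_derivative M (\<lambda>s x. - 1 * b s x) (\<lambda>x. - 1 * b' x) s I"
      proof -
        have "(\<lambda>x. (- 1 * b r x - - 1 * b s x) / (r - s) - - 1 * b' x)
            = (\<lambda>x. - 1 * ((b r x - b s x) / (r - s) - b' x))" for r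
          by (auto simp: fun_eq_iff minus_divide_left)
        then show ?thesis
          using that(4) unfolding has_L2_derivative_def by (simp only: L2_norm_cmult) simp
      qed
      from has_L2_derivative_add[OF that(1-3) this L2_cmult[OF that(5)] L2_cmult[OF that(6)] s]
      show ?thesis by simp
    qed
    show "has_L2_derivative M d (e s) s I" "has_L2_derivative M e (f s) s I"
      unfolding d_def e_def f_def
      by (rule diff D(9,10)[OF s] D'(9,10)[OF s] D(5,6,7) D'(5,6,7) s; assumption?)+
  qed
  have uv: "ip (f s) (e s) = A s * ip (e s) (e s) + B s * ip (d s) (e s)" if s: "s \<in> I" for s
    using D(3-7)[OF s] D'(3-7)[OF s] acc[OF s D(4)[OF s]] acc[OF s D'(4)[OF s]]
    by (simp add: d_def e_def f_def algebra_simps)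
  define N where "N = (\<lambda>s. ip (d s) (d s) + ip (e s) (e s))"
  define N' where "N' = (\<lambda>s. 2 * ip (d s) (e s) + 2 * ip (f s) (e s))"
  have "N t = 0"
  proof (rule gronwall_zero[OF int t0 t, of N N'])
    show "N t0 = 0"
    proof -
      have "nrm (d t0) = 0" "nrm (e t0) = 0"
        unfolding d_def e_def using D(5,6)[OF t0] D'(5,6)[OF t0] init by (simp_all add: L2_norm_diff_eq_0_iff)
      then show ?thesis by (simp add: N_def L2_norm_def)
    qed
    show "0 \<le> N s" for s by (simp add: N_def)
    show "(N has_real_derivative N' s) (at s)" if s: "s \<in> I" for s
    proof -
      have "((\<lambda>s. ip (d s) (d s)) has_real_derivative ip (e s) (d s) + ip (d s) (e s)) (at s)"
        by (rule inner_derivative[OF m s dd(1)[OF s] L2(1) L2(2)[OF s] dd(1)[OF s] L2(1) L2(2)[OF s]])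
      moreover have "((\<lambda>s. ip (e s) (e s)) has_real_derivative ip (f s) (e s) + ip (e s) (f s)) (at s)"
        by (rule inner_derivative[OF m s dd(2)[OF s] L2(2) L2(3)[OF s] dd(2)[OF s] L2(2) L2(3)[OF s]])
      ultimately have "(N has_real_derivative (ip (e s) (d s) + ip (d s) (e s)) + (ip (f s) (e s) + ip (e s) (f s))) (at s)"
        unfolding N_def by (rule DERIV_add)
      then show ?thesis
        by (simp add: N'_def L2_inner_commute[of M "e s" "d s"] L2_inner_commute[of M "e s" "f s"])
    qed
    fix a b assume ab: "{a..b} \<subseteq> I"
    have "bounded (A ` {a..b})" "bounded (B ` {a..b})"
      using continuous_on_subset[OF contA ab] continuous_on_subset[OF contB ab]
      by (auto intro!: compact_imp_bounded compact_continuous_image)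
    then obtain KA KB where K: "\<forall>s\<in>{a..b}. \<bar>A s\<bar> \<le> KA" "\<forall>s\<in>{a..b}. \<bar>B s\<bar> \<le> KB"
      unfolding bounded_iff by (metis imageI real_norm_def)
    have "\<bar>N' s\<bar> \<le> (1 + 2 * KA + KB) * N s" if s: "s \<in> {a..b}" for s
    proof -
      have sI: "s \<in> I" using s ab by blast
      have N0: "0 \<le> N s" "ip (e s) (e s) \<le> N s" by (auto simp: N_def)
      have de: "2 * \<bar>ip (d s) (e s)\<bar> \<le> N s"
      proof -
        have "2 * \<bar>ip (d s) (e s)\<bar> \<le> 2 * nrm (d s) * nrm (e s)"
          using L2_Cauchy_Schwarz[OF L2(1,2)[OF sI]] by simp
        also have "\<dots> \<le> (nrm (d s))\<^sup>2 + (nrm (e s))\<^sup>2" by (rule sum_squares_bound)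
        finally show ?thesis by (simp add: N_def)
      qed
      have "\<bar>N' s\<bar> \<le> 2 * \<bar>ip (d s) (e s)\<bar> + 2 * \<bar>A s\<bar> * ip (e s) (e s) + \<bar>B s\<bar> * (2 * \<bar>ip (d s) (e s)\<bar>)"
      proof -
        have "N' s = 2 * ip (d s) (e s) + (2 * (A s * ip (e s) (e s)) + 2 * (B s * ip (d s) (e s)))"
          unfolding N'_def uv[OF sI] by simp
        then have "\<bar>N' s\<bar> \<le> \<bar>2 * ip (d s) (e s)\<bar> + (\<bar>2 * (A s * ip (e s) (e s))\<bar> + \<bar>2 * (B s * ip (d s) (e s))\<bar>)"
          by linarith
        then show ?thesis by (simp add: abs_mult)
      qed
      also have "\<dots> \<le> N s + 2 * KA * N s + KB * N s"
        using K s de N0 by (intro add_mono mult_mono) (auto intro: order_trans[OF abs_ge_zero])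
      finally show ?thesis by (simp add: algebra_simps)
    qed
    then show "\<exists>K. \<forall>s\<in>{a..b}. \<bar>N' s\<bar> \<le> K * N s" by blast
  qed
  then have "ip (d t) (d t) = 0"
    using L2_inner_self_nonneg[of M "d t"] L2_inner_self_nonneg[of M "e t"] unfolding N_def by linarith
  then have "nrm (d t) = 0" by (simp add: L2_norm_def)
  then show ?thesis
    unfolding d_def using D(5)[OF t] D'(5)[OF t] by (simp add: L2_norm_diff_eq_0_iff)
qed

end

subsection \<open>Explicit global geodesics\<close>

lemma Newton_solution_smooth:
  fixes s z F :: "real \<Rightarrow> real"
  assumes s: "\<And>t. (s has_real_derivative z t) (at t)" and z: "\<And>t. (z has_real_derivative F (s t)) (at t)"
    and F: "C_infty F UNIV"
  shows "C_infty s UNIV"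
proof -
  have "Ck_on k s UNIV \<and> Ck_on k z UNIV" for k
  proof (induction k)
    case 0
    then show ?case
      using DERIV_isCont[OF s] DERIV_isCont[OF z] by (auto intro!: continuous_at_imp_continuous_on)
  next
    case (Suc k)
    have "Ck_on k (\<lambda>t. F (s t)) UNIV"
      by (rule Ck_on_compose[of UNIV UNIV s k F]) (use F Suc in \<open>auto simp: C_infty_def\<close>)
    then have "Ck_on (Suc k) z UNIV"
      by (rule Ck_on_realI[OF open_UNIV z])
    moreover have "Ck_on (Suc k) s UNIV" by (rule Ck_on_realI[OF open_UNIV s conjunct2[OF Suc]])
    ultimately show ?case by blast
  qed
  then show ?thesis by (simp add: C_infty_def)
qed

lemma (in radial) polar_solution:
  assumes "0 < r0"
  shows "\<exists>r r' \<theta>. C_infty r UNIV \<and> C_infty \<theta> UNIV \<and> r t0 = r0 \<and> r' t0 = r0' \<and> \<theta> t0 = 0 \<and>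
    (\<forall>t. 0 < r t \<and> (r has_real_derivative r' t) (at t)
      \<and> ((\<lambda>t. sqrt (g (r t)) * r' t) has_real_derivative radial_force (j\<^sup>2) (r t)) (at t)
      \<and> (\<theta> has_real_derivative j / ((r t)\<^sup>2 * C1 ((r t)\<^sup>2))) (at t))"
proof -
  obtain s z where init: "s t0 = w r0" "z t0 = sqrt (g r0) * r0'"
    and s: "\<And>t. (s has_real_derivative z t) (at t)"
    and z: "\<And>t. (z has_real_derivative radial_force (j\<^sup>2) (rho (s t))) (at t)"
    using Newton_global[OF radial_force_smooth potential_deriv potential_nonneg[OF zero_le_power2],
        of t0 "w r0" "sqrt (g r0) * r0'" j] by blast
  define r where "r = (\<lambda>t. rho (s t))"
  define r' where "r' = (\<lambda>t. z t / sqrt (g (r t)))"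
  have r: "0 < r t" for t by (simp add: r_def)
  have S: "0 < sqrt (g (r t))" for t using g_pos[OF r] by simp
  have rd: "(r has_real_derivative r' t) (at t)" for t
    using DERIV_chain2[where f = rho and g = s, OF rho_deriv s]
    by (simp add: r_def r'_def divide_inverse mult.commute)
  have zr: "sqrt (g (r t)) * r' t = z t" for t using S[of t] by (simp add: r'_def)
  have r_smooth: "C_infty r UNIV"
    unfolding r_def
    by (rule C_infty_compose[OF rho_smooth Newton_solution_smooth[OF s z radial_force_smooth]]) auto
  define \<omega> where "\<omega> = (\<lambda>t. j / ((r t)\<^sup>2 * C1 ((r t)\<^sup>2)))"
  have "C_infty (\<lambda>t. (r t)\<^sup>2 * C1 ((r t)\<^sup>2)) UNIV"
  proof -
    have "C_infty (\<lambda>t. C1 ((r t)\<^sup>2)) UNIV"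
      by (rule C_infty_compose[OF C1_square_smooth r_smooth]) (auto simp: r)
    then show ?thesis by (intro C_infty_mult C_infty_power r_smooth) auto
  qed
  then have \<omega>_smooth: "C_infty \<omega> UNIV"
    unfolding \<omega>_def by (rule C_infty_divide[OF C_infty_const])
      (use r C1_pos in \<open>auto intro!: mult_pos_pos zero_less_power\<close>)
  obtain H where H: "\<And>t. (H has_vector_derivative \<omega> t) (at t)"
    using antiderivative_exists[OF C_infty_continuous[OF \<omega>_smooth]] by blast
  define \<theta> where "\<theta> = (\<lambda>t. H t - H t0)"
  have \<theta>: "(\<theta> has_real_derivative \<omega> t) (at t)" for t
    using H unfolding \<theta>_def has_real_derivative_iff_has_vector_derivative
    by (auto intro!: derivative_eq_intros)
  have "C_infty \<theta> UNIV" by (rule C_infty_derivI[OF open_UNIV \<theta> \<omega>_smooth])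
  moreover have "r t0 = r0" using init(1) assms by (simp add: r_def rho_W)
  moreover have "r' t0 = r0'"
    using S[of t0] init(2) \<open>r t0 = r0\<close> by (simp add: r'_def)
  moreover have "\<theta> t0 = 0" by (simp add: \<theta>_def)
  moreover have "((\<lambda>t. sqrt (g (r t)) * r' t) has_real_derivative radial_force (j\<^sup>2) (r t)) (at t)" for t
    using z[of t] unfolding zr by (simp add: r_def)
  ultimately have "C_infty r UNIV \<and> C_infty \<theta> UNIV \<and> r t0 = r0 \<and> r' t0 = r0' \<and> \<theta> t0 = 0 \<and>
    (\<forall>t. 0 < r t \<and> (r has_real_derivative r' t) (at t)
      \<and> ((\<lambda>t. sqrt (g (r t)) * r' t) has_real_derivative radial_force (j\<^sup>2) (r t)) (at t)
      \<and> (\<theta> has_real_derivative j / ((r t)\<^sup>2 * C1 ((r t)\<^sup>2))) (at t))"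
    using r rd \<theta> r_smooth unfolding \<omega>_def by blast
  then show ?thesis by blast
qed

lemma has_L2_derivative_combination:
  assumes "(X has_real_derivative X') (at t within S)" "(Y has_real_derivative Y') (at t within S)"
    and "a \<in> L2_functions M" "e \<in> L2_functions M" "t \<in> S"
  shows "has_L2_derivative M (\<lambda>s x. X s * a x + Y s * e x) (\<lambda>x. X' * a x + Y' * e x) t S"
  by (rule has_L2_derivative_add[OF has_L2_derivative_scale[OF assms(1)] _ _
        has_L2_derivative_scale[OF assms(2)] _ _ assms(5)]) (use assms in auto)

context geodesic_setting
begin

text \<open>In the plane spanned by \<open>a\<close> and an orthogonal vector \<open>e\<close> of the same length, the geodesic is
  \<open>(r / r0) (cos \<theta> a + sin \<theta> e)\<close>. The degenerate case of a radial geodesic, with \<open>e = 0\<close>, is included: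
  then \<open>j = 0\<close> and the angle stays zero.\<close>

lemma planar_geodesic:
  assumes a: "a \<in> T" and e: "e \<in> T" and r0: "0 < r0"
    and aa: "ip a a = r0\<^sup>2" and ae: "ip a e = 0" and ee: "ip e e = r0\<^sup>2 \<or> j = 0"
    and smooth: "C_infty r UNIV" "C_infty \<theta> UNIV" and \<theta>0: "\<theta> t0 = 0"
    and r: "\<And>t. 0 < r t" and rd: "\<And>t. (r has_real_derivative r' t) (at t)"
    and zd: "\<And>t. ((\<lambda>t. sqrt (g (r t)) * r' t) has_real_derivative radial_force (j\<^sup>2) (r t)) (at t)"
    and \<theta>d: "\<And>t. (\<theta> has_real_derivative j / ((r t)\<^sup>2 * C1 ((r t)\<^sup>2))) (at t)"
    and X_def: "X = (\<lambda>t. r t / r0 * cos (\<theta> t))" and Y_def: "Y = (\<lambda>t. r t / r0 * sin (\<theta> t))"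
  shows "C_infty X UNIV" "C_infty Y UNIV"
    "deriv X t = (r' t * cos (\<theta> t) - r t * (j / ((r t)\<^sup>2 * C1 ((r t)\<^sup>2))) * sin (\<theta> t)) / r0"
    "deriv Y t = (r' t * sin (\<theta> t) + r t * (j / ((r t)\<^sup>2 * C1 ((r t)\<^sup>2))) * cos (\<theta> t)) / r0"
    "motion UNIV (\<lambda>t x. X t * a x + Y t * e x) (\<lambda>t x. deriv X t * a x + deriv Y t * e x)
      (\<lambda>t x. deriv (deriv X) t * a x + deriv (deriv Y) t * e x)"
proof -
  have L2: "a \<in> L2" "e \<in> L2" using a e T_L2 by auto
  define \<omega> where "\<omega> = (\<lambda>t. j / ((r t)\<^sup>2 * C1 ((r t)\<^sup>2)))"
  have C1r: "0 < C1 ((r t)\<^sup>2)" for t using r[of t] by (intro C1_pos) simp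
  have j: "j = (r t)\<^sup>2 * C1 ((r t)\<^sup>2) * \<omega> t" for t
    using r[of t] C1r[of t] by (simp add: \<omega>_def)
  have \<theta>d': "(\<theta> has_real_derivative \<omega> t) (at t)" for t using \<theta>d by (simp add: \<omega>_def)
  define X' where "X' = (\<lambda>t. (r' t * cos (\<theta> t) - r t * \<omega> t * sin (\<theta> t)) / r0)"
  define Y' where "Y' = (\<lambda>t. (r' t * sin (\<theta> t) + r t * \<omega> t * cos (\<theta> t)) / r0)"
  have trig: "((\<lambda>t. cos (\<theta> t)) has_real_derivative - sin (\<theta> t) * \<omega> t) (at t)"
    "((\<lambda>t. sin (\<theta> t)) has_real_derivative cos (\<theta> t) * \<omega> t) (at t)" for t
    using DERIV_chain2[where f = cos and g = \<theta>, OF DERIV_cos \<theta>d']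
      DERIV_chain2[where f = sin and g = \<theta>, OF DERIV_sin \<theta>d'] by simp_all
  have Xd: "(X has_real_derivative X' t) (at t)" and Yd: "(Y has_real_derivative Y' t) (at t)" for t
    using DERIV_mult[OF DERIV_cdivide[OF rd, of r0] trig(1)[of t]]
      DERIV_mult[OF DERIV_cdivide[OF rd, of r0] trig(2)[of t]] r0
    by (simp_all add: X_def Y_def X'_def Y'_def field_simps)
  then have dX: "deriv X = X'" and dY: "deriv Y = Y'" by (auto simp: fun_eq_iff intro: DERIV_imp_deriv)
  have smooth_trig: "C_infty (\<lambda>t. cos (\<theta> t)) UNIV" "C_infty (\<lambda>t. sin (\<theta> t)) UNIV"
    by (rule C_infty_compose[OF C_infty_cos_sin(1) smooth(2)] C_infty_compose[OF C_infty_cos_sin(2) smooth(2)]; simp)+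
  have r_smooth: "C_infty (\<lambda>t. r t / r0) UNIV"
    using C_infty_mult[OF open_UNIV smooth(1) C_infty_const[of "1 / r0"]] by simp
  show XS: "C_infty X UNIV" and YS: "C_infty Y UNIV"
    unfolding X_def Y_def by (intro C_infty_mult r_smooth smooth_trig open_UNIV)+
  show "deriv X t = (r' t * cos (\<theta> t) - r t * (j / ((r t)\<^sup>2 * C1 ((r t)\<^sup>2))) * sin (\<theta> t)) / r0"
    "deriv Y t = (r' t * sin (\<theta> t) + r t * (j / ((r t)\<^sup>2 * C1 ((r t)\<^sup>2))) * cos (\<theta> t)) / r0"
    by (simp_all add: dX dY X'_def Y'_def \<omega>_def)
  have ee': "Y t * ip e e = Y t * r0\<^sup>2" "Y' t * ip e e = Y' t * r0\<^sup>2" for t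
  proof -
    have "Y t = 0 \<and> Y' t = 0" if "j = 0"
    proof -
      have \<omega>0: "\<omega> t = 0" for t using that by (simp add: \<omega>_def)
      then have "(\<theta> has_real_derivative 0) (at t)" for t using \<theta>d'[of t] by simp
      then have "\<theta> t = \<theta> t0" using DERIV_isconst_all by blast
      then show ?thesis using \<theta>0 \<omega>0 by (simp add: Y_def Y'_def)
    qed
    then show "Y t * ip e e = Y t * r0\<^sup>2" "Y' t * ip e e = Y' t * r0\<^sup>2" using ee by auto
  qed
  define c where "c = (\<lambda>t x. X t * a x + Y t * e x)"
  define v where "v = (\<lambda>t x. X' t * a x + Y' t * e x)"
  have T: "c t \<in> T" "v t \<in> T" for t unfolding c_def v_def by (rule T_lincomb[OF a e])+
  then have cL2: "c t \<in> L2" "v t \<in> L2" for t using T_L2 by auto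
  have scaled: "X t * r0 = r t * cos (\<theta> t)" "Y t * r0 = r t * sin (\<theta> t)"
    "X' t * r0 = r' t * cos (\<theta> t) - r t * \<omega> t * sin (\<theta> t)"
    "Y' t * r0 = r' t * sin (\<theta> t) + r t * \<omega> t * cos (\<theta> t)" for t
    using r0 by (simp_all add: X_def Y_def X'_def Y'_def)
  have sc: "(sin (\<theta> t))\<^sup>2 + (cos (\<theta> t))\<^sup>2 = 1" for t by simp
  have products: "ip (c t) (c t) = (r t)\<^sup>2" "ip (c t) (v t) = r t * r' t"
    "ip (v t) (v t) = (r' t)\<^sup>2 + (r t)\<^sup>2 * (\<omega> t)\<^sup>2" for t
  proof -
    have "ip (c t) (c t) = X t * X t * r0\<^sup>2 + Y t * (Y t * ip e e)"
      using L2 aa ae by (simp add: c_def L2_inner_commute[of M e a] algebra_simps)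
    also have "\<dots> = ((X t * r0)\<^sup>2 + (Y t * r0)\<^sup>2)"
      unfolding ee' by (simp add: power2_eq_square algebra_simps)
    also have "\<dots> = (r t)\<^sup>2 * ((sin (\<theta> t))\<^sup>2 + (cos (\<theta> t))\<^sup>2)"
      unfolding scaled by algebra
    finally show "ip (c t) (c t) = (r t)\<^sup>2" unfolding sc by simp
    have "ip (c t) (v t) = X t * X' t * r0\<^sup>2 + Y t * (Y' t * ip e e)"
      using L2 aa ae by (simp add: c_def v_def L2_inner_commute[of M e a] algebra_simps)
    also have "\<dots> = (X t * r0) * (X' t * r0) + (Y t * r0) * (Y' t * r0)"
      unfolding ee' by (simp add: power2_eq_square algebra_simps)
    also have "\<dots> = r t * r' t * ((sin (\<theta> t))\<^sup>2 + (cos (\<theta> t))\<^sup>2)"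
      unfolding scaled by algebra
    finally show "ip (c t) (v t) = r t * r' t" unfolding sc by simp
    have "ip (v t) (v t) = X' t * X' t * r0\<^sup>2 + Y' t * (Y' t * ip e e)"
      using L2 aa ae by (simp add: v_def L2_inner_commute[of M e a] algebra_simps)
    also have "\<dots> = (X' t * r0)\<^sup>2 + (Y' t * r0)\<^sup>2"
      unfolding ee' by (simp add: power2_eq_square algebra_simps)
    also have "\<dots> = ((r' t)\<^sup>2 + (r t)\<^sup>2 * (\<omega> t)\<^sup>2) * ((sin (\<theta> t))\<^sup>2 + (cos (\<theta> t))\<^sup>2)"
      unfolding scaled by algebra
    finally show "ip (v t) (v t) = (r' t)\<^sup>2 + (r t)\<^sup>2 * (\<omega> t)\<^sup>2" unfolding sc by simp
  qed
  define S where "S = (\<lambda>t. sqrt (g (r t)))"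
  have S: "0 < S t" "S t * S t = 4 * (C1 ((r t)\<^sup>2) + C2 ((r t)\<^sup>2) * (r t)\<^sup>2)" for t
    using g_pos[OF r[of t]] by (simp_all add: S_def g2_def)
  have geodesic: "geodesic_equation_at G T c v t" for t
    unfolding geodesic_equation_at_def
  proof
    fix k assume k: "k \<in> T"
    then have kL2: "k \<in> L2" using T_L2 by blast
    define \<alpha> \<beta> where "\<alpha> = ip a k" and "\<beta> = ip e k"
    have ck: "ip (c t) k = X t * \<alpha> + Y t * \<beta>" and vk: "ip (v t) k = X' t * \<alpha> + Y' t * \<beta>" for t
      using L2 kL2 by (simp_all add: c_def v_def \<alpha>_def \<beta>_def)
    define MX where "MX = (\<lambda>t. (S t * (sqrt (g (r t)) * r' t) * cos (\<theta> t) - 4 * j / r t * sin (\<theta> t)) / r0)"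
    define MY where "MY = (\<lambda>t. (S t * (sqrt (g (r t)) * r' t) * sin (\<theta> t) + 4 * j / r t * cos (\<theta> t)) / r0)"
    have "G (c t) (v t) k = MX t * \<alpha> + MY t * \<beta>" for t
    proof -
      have jr: "4 * j / r t = 4 * C1 ((r t)\<^sup>2) * (r t * \<omega> t)"
        using r[of t] by (subst j[of t]) (simp add: field_simps power2_eq_square)
      have SS: "S t * (sqrt (g (r t)) * r' t) = 4 * (C1 ((r t)\<^sup>2) + C2 ((r t)\<^sup>2) * (r t)\<^sup>2) * r' t"
        using S(2)[of t] by (simp add: S_def mult.assoc[symmetric])
      have M: "MX t = 4 * C1 ((r t)\<^sup>2) * X' t + 4 * C2 ((r t)\<^sup>2) * (r t * r' t) * X t"
        "MY t = 4 * C1 ((r t)\<^sup>2) * Y' t + 4 * C2 ((r t)\<^sup>2) * (r t * r' t) * Y t"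
        unfolding MX_def MY_def SS jr X'_def Y'_def X_def Y_def using r0
        by (simp_all add: field_simps power2_eq_square)
      have "G (c t) (v t) k = 4 * C1 ((r t)\<^sup>2) * (X' t * \<alpha> + Y' t * \<beta>)
          + 4 * C2 ((r t)\<^sup>2) * (r t * r' t) * (X t * \<alpha> + Y t * \<beta>)"
        unfolding metric_G_def L2_norm_power2 products ck vk ..
      then show ?thesis unfolding M by (simp add: algebra_simps)
    qed
    then have Geq: "(\<lambda>s. G (c s) (v s) k) = (\<lambda>s. MX s * \<alpha> + MY s * \<beta>)" by (simp add: fun_eq_iff)
    define g' where "g' = 4 * (2 * r t * C1' ((r t)\<^sup>2) + 2 * r t ^ 3 * C2' ((r t)\<^sup>2) + 2 * r t * C2 ((r t)\<^sup>2))"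
    have "((\<lambda>s. g (r s)) has_real_derivative g' * r' t) (at t)"
      using DERIV_chain2[where f = g and g = r, OF g_deriv[OF r] rd] by (simp add: g'_def)
    from DERIV_chain2[where f = sqrt and g = "\<lambda>s. g (r s)", OF DERIV_real_sqrt[OF g_pos[OF r]] this]
    have Sd: "(S has_real_derivative g' * r' t / (2 * S t)) (at t)"
      by (simp add: S_def field_simps)
    define P where "P = g' * r' t / (2 * S t) * (S t * r' t) + S t * radial_force (j\<^sup>2) (r t)"
    define R where "R = P - 4 * j / r t * \<omega> t"
    define A where "A = - (S t * (S t * r' t)) * \<omega> t + 4 * j / (r t * r t) * r' t"
    have jd: "((\<lambda>s. 4 * j / r s) has_real_derivative - (4 * j / (r t * r t) * r' t)) (at t)"
      using r[of t] by (auto intro!: derivative_eq_intros rd simp: field_simps)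
    have Szd: "((\<lambda>s. S s * (sqrt (g (r s)) * r' s)) has_real_derivative P) (at t)"
      using DERIV_mult[OF Sd zd[of t]] by (simp add: P_def S_def mult.commute)
    have "(MX has_real_derivative (R * cos (\<theta> t) + A * sin (\<theta> t)) / r0) (at t)"
    proof -
      have "(MX has_real_derivative ((P * cos (\<theta> t) + (- sin (\<theta> t) * \<omega> t) * (S t * (sqrt (g (r t)) * r' t)))
          - (- (4 * j / (r t * r t) * r' t) * sin (\<theta> t) + (cos (\<theta> t) * \<omega> t) * (4 * j / r t))) / r0) (at t)"
        unfolding MX_def by (intro DERIV_cdivide DERIV_diff DERIV_mult Szd jd trig)
      also have "((P * cos (\<theta> t) + (- sin (\<theta> t) * \<omega> t) * (S t * (sqrt (g (r t)) * r' t)))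
          - (- (4 * j / (r t * r t) * r' t) * sin (\<theta> t) + (cos (\<theta> t) * \<omega> t) * (4 * j / r t)))
          = R * cos (\<theta> t) + A * sin (\<theta> t)"
        by (simp add: R_def A_def S_def algebra_simps)
      finally show ?thesis .
    qed
    moreover have "(MY has_real_derivative (R * sin (\<theta> t) - A * cos (\<theta> t)) / r0) (at t)"
    proof -
      have "(MY has_real_derivative ((P * sin (\<theta> t) + (cos (\<theta> t) * \<omega> t) * (S t * (sqrt (g (r t)) * r' t)))
          + (- (4 * j / (r t * r t) * r' t) * cos (\<theta> t) + (- sin (\<theta> t) * \<omega> t) * (4 * j / r t))) / r0) (at t)"
        unfolding MY_def by (intro DERIV_cdivide DERIV_add DERIV_mult Szd jd trig)
      also have "((P * sin (\<theta> t) + (cos (\<theta> t) * \<omega> t) * (S t * (sqrt (g (r t)) * r' t)))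
          + (- (4 * j / (r t * r t) * r' t) * cos (\<theta> t) + (- sin (\<theta> t) * \<omega> t) * (4 * j / r t)))
          = R * sin (\<theta> t) - A * cos (\<theta> t)"
        by (simp add: R_def A_def S_def algebra_simps)
      finally show ?thesis .
    qed
    ultimately have Gd: "((\<lambda>s. G (c s) (v s) k) has_real_derivative
        (R * cos (\<theta> t) + A * sin (\<theta> t)) / r0 * \<alpha> + (R * sin (\<theta> t) - A * cos (\<theta> t)) / r0 * \<beta>) (at t)"
      unfolding Geq by (intro DERIV_add DERIV_cmult_right)
    have A_eq: "A = - 4 * C2 ((r t)\<^sup>2) * (r t)\<^sup>2 * r' t * \<omega> t"
    proof -
      have "4 * j / (r t * r t) = 4 * C1 ((r t)\<^sup>2) * \<omega> t"
        using r[of t] by (subst j[of t]) (simp add: field_simps power2_eq_square)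
      then have "A = - (S t * S t) * r' t * \<omega> t + 4 * C1 ((r t)\<^sup>2) * \<omega> t * r' t"
        by (simp add: A_def algebra_simps)
      then show ?thesis unfolding S(2) by (simp add: algebra_simps)
    qed
    have R_eq: "R = 4 * r t * (C1' ((r t)\<^sup>2) * ((r' t)\<^sup>2 + (r t)\<^sup>2 * (\<omega> t)\<^sup>2)
        + C2' ((r t)\<^sup>2) * (r t * r' t)\<^sup>2 + C2 ((r t)\<^sup>2) * (r' t)\<^sup>2)"
    proof -
      have "S t * radial_force (j\<^sup>2) (r t)
          = 4 * j\<^sup>2 * (C1 ((r t)\<^sup>2) + (r t)\<^sup>2 * C1' ((r t)\<^sup>2)) / ((C1 ((r t)\<^sup>2))\<^sup>2 * r t ^ 3)"
      proof -
        have "radial_force (j\<^sup>2) (r t)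
            = 4 * j\<^sup>2 * (C1 ((r t)\<^sup>2) + (r t)\<^sup>2 * C1' ((r t)\<^sup>2)) / ((C1 ((r t)\<^sup>2))\<^sup>2 * r t ^ 3) / S t"
          by (simp add: radial_force_def S_def)
        then show ?thesis using S(1)[of t] by simp
      qed
      also have "\<dots> = 4 * r t * (\<omega> t)\<^sup>2 * (C1 ((r t)\<^sup>2) + (r t)\<^sup>2 * C1' ((r t)\<^sup>2))"
        using r[of t] C1r[of t] by (subst j[of t]) (simp add: field_simps eval_nat_numeral)
      finally have 1: "S t * radial_force (j\<^sup>2) (r t)
          = 4 * r t * (\<omega> t)\<^sup>2 * (C1 ((r t)\<^sup>2) + (r t)\<^sup>2 * C1' ((r t)\<^sup>2))" .
      have 2: "4 * j / r t * \<omega> t = 4 * r t * C1 ((r t)\<^sup>2) * (\<omega> t)\<^sup>2"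
        using r[of t] by (subst j[of t]) (simp add: field_simps power2_eq_square)
      have 3: "g' * r' t / (2 * S t) * (S t * r' t) = g' * (r' t)\<^sup>2 / 2"
        using S(1)[of t] by (simp add: field_simps power2_eq_square)
      show ?thesis
        unfolding R_def P_def 1 2 3 unfolding g'_def by (simp add: algebra_simps eval_nat_numeral)
    qed
    define Q where "Q = 8 * (C1' ((r t)\<^sup>2) * ip (c t) k * ((r' t)\<^sup>2 + (r t)\<^sup>2 * (\<omega> t)\<^sup>2)
      + C2' ((r t)\<^sup>2) * ip (c t) k * (r t * r' t)\<^sup>2 + C2 ((r t)\<^sup>2) * (r t * r' t) * ip (v t) k)"
    have "((\<lambda>\<epsilon>. G (\<lambda>x. c t x + \<epsilon> * k x) (v t) (v t)) has_real_derivative Q) (at 0)"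
      using metric_position_derivative[OF cL2(1)[of t] _ cL2(2)[of t] kL2] r[of t]
      unfolding products by (simp add: Q_def)
    moreover have Q2: "(R * cos (\<theta> t) + A * sin (\<theta> t)) / r0 * \<alpha> + (R * sin (\<theta> t) - A * cos (\<theta> t)) / r0 * \<beta> = Q / 2"
      unfolding Q_def ck vk X_def Y_def X'_def Y'_def A_eq R_eq using r0
      by (simp add: field_simps) (simp add: power2_eq_square algebra_simps)
    ultimately show "\<exists>q. ((\<lambda>\<epsilon>. G (\<lambda>x. c t x + \<epsilon> * k x) (v t) (v t)) has_real_derivative q) (at 0) \<and>
        ((\<lambda>s. G (c s) (v s) k) has_real_derivative (q / 2)) (at t)"
      using Gd[unfolded Q2] by blast
  qed
  have X'd: "(X' has_real_derivative deriv X' t) (at t)" "(Y' has_real_derivative deriv Y' t) (at t)" for t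
    using C_infty_deriv(1)[OF C_infty_deriv(2)[OF XS open_UNIV] open_UNIV, of t]
      C_infty_deriv(1)[OF C_infty_deriv(2)[OF YS open_UNIV] open_UNIV, of t] by (simp_all add: dX dY)
  have "motion UNIV c v (\<lambda>t x. deriv X' t * a x + deriv Y' t * e x)"
    unfolding motion_def
  proof (intro conjI ballI)
    fix t
    show "c t \<in> T" "v t \<in> T" by (rule T)+
    show "(\<lambda>x. deriv X' t * a x + deriv Y' t * e x) \<in> L2" using L2 by simp
    show "0 < nrm (c t)" using products(1)[of t] r[of t] by (simp add: L2_norm_def)
    show "has_L2_derivative M c (v t) t UNIV" "has_L2_derivative M v (\<lambda>x. deriv X' t * a x + deriv Y' t * e x) t UNIV"
      unfolding c_def v_def by (intro has_L2_derivative_combination Xd Yd X'd L2 UNIV_I)+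
    show "geodesic_equation_at G T c v t" by (rule geodesic)
  qed auto
  then show "motion UNIV (\<lambda>t x. X t * a x + Y t * e x) (\<lambda>t x. deriv X t * a x + deriv Y t * e x)
      (\<lambda>t x. deriv (deriv X) t * a x + deriv (deriv Y) t * e x)"
    by (simp add: c_def v_def dX dY)
qed

text \<open>The vector \<open>e\<close> is the component of the velocity orthogonal to the position, rescaled to the length
  of the position.\<close>

lemma motion_exists:
  assumes a: "a \<in> T" and b: "b \<in> T" and anz: "0 < nrm a"
  shows "\<exists>X Y. \<exists>e\<in>T. C_infty X UNIV \<and> C_infty Y UNIV \<and>
    motion UNIV (\<lambda>t x. X t * a x + Y t * e x) (\<lambda>t x. deriv X t * a x + deriv Y t * e x)
      (\<lambda>t x. deriv (deriv X) t * a x + deriv (deriv Y) t * e x) \<and>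
    (\<forall>x. X t0 * a x + Y t0 * e x = a x) \<and> (AE x in M. deriv X t0 * a x + deriv Y t0 * e x = b x)"
proof -
  have L2: "a \<in> L2" "b \<in> L2" using a b T_L2 by auto
  define r0 where "r0 = nrm a"
  have r0: "0 < r0" "ip a a = r0\<^sup>2" using anz by (simp_all add: r0_def)
  define p where "p = ip a b / r0\<^sup>2"
  define n where "n = (\<lambda>x. 1 * b x + - p * a x)"
  have n: "n \<in> T" unfolding n_def by (rule T_lincomb[OF b a])
  then have nL2: "n \<in> L2" using T_L2 by blast
  have an: "ip a n = 0"
    using L2 r0 by (simp add: n_def p_def L2_cmult[of _ _ "- p", simplified])
  \<comment> \<open>if \<open>nrm n = 0\<close>, the quotient is \<open>0\<close> and so is \<open>e\<close>; the geodesic is radial\<close>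
  define e where "e = (\<lambda>x. r0 / nrm n * n x + 0 * a x)"
  have e: "e \<in> T" unfolding e_def by (rule T_lincomb[OF n a])
  define j where "j = C1 (r0\<^sup>2) * r0 * nrm n"
  have C1r0: "0 < C1 (r0\<^sup>2)" using r0(1) by (intro C1_pos) simp
  have ae: "ip a e = 0" using an by (simp add: e_def)
  have ee: "ip e e = r0\<^sup>2 \<or> j = 0"
  proof (cases "nrm n = 0")
    case False
    have "ip e e = (r0 / nrm n)\<^sup>2 * (nrm n)\<^sup>2"
      unfolding L2_norm_power2 by (simp add: e_def power2_eq_square)
    then show ?thesis using False by (simp add: power_divide del: L2_norm_power2)
  qed (simp add: j_def)
  obtain r r' \<theta> where sol: "C_infty r UNIV" "C_infty \<theta> UNIV" "\<theta> t0 = 0" "\<And>t. 0 < r t"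
      "\<And>t. (r has_real_derivative r' t) (at t)"
      "\<And>t. ((\<lambda>t. sqrt (g (r t)) * r' t) has_real_derivative radial_force (j\<^sup>2) (r t)) (at t)"
      "\<And>t. (\<theta> has_real_derivative j / ((r t)\<^sup>2 * C1 ((r t)\<^sup>2))) (at t)"
    and init: "r t0 = r0" "r' t0 = p * r0"
    using polar_solution[OF r0(1), of t0 "p * r0" j] by blast
  define X where "X = (\<lambda>t. r t / r0 * cos (\<theta> t))"
  define Y where "Y = (\<lambda>t. r t / r0 * sin (\<theta> t))"
  note P = planar_geodesic[OF a e r0 ae ee sol X_def Y_def]
  have "X t0 = 1" "Y t0 = 0" using init(1) sol(3) r0(1) by (simp_all add: X_def Y_def)
  moreover have "AE x in M. deriv X t0 * a x + deriv Y t0 * e x = b x"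
  proof -
    have "deriv X t0 = p" using P(3)[of t0] init sol(3) r0(1) by simp
    moreover have "deriv Y t0 = nrm n / r0"
      using P(4)[of t0] init sol(3) r0(1) C1r0 by (simp add: j_def power2_eq_square)
    moreover have "AE x in M. nrm n / r0 * e x = n x"
    proof (cases "nrm n = 0")
      case True
      then have "AE x in M. n x = 0" using L2_norm_eq_0_iff[OF nL2] by blast
      then show ?thesis using True by auto
    next
      case False
      then show ?thesis using r0(1) by (simp add: e_def)
    qed
    ultimately show ?thesis by (auto simp: n_def elim!: eventually_mono)
  qed
  ultimately have "C_infty X UNIV \<and> C_infty Y UNIV \<and>
    motion UNIV (\<lambda>t x. X t * a x + Y t * e x) (\<lambda>t x. deriv X t * a x + deriv Y t * e x)
      (\<lambda>t x. deriv (deriv X) t * a x + deriv (deriv Y) t * e x) \<and>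
    (\<forall>x. X t0 * a x + Y t0 * e x = a x) \<and> (AE x in M. deriv X t0 * a x + deriv Y t0 * e x = b x)"
    using P(1,2,5) by simp
  then show ?thesis using e by blast
qed

lemma motion_subset:
  assumes "motion I c v u" "J \<subseteq> I" "open J" "is_interval J"
  shows "motion J c v u"
  using assms unfolding motion_def has_L2_derivative_def
  by (meson subsetD tendsto_within_subset)

text \<open>The global geodesic with the initial data at \<open>t0\<close> extends the given one by uniqueness. The
  explicit form keeps track of its regularity in time and space.\<close>

theorem motion_extends:
  assumes m: "motion I c v u" and t0: "t0 \<in> I"
  shows "\<exists>X Y. \<exists>a\<in>T. \<exists>e\<in>T. C_infty X UNIV \<and> C_infty Y UNIV \<and>
    motion UNIV (\<lambda>t x. X t * a x + Y t * e x) (\<lambda>t x. deriv X t * a x + deriv Y t * e x)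
      (\<lambda>t x. deriv (deriv X) t * a x + deriv (deriv Y) t * e x) \<and>
    (\<forall>t\<in>I. AE x in M. X t * a x + Y t * e x = c t x)"
proof -
  note D = motionD[OF m t0]
  obtain X Y e where e: "e \<in> T" and XY: "C_infty X UNIV" "C_infty Y UNIV"
    and g: "motion UNIV (\<lambda>t x. X t * c t0 x + Y t * e x) (\<lambda>t x. deriv X t * c t0 x + deriv Y t * e x)
      (\<lambda>t x. deriv (deriv X) t * c t0 x + deriv (deriv Y) t * e x)"
    and init: "\<And>x. X t0 * c t0 x + Y t0 * e x = c t0 x"
      "AE x in M. deriv X t0 * c t0 x + deriv Y t0 * e x = v t0 x"
    using motion_exists[OF D(3,4,8), of t0] by blast
  have "AE x in M. X t * c t0 x + Y t * e x = c t x" if "t \<in> I" for t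
    by (rule motion_unique[OF motion_subset[OF g subset_UNIV D(1,2)] m t0 that]) (use init in auto)
  then show ?thesis using D(3) e XY g by blast
qed

end

context L2_radial
begin

lemma combination_higher_derivatives:
  assumes "C_infty X UNIV" "C_infty Y UNIV" "a \<in> L2" "e \<in> L2"
  shows "has_L2_derivative M (\<lambda>t x. (deriv ^^ n) X t * a x + (deriv ^^ n) Y t * e x)
    (\<lambda>x. (deriv ^^ Suc n) X t * a x + (deriv ^^ Suc n) Y t * e x) t UNIV"
proof -
  have "C_infty ((deriv ^^ n) X) UNIV" "C_infty ((deriv ^^ n) Y) UNIV"
    using assms(1,2) by (induction n) (auto intro: C_infty_deriv(2))
  from C_infty_deriv(1)[OF this(1) open_UNIV UNIV_I] C_infty_deriv(1)[OF this(2) open_UNIV UNIV_I]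
  show ?thesis using assms(3,4) by (intro has_L2_derivative_combination) simp_all
qed

theorem L2_geodesics_extend: "L2_geodesically_complete M G"
  unfolding L2_geodesically_complete_def
proof (intro allI impI)
  fix I c assume asm: "open I \<and> is_interval I \<and> I \<noteq> {} \<and> L2_geodesic M G I c"
  interpret geodesic_setting M C1 C2 L2 by standard auto
  obtain D where D: "D 0 = c" "\<And>n t. t \<in> I \<Longrightarrow> D n t \<in> L2"
    "\<And>n t. t \<in> I \<Longrightarrow> has_L2_derivative M (D n) (D (Suc n) t) t I"
    "\<And>t. t \<in> I \<Longrightarrow> geodesic_equation_at G L2 c (D 1) t"
    using asm unfolding L2_geodesic_def by blast
  have nz: "c t \<in> L2nz" if "t \<in> I" for t using asm that by (simp add: L2_geodesic_def)
  have "motion I c (D 1) (D 2)"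
    unfolding motion_def
  proof (intro conjI ballI)
    fix t assume t: "t \<in> I"
    show "has_L2_derivative M c (D 1 t) t I" "has_L2_derivative M (D 1) (D 2 t) t I"
      using D(3)[OF t, of 0] D(3)[OF t, of 1] D(1) by (simp_all add: numeral_2_eq_2)
  qed (use asm D(2,4) nz L2nz_iff in auto)
  then obtain X Y a e where ae: "a \<in> L2" "e \<in> L2" and XY: "C_infty X UNIV" "C_infty Y UNIV"
    and mot: "motion UNIV (\<lambda>t x. X t * a x + Y t * e x) (\<lambda>t x. deriv X t * a x + deriv Y t * e x)
      (\<lambda>t x. deriv (deriv X) t * a x + deriv (deriv Y) t * e x)"
    and ext: "\<forall>t\<in>I. AE x in M. X t * a x + Y t * e x = c t x"
    using motion_extends asm by blast
  define E where "E = (\<lambda>n t x. (deriv ^^ n) X t * a x + (deriv ^^ n) Y t * e x)"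
  have "L2_geodesic M G UNIV (E 0)"
    unfolding L2_geodesic_def
  proof (intro conjI ballI exI[of _ E] allI refl)
    show "E 0 t \<in> L2nz" for t
      using motionD(5,8)[OF mot UNIV_I, of t] by (simp add: E_def L2nz_iff)
    show "E n t \<in> L2" for n t using ae by (simp add: E_def)
    show "has_L2_derivative M (E n) (E (Suc n) t) t UNIV" for n t
      unfolding E_def by (rule combination_higher_derivatives[OF XY ae])
    show "geodesic_equation_at G L2 (E 0) (E 1) t" for t
      using motionD(11)[OF mot UNIV_I, of t] by (simp add: E_def)
  qed
  moreover have "\<forall>t\<in>I. AE x in M. E 0 t x = c t x" using ext by (simp add: E_def)
  ultimately show "\<exists>c'. L2_geodesic M G UNIV c' \<and> (\<forall>t\<in>I. AE x in M. c' t x = c t x)" by blast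
qed

end

section \<open>Compact manifolds with corners\<close>

text \<open>A local smooth extension of \<open>f\<close> agrees with \<open>f\<close> along the whole time direction because \<open>I\<close> is
  open, so its time derivative is a local smooth extension of the time derivative of \<open>f\<close>, even at
  boundary points of \<open>S\<close>.\<close>

lemma smooth_on_time_derivative:
  fixes f :: "real \<times> 'e::euclidean_space \<Rightarrow> real"
  assumes f: "smooth_on f (I \<times> S)" and I: "open I"
  shows "\<And>t y. t \<in> I \<Longrightarrow> y \<in> S \<Longrightarrow>
      ((\<lambda>\<tau>. f (\<tau>, y)) has_real_derivative deriv (\<lambda>\<tau>. f (\<tau>, y)) t) (at t)"
    and "smooth_on (\<lambda>p. deriv (\<lambda>\<tau>. f (\<tau>, snd p)) (fst p)) (I \<times> S)"
proof -
  have key: "((\<lambda>\<tau>. f (\<tau>, y)) has_real_derivative frechet_derivative F (at (t, y)) (1, 0)) (at t)"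
    if V: "open V" "\<And>k. Ck_on k F V" "\<And>p. p \<in> (I \<times> S) \<inter> V \<Longrightarrow> F p = f p"
      and p: "t \<in> I" "y \<in> S" "(t, y) \<in> V" for V F t y
  proof -
    have "F differentiable (at (t, y))" using V(2)[of 1] p(3) by simp
    then have F: "(F has_derivative frechet_derivative F (at (t, y))) (at (t, y))"
      by (simp add: frechet_derivative_works)
    have "((\<lambda>\<tau>. (\<tau>, y)) has_derivative (\<lambda>h. (h, 0))) (at t)"
      by (auto intro!: derivative_eq_intros)
    from has_derivative_compose[OF this F]
    have "((\<lambda>\<tau>. F (\<tau>, y)) has_derivative (\<lambda>h. frechet_derivative F (at (t, y)) (h, 0))) (at t)" .
    moreover have "(\<lambda>h. frechet_derivative F (at (t, y)) (h, 0))
        = (\<lambda>h. frechet_derivative F (at (t, y)) (1, 0) * h)"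
    proof
      fix h :: real
      have "frechet_derivative F (at (t, y)) (h *\<^sub>R (1, 0)) = h *\<^sub>R frechet_derivative F (at (t, y)) (1, 0)"
        by (rule linear_cmul[OF has_derivative_linear[OF F]])
      then show "frechet_derivative F (at (t, y)) (h, 0) = frechet_derivative F (at (t, y)) (1, 0) * h"
        by (simp add: mult.commute)
    qed
    ultimately have "((\<lambda>\<tau>. F (\<tau>, y)) has_real_derivative frechet_derivative F (at (t, y)) (1, 0)) (at t)"
      by (simp only: has_field_derivative_def)
    moreover have "open (I \<inter> (\<lambda>\<tau>. (\<tau>, y)) -` V)"
      using I V(1) by (intro open_Int open_vimage continuous_intros)
    ultimately show ?thesis
      by (rule has_field_derivative_transform_within_open) (use V(3) p in auto)
  qed
  have local: "\<exists>V F. open V \<and> p \<in> V \<and> (\<forall>k. Ck_on k F V) \<and> (\<forall>q\<in>(I \<times> S) \<inter> V. F q = f q)" if "p \<in> I \<times> S" for p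
    using f that unfolding smooth_on_def by blast
  show "((\<lambda>\<tau>. f (\<tau>, y)) has_real_derivative deriv (\<lambda>\<tau>. f (\<tau>, y)) t) (at t)" if "t \<in> I" "y \<in> S" for t y
  proof -
    have "(t, y) \<in> I \<times> S" using that by simp
    then obtain V F where V: "open V" "(t, y) \<in> V" "\<And>k. Ck_on k F V"
      "\<And>q. q \<in> (I \<times> S) \<inter> V \<Longrightarrow> F q = f q"
      using local by metis
    from key[OF V(1,3,4) that V(2)] show ?thesis by (simp add: DERIV_imp_deriv)
  qed
  show "smooth_on (\<lambda>p. deriv (\<lambda>\<tau>. f (\<tau>, snd p)) (fst p)) (I \<times> S)"
    unfolding smooth_on_def
  proof
    fix p assume "p \<in> I \<times> S"
    then obtain V F where V: "open V" "p \<in> V" "\<And>k. Ck_on k F V" "\<And>q. q \<in> (I \<times> S) \<inter> V \<Longrightarrow> F q = f q"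
      using local by metis
    have "\<forall>k. Ck_on k (\<lambda>q. frechet_derivative F (at q) (1, 0)) V"
      using V(3) by (metis Ck_on.simps(2))
    moreover have "frechet_derivative F (at q) (1, 0) = deriv (\<lambda>\<tau>. f (\<tau>, snd q)) (fst q)"
      if "q \<in> (I \<times> S) \<inter> V" for q
      using key[OF V(1,3,4), of "fst q" "snd q"] that DERIV_imp_deriv by fastforce
    ultimately show "\<exists>V F. open V \<and> p \<in> V \<and> (\<forall>k. Ck_on k F V) \<and>
        (\<forall>q\<in>(I \<times> S) \<inter> V. F q = deriv (\<lambda>\<tau>. f (\<tau>, snd q)) (fst q))"
      using V(1,2) by blast
  qed
qed

locale compact_corner_manifold =
  fixes \<A> :: "('m::{t2_space,second_countable_topology}, 'e::euclidean_space) chart set"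
    and M :: "'m measure"
  assumes compact: "compact (UNIV :: 'm set)"
    and atlas: "smooth_corner_atlas \<A>"
    and density: "smooth_positive_density \<A> M"
    and total: "emeasure M (space M) = 1"
begin

lemma sets_M [measurable_cong, simp]: "sets M = sets borel"
  using density by (simp add: smooth_positive_density_def)

lemma space_M [simp]: "space M = UNIV"
  using sets_eq_imp_space_eq[OF sets_M] by simp

sublocale finite_measure M
  by standard (simp add: total[simplified])

lemma chartD:
  assumes "(U, \<phi>) \<in> \<A>"
  shows "open U" "openin (top_of_set quadrant) (\<phi> ` U)" "homeomorphism U (\<phi> ` U) \<phi> (inv_into U \<phi>)"
    "x \<in> U \<Longrightarrow> inv_into U \<phi> (\<phi> x) = x" "y \<in> \<phi> ` U \<Longrightarrow> inv_into U \<phi> y \<in> U"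
    "continuous_on U \<phi>"
proof -
  have "corner_chart (U, \<phi>)" using atlas assms by (auto simp: smooth_corner_atlas_def)
  then show "open U" "openin (top_of_set quadrant) (\<phi> ` U)" and h: "homeomorphism U (\<phi> ` U) \<phi> (inv_into U \<phi>)"
    by (auto simp: corner_chart_def)
  show "x \<in> U \<Longrightarrow> inv_into U \<phi> (\<phi> x) = x" using h by (auto simp: homeomorphism_def)
  show "y \<in> \<phi> ` U \<Longrightarrow> inv_into U \<phi> y \<in> U" by (rule inv_into_into)
  show "continuous_on U \<phi>" using h by (simp add: homeomorphism_def)
qed

lemma chart_exists: obtains U \<phi> where "(U, \<phi>) \<in> \<A>" "x \<in> U"
proof -
  have "x \<in> (\<Union>(U, \<phi>)\<in>\<A>. U)" using atlas by (simp add: smooth_corner_atlas_def)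
  then show ?thesis using that by auto
qed

text \<open>Every point of the quadrant is a limit of interior points, so a chart domain around a boundary
  point still contains a set that is open in the Euclidean space.\<close>

lemma chart_image_contains_open:
  assumes c: "(U, \<phi>) \<in> \<A>" and O: "open S" "x \<in> S" "x \<in> U"
  shows "\<exists>N. open N \<and> N \<noteq> {} \<and> N \<subseteq> \<phi> ` (S \<inter> U)"
proof -
  have "openin (top_of_set U) (S \<inter> U)" using O(1) by (metis inf_commute openin_open)
  then have "openin (top_of_set (\<phi> ` U)) (\<phi> ` (S \<inter> U))"
    by (rule homeomorphism_imp_open_map[OF chartD(3)[OF c]])
  then have "openin (top_of_set quadrant) (\<phi> ` (S \<inter> U))"
    using chartD(2)[OF c] openin_trans by blast
  then obtain T where T: "open T" "\<phi> ` (S \<inter> U) = quadrant \<inter> T" by (auto simp: openin_open)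
  have y: "\<phi> x \<in> quadrant" "\<phi> x \<in> T" using O T(2) by auto
  obtain \<epsilon> where \<epsilon>: "0 < \<epsilon>" "ball (\<phi> x) \<epsilon> \<subseteq> T" using T(1) y(2) openE by blast
  define N :: "'e set" where "N = T \<inter> (\<Inter>b\<in>Basis. {z. 0 < z \<bullet> b})"
  have "open N"
    unfolding N_def using T(1)
    by (intro open_Int open_INT finite_Basis ballI open_Collect_less continuous_intros) auto
  moreover have "N \<subseteq> \<phi> ` (S \<inter> U)"
    unfolding T(2) by (auto simp: N_def quadrant_def less_imp_le)
  moreover have "N \<noteq> {}"
  proof -
    define o1 :: 'e where "o1 = \<Sum>Basis"
    have o1: "o1 \<bullet> b = 1" if "b \<in> Basis" for b
      using that by (simp add: o1_def inner_sum_left inner_Basis if_distrib cong: if_cong)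
    define n where "n = norm o1 + 1"
    define \<delta> where "\<delta> = \<epsilon> / (2 * n)"
    have n1: "0 < n" by (simp add: n_def add_nonneg_pos)
    have \<delta>: "0 < \<delta>" using \<epsilon>(1) n1 by (simp add: \<delta>_def)
    have "norm (\<delta> *\<^sub>R o1) < \<epsilon>"
    proof -
      have "norm (\<delta> *\<^sub>R o1) \<le> \<delta> * n" using \<delta> by (simp add: n_def)
      also have "\<dots> = \<epsilon> / 2" using n1 by (simp add: \<delta>_def)
      finally show ?thesis using \<epsilon>(1) by simp
    qed
    then have "\<phi> x + \<delta> *\<^sub>R o1 \<in> ball (\<phi> x) \<epsilon>" by (simp add: dist_norm)
    moreover have "0 < (\<phi> x + \<delta> *\<^sub>R o1) \<bullet> b" if "b \<in> Basis" for b
      using y(1) \<delta> o1[OF that] that by (auto simp: quadrant_def inner_add_left intro: add_nonneg_pos)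
    ultimately have "\<phi> x + \<delta> *\<^sub>R o1 \<in> N" using \<epsilon>(2) by (auto simp: N_def)
    then show ?thesis by blast
  qed
  ultimately show ?thesis by blast
qed

lemma open_positive_measure:
  assumes S: "open S" "S \<noteq> {}"
  shows "0 < emeasure M S"
proof -
  obtain x where x: "x \<in> S" using S by blast
  obtain U \<phi> where c: "(U, \<phi>) \<in> \<A>" "x \<in> U" by (rule chart_exists)
  obtain N where N: "open N" "N \<noteq> {}" "N \<subseteq> \<phi> ` (S \<inter> U)"
    using chart_image_contains_open[OF c(1) S(1) x c(2)] by blast
  obtain \<rho> where \<rho>: "smooth_on \<rho> (\<phi> ` U)" "\<And>y. y \<in> \<phi> ` U \<Longrightarrow> 0 < \<rho> y"
    and em: "\<And>B. B \<in> sets borel \<Longrightarrow> B \<subseteq> U \<Longrightarrow>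
      emeasure M B = (\<integral>\<^sup>+y. ennreal (\<rho> y) * indicator (\<phi> ` B) y \<partial>lborel)"
    using density c(1) unfolding smooth_positive_density_def by fastforce
  have NU: "N \<subseteq> \<phi> ` U" using N(3) by blast
  have "emeasure M (S \<inter> U) \<noteq> 0"
  proof
    assume zero: "emeasure M (S \<inter> U) = 0"
    have "(\<integral>\<^sup>+y. ennreal (indicator N y *\<^sub>R \<rho> y) \<partial>lborel)
        \<le> (\<integral>\<^sup>+y. ennreal (\<rho> y) * indicator (\<phi> ` (S \<inter> U)) y \<partial>lborel)"
      using N(3) by (intro nn_integral_mono) (auto simp: indicator_def)
    also have "\<dots> = 0"
      using em[of "S \<inter> U"] zero chartD(1)[OF c(1)] S(1) by (simp add: open_Int borel_open)
    finally have "(\<integral>\<^sup>+y. ennreal (indicator N y *\<^sub>R \<rho> y) \<partial>lborel) = 0" by simp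
    moreover have "(\<lambda>y. indicator N y *\<^sub>R \<rho> y) \<in> borel_measurable borel"
      using N(1) continuous_on_subset[OF smooth_on_continuous[OF \<rho>(1)] NU]
      by (intro borel_measurable_continuous_on_indicator) auto
    ultimately have "AE y in lborel. ennreal (indicator N y *\<^sub>R \<rho> y) = 0"
      by (subst (asm) nn_integral_0_iff_AE) auto
    then have "AE y in lborel. y \<notin> N"
    proof eventually_elim
      fix y assume "ennreal (indicator N y *\<^sub>R \<rho> y) = 0"
      then show "y \<notin> N" using \<rho>(2)[of y] NU by (auto simp: indicator_def ennreal_eq_0_iff)
    qed
    then have "N \<in> null_sets lborel" using N(1) by (simp add: AE_iff_null_sets)
    then have "negligible N" by (simp add: negligible_iff_null_sets null_sets_completionI)
    then show False using open_not_negligible[OF N(1,2)] by blast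
  qed
  moreover have "emeasure M (S \<inter> U) \<le> emeasure M S"
    using S(1) by (intro emeasure_mono) auto
  ultimately show ?thesis by (metis bot.extremum_unique bot_ennreal not_gr_zero)
qed

text \<open>A manifold of positive dimension has two points, and these have disjoint neighbourhoods.\<close>

lemma disjoint_positive_sets:
  "\<exists>A B. A \<in> sets M \<and> B \<in> sets M \<and> A \<inter> B = {} \<and> 0 < emeasure M A \<and> 0 < emeasure M B"
proof -
  fix x :: 'm
  obtain U \<phi> where c: "(U, \<phi>) \<in> \<A>" "x \<in> U" by (rule chart_exists)
  obtain N where N: "open N" "N \<noteq> {}" "N \<subseteq> \<phi> ` (UNIV \<inter> U)"
    using chart_image_contains_open[OF c(1) open_UNIV UNIV_I c(2)] by blast
  have "infinite N" using N(1,2) finite_imp_not_open by blast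
  then have "infinite U" using N(3) finite_subset by auto
  then obtain y where "y \<in> U" "y \<noteq> x"
    by (metis finite.simps insertI1 subsetI finite_subset singletonI)
  then obtain A B where AB: "open A" "open B" "y \<in> A" "x \<in> B" "A \<inter> B = {}"
    using hausdorff[of y x] by blast
  then have "0 < emeasure M A" "0 < emeasure M B"
    by (auto intro: open_positive_measure)
  moreover have "A \<in> sets M" "B \<in> sets M" using \<open>open A\<close> \<open>open B\<close> by simp_all
  ultimately show ?thesis using AB(5) by blast
qed

lemma continuous_imp_L2:
  fixes f :: "'m \<Rightarrow> real"
  assumes "continuous_on UNIV f"
  shows "f \<in> L2_functions M"
proof (rule L2_functionsI)
  show meas: "f \<in> borel_measurable M"
    using borel_measurable_continuous_onI[OF assms] measurable_cong_sets[OF sets_M refl] by blast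
  have "bounded (range f)" by (rule compact_imp_bounded[OF compact_continuous_image[OF assms compact]])
  then obtain B where B: "\<And>x. \<bar>f x\<bar> \<le> B" unfolding bounded_iff by auto
  have "(f x)\<^sup>2 \<le> B\<^sup>2" for x using power_mono[OF B abs_ge_zero, of x 2] by simp
  then show "integrable M (\<lambda>x. (f x)\<^sup>2)"
    using meas by (intro integrable_const_bound[where B = "B\<^sup>2"]) auto
qed

lemma L2_norm_le_sup:
  assumes "f \<in> L2_functions M" "\<And>x. \<bar>f x\<bar> \<le> e"
  shows "L2_norm M f \<le> e"
proof (rule power2_le_imp_le)
  show "0 \<le> e" using assms(2) abs_ge_zero order_trans by blast
  have "(L2_norm M f)\<^sup>2 = (\<integral>x. (f x)\<^sup>2 \<partial>M)" by (rule L2_norm_power2_integral)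
  also have "\<dots> \<le> (\<integral>x. e\<^sup>2 \<partial>M)"
    using assms(1) power_mono[OF assms(2) abs_ge_zero, of _ 2]
    by (intro integral_mono) (auto simp: L2_functions_def)
  also have "\<dots> = e\<^sup>2" using total by (simp add: measure_def)
  finally show "(L2_norm M f)\<^sup>2 \<le> e\<^sup>2" .
qed

lemma continuous_AE_eq_imp_eq:
  fixes f h :: "'m \<Rightarrow> real"
  assumes "continuous_on UNIV f" "continuous_on UNIV h" "AE x in M. f x = h x"
  shows "f = h"
proof (rule ccontr)
  assume "f \<noteq> h"
  have op: "open {x. f x \<noteq> h x}" using assms(1,2) by (rule open_Collect_neq)
  then have "{x. f x \<noteq> h x} \<in> sets M" by simp
  moreover have "AE x in M. x \<notin> {x. f x \<noteq> h x}" using assms(3) by simp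
  ultimately have "emeasure M {x. f x \<noteq> h x} = 0" by (metis AE_iff_null_sets null_setsD1)
  then show False using open_positive_measure[OF op] \<open>f \<noteq> h\<close> by auto
qed

subsection \<open>Smooth functions and smooth curves\<close>

abbreviation "C_inf \<equiv> smooth_functions \<A>"

lemma smooth_functions_lincomb:
  assumes "f \<in> C_inf" "h \<in> C_inf"
  shows "(\<lambda>x. a * f x + b * h x) \<in> C_inf"
  using assms unfolding smooth_functions_def
  by (auto intro!: smooth_on_add smooth_on_mult smooth_on_const)

definition curve_velocity :: "(real \<Rightarrow> 'm \<Rightarrow> real) \<Rightarrow> real \<Rightarrow> 'm \<Rightarrow> real" where
  "curve_velocity c = (\<lambda>t x. deriv (\<lambda>\<tau>. c \<tau> x) t)"

lemma smooth_curve_chart: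
  assumes "smooth_curve \<A> I c" "(U, \<phi>) \<in> \<A>"
  shows "smooth_on (\<lambda>p. c (fst p) (inv_into U \<phi> (snd p))) (I \<times> \<phi> ` U)"
  using bspec[OF assms(1)[unfolded smooth_curve_def] assms(2)] by (simp add: case_prod_beta')

lemma smooth_curve_velocity:
  assumes c: "smooth_curve \<A> I c" and I: "open I"
  shows "smooth_curve \<A> I (curve_velocity c)"
    and "t \<in> I \<Longrightarrow> ((\<lambda>\<tau>. c \<tau> x) has_real_derivative curve_velocity c t x) (at t)"
proof -
  show "smooth_curve \<A> I (curve_velocity c)"
    unfolding smooth_curve_def
  proof clarify
    fix U \<phi> assume "(U, \<phi>) \<in> \<A>"
    from smooth_on_time_derivative(2)[OF smooth_curve_chart[OF c this] I]
    show "smooth_on (\<lambda>(t, y). curve_velocity c t (inv_into U \<phi> y)) (I \<times> \<phi> ` U)"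
      by (simp add: curve_velocity_def case_prod_beta')
  qed
  assume t: "t \<in> I"
  obtain U \<phi> where U: "(U, \<phi>) \<in> \<A>" "x \<in> U" by (rule chart_exists)
  from smooth_on_time_derivative(1)[OF smooth_curve_chart[OF c U(1)] I t, of "\<phi> x"] U
  show "((\<lambda>\<tau>. c \<tau> x) has_real_derivative curve_velocity c t x) (at t)"
    by (simp add: curve_velocity_def chartD(4)[OF U])
qed

lemma smooth_curve_slice:
  assumes c: "smooth_curve \<A> I c" and t: "t \<in> I"
  shows "c t \<in> C_inf"
  unfolding smooth_functions_def
proof clarify
  fix U \<phi> assume U: "(U, \<phi>) \<in> \<A>"
  have "bounded_linear (\<lambda>y::'e. (0::real, y))"
    by (intro bounded_linear_Pair bounded_linear_zero bounded_linear_ident)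
  from smooth_on_affine[OF smooth_curve_chart[OF c U] this, of "\<phi> ` U" "(t, 0)"] t
  show "smooth_on (\<lambda>y. c t (inv_into U \<phi> y)) (\<phi> ` U)" by simp
qed

lemma smooth_curve_continuous:
  assumes c: "smooth_curve \<A> I c" and I: "open I"
  shows "continuous_on (I \<times> UNIV) (\<lambda>p. c (fst p) (snd p))"
proof -
  have "\<exists>S. open S \<and> p \<in> S \<and> continuous_on S (\<lambda>p. c (fst p) (snd p))" if p: "p \<in> I \<times> UNIV" for p
  proof -
    obtain U \<phi> where U: "(U, \<phi>) \<in> \<A>" "snd p \<in> U" by (rule chart_exists)
    have "continuous_on (I \<times> U) (\<lambda>p. (fst p, \<phi> (snd p)))"
      by (intro continuous_intros continuous_on_compose2[OF chartD(6)[OF U(1)]]) auto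
    then have "continuous_on (I \<times> U) (\<lambda>p. c (fst (fst p, \<phi> (snd p))) (inv_into U \<phi> (snd (fst p, \<phi> (snd p)))))"
      by (rule continuous_on_compose2[OF smooth_on_continuous[OF smooth_curve_chart[OF c U(1)]]]) auto
    moreover have "c (fst (fst p, \<phi> (snd p))) (inv_into U \<phi> (snd (fst p, \<phi> (snd p)))) = c (fst p) (snd p)"
      if "p \<in> I \<times> U" for p
      using that chartD(4)[OF U(1), of "snd p"] by auto
    ultimately have "continuous_on (I \<times> U) (\<lambda>p. c (fst p) (snd p))"
      by (simp cong: continuous_on_cong)
    then show ?thesis using p U I chartD(1)[OF U(1)]
      by (intro exI[of _ "I \<times> U"]) (auto simp: open_Times mem_Times_iff)
  qed
  then show ?thesis
    by (intro continuous_at_imp_continuous_on ballI) (metis continuous_on_eq_continuous_at)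
qed

lemma smooth_curve_slice_continuous:
  assumes "smooth_curve \<A> I c" "open I" "t \<in> I"
  shows "continuous_on UNIV (c t)"
proof -
  have "continuous_on UNIV (\<lambda>x::'m. (t, x))" by (intro continuous_intros)
  from continuous_on_compose2[OF smooth_curve_continuous[OF assms(1,2)] this] show ?thesis
    using assms(3) by auto
qed

lemma smooth_function_continuous:
  assumes "f \<in> C_inf"
  shows "continuous_on UNIV f"
proof -
  have "continuous (at x) f" for x
  proof -
    obtain U \<phi> where U: "(U, \<phi>) \<in> \<A>" "x \<in> U" by (rule chart_exists)
    have "smooth_on (\<lambda>y. f (inv_into U \<phi> y)) (\<phi> ` U)"
      using assms U(1) by (auto simp: smooth_functions_def)
    then have "continuous_on U (\<lambda>x. f (inv_into U \<phi> (\<phi> x)))"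
      by (rule continuous_on_compose2[OF smooth_on_continuous chartD(6)[OF U(1)]]) auto
    then have "continuous_on U f" using chartD(4)[OF U(1)] by (simp cong: continuous_on_cong)
    then show ?thesis using U chartD(1)[OF U(1)] by (simp add: continuous_on_eq_continuous_at)
  qed
  then show ?thesis by (simp add: continuous_at_imp_continuous_on)
qed

text \<open>By compactness the velocity is continuous in time uniformly in space; with the mean value
  theorem, the difference quotients then converge uniformly, hence in \<open>L\<^sup>2\<close>.\<close>

lemma smooth_curve_L2_derivative:
  assumes c: "smooth_curve \<A> I c" and I: "open I" and t: "t \<in> I"
  shows "has_L2_derivative M c (curve_velocity c t) t I"
  unfolding has_L2_derivative_def Lim_within dist_real_def
proof (intro allI impI)
  fix e :: real assume e: "0 < e"
  note v = smooth_curve_velocity[OF c I]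
  have cL2: "c s \<in> L2_functions M" if "s \<in> I" for s
    by (rule continuous_imp_L2[OF smooth_curve_slice_continuous[OF c I that]])
  have vL2: "curve_velocity c t \<in> L2_functions M"
    by (rule continuous_imp_L2[OF smooth_curve_slice_continuous[OF v(1) I t]])
  have "0 < e / 2" using e by simp
  then obtain X0 where X0: "t \<in> X0" "open X0"
    "\<forall>s\<in>X0 \<inter> I. \<forall>x\<in>UNIV. dist (curve_velocity c s x) (curve_velocity c t x) \<le> e / 2"
    using continuous_on_prod_compactE[OF smooth_curve_continuous[OF v(1) I] compact t] by (metis fst_conv snd_conv)
  have "open (X0 \<inter> I)" "t \<in> X0 \<inter> I" using X0(1,2) I t by auto
  then obtain d where d: "0 < d" "ball t d \<subseteq> X0 \<inter> I" using openE by blast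
  have "L2_norm M (\<lambda>x. (c s x - c t x) / (s - t) - curve_velocity c t x) \<le> e / 2"
    if s: "s \<in> I" "s \<noteq> t" "\<bar>s - t\<bar> < d" for s
  proof (rule L2_norm_le_sup)
    show "(\<lambda>x. (c s x - c t x) / (s - t) - curve_velocity c t x) \<in> L2_functions M"
      using cL2 vL2 s(1) t by simp
    fix x
    have near: "\<tau> \<in> X0 \<inter> I" if "\<bar>\<tau> - t\<bar> \<le> \<bar>s - t\<bar>" for \<tau>
      using d(2) s(3) that by (auto simp: dist_real_def abs_minus_commute subset_iff)
    have "\<exists>\<tau>. \<bar>\<tau> - t\<bar> \<le> \<bar>s - t\<bar> \<and> (c s x - c t x) / (s - t) = curve_velocity c \<tau> x"
    proof (cases "t < s")
      case True
      have "\<exists>z>t. z < s \<and> c s x - c t x = (s - t) * curve_velocity c z x"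
        by (rule MVT2[OF True]) (use v(2) near in auto)
      then obtain z where "t < z" "z < s" "c s x - c t x = (s - t) * curve_velocity c z x" by blast
      then show ?thesis using True by (intro exI[of _ z]) simp
    next
      case False
      then have lt: "s < t" using s(2) by simp
      have "\<exists>z>s. z < t \<and> c t x - c s x = (t - s) * curve_velocity c z x"
        by (rule MVT2[OF lt]) (use v(2) near in auto)
      then obtain z where "s < z" "z < t" "c t x - c s x = (t - s) * curve_velocity c z x" by blast
      then show ?thesis using lt by (intro exI[of _ z]) (simp add: field_simps)
    qed
    then obtain \<tau> where "\<bar>\<tau> - t\<bar> \<le> \<bar>s - t\<bar>" "(c s x - c t x) / (s - t) = curve_velocity c \<tau> x" by blast
    then show "\<bar>(c s x - c t x) / (s - t) - curve_velocity c t x\<bar> \<le> e / 2"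
      using X0(3) near by (simp add: dist_real_def)
  qed
  then have "\<forall>s\<in>I. 0 < \<bar>s - t\<bar> \<and> \<bar>s - t\<bar> < d \<longrightarrow>
      \<bar>L2_norm M (\<lambda>x. (c s x - c t x) / (s - t) - curve_velocity c t x) - 0\<bar> < e"
    using e by fastforce
  then show "\<exists>d>0. \<forall>s\<in>I. 0 < \<bar>s - t\<bar> \<and> \<bar>s - t\<bar> < d \<longrightarrow>
      \<bar>L2_norm M (\<lambda>x. (c s x - c t x) / (s - t) - curve_velocity c t x) - 0\<bar> < e"
    using d(1) by blast
qed

lemma combination_smooth_curve:
  assumes X: "C_infty X UNIV" and Y: "C_infty Y UNIV" and a: "a \<in> C_inf" and e: "e \<in> C_inf"
  shows "smooth_curve \<A> UNIV (\<lambda>t x. X t * a x + Y t * e x)"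
  unfolding smooth_curve_def
proof clarify
  fix U \<phi> assume U: "(U, \<phi>) \<in> \<A>"
  have time: "smooth_on (\<lambda>p. Z (fst p)) (UNIV \<times> \<phi> ` U)" if "C_infty Z UNIV" for Z :: "real \<Rightarrow> real"
    using smooth_on_affine[OF _ bounded_linear_fst, of Z UNIV "UNIV \<times> \<phi> ` U" 0] that
    by (simp add: smooth_on_open_iff)
  have space: "smooth_on (\<lambda>p. f (inv_into U \<phi> (snd p))) (UNIV \<times> \<phi> ` U)" if "f \<in> C_inf" for f
  proof -
    have "smooth_on (\<lambda>y. f (inv_into U \<phi> y)) (\<phi> ` U)" using that U by (auto simp: smooth_functions_def)
    from smooth_on_affine[OF this bounded_linear_snd, of "UNIV \<times> \<phi> ` U" 0] show ?thesis
      by (simp add: mem_Times_iff)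
  qed
  show "smooth_on (\<lambda>(t, y). X t * a (inv_into U \<phi> y) + Y t * e (inv_into U \<phi> y)) (UNIV \<times> \<phi> ` U)"
    unfolding case_prod_beta' by (intro smooth_on_add smooth_on_mult time space X Y a e)
qed

end

locale corner_manifold_metric = compact_corner_manifold \<A> M + radial C1 C2
  for \<A> :: "('m::{t2_space,second_countable_topology}, 'e::euclidean_space) chart set" and M C1 C2
begin

sublocale L2_radial_connected M C1 C2
  by standard (rule disjoint_positive_sets)

sublocale smooth: geodesic_setting M C1 C2 C_inf
  by standard (auto intro: continuous_imp_L2 smooth_function_continuous smooth_functions_lincomb)

text \<open>Smooth curves are curves in \<open>L\<^sup>2\<close> with pointwise derivatives, so the geodesic equation, tested
  with smooth functions only, extends the geodesic almost everywhere; by continuity and full support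
  of the measure, the extension agrees with it at every point.\<close>

theorem smooth_geodesics_extend: "smooth_geodesically_complete \<A> G"
  unfolding smooth_geodesically_complete_def
proof (intro allI impI)
  fix I c assume asm: "open I \<and> is_interval I \<and> I \<noteq> {} \<and> smooth_geodesic \<A> G I c"
  then have I: "open I" "is_interval I" and c: "smooth_curve \<A> I c"
    and cT: "\<And>t. t \<in> I \<Longrightarrow> c t \<in> C_inf - {\<lambda>x. 0}"
    and geo: "\<And>t. t \<in> I \<Longrightarrow> geodesic_equation_at G C_inf c (curve_velocity c) t"
    by (auto simp: smooth_geodesic_def curve_velocity_def)
  obtain t0 where t0: "t0 \<in> I" using asm by blast
  define v where "v = curve_velocity c"
  have v: "smooth_curve \<A> I v" unfolding v_def by (rule smooth_curve_velocity(1)[OF c I(1)])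
  define u where "u = curve_velocity v"
  have u: "smooth_curve \<A> I u" unfolding u_def by (rule smooth_curve_velocity(1)[OF v I(1)])
  have "smooth.motion I c v u"
    unfolding smooth.motion_def
  proof (intro conjI ballI I)
    fix t assume t: "t \<in> I"
    show "c t \<in> C_inf" "v t \<in> C_inf" using cT[OF t] smooth_curve_slice[OF v t] by auto
    show "u t \<in> L2" by (rule continuous_imp_L2[OF smooth_curve_slice_continuous[OF u I(1) t]])
    show "has_L2_derivative M c (v t) t I" "has_L2_derivative M v (u t) t I"
      unfolding u_def using smooth_curve_L2_derivative[OF c I(1) t] smooth_curve_L2_derivative[OF v I(1) t]
      by (simp_all add: v_def)
    show "geodesic_equation_at G C_inf c v t" unfolding v_def by (rule geo[OF t])
    show "0 < nrm (c t)"
    proof -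
      have cont: "continuous_on UNIV (c t)" using smooth_function_continuous cT[OF t] by blast
      have "\<not> (AE x in M. c t x = 0)"
        using continuous_AE_eq_imp_eq[OF cont continuous_on_const, of 0] cT[OF t] by auto
      then show ?thesis
        using L2_norm_eq_0_iff[OF continuous_imp_L2[OF cont]] L2_norm_nonneg[of M "c t"] by linarith
    qed
  qed
  from smooth.motion_extends[OF this t0] obtain X Y a e where ae: "a \<in> C_inf" "e \<in> C_inf"
    and XY: "C_infty X UNIV" "C_infty Y UNIV"
    and mot: "smooth.motion UNIV (\<lambda>t x. X t * a x + Y t * e x) (\<lambda>t x. deriv X t * a x + deriv Y t * e x)
      (\<lambda>t x. deriv (deriv X) t * a x + deriv (deriv Y) t * e x)"
    and agree: "\<And>t. t \<in> I \<Longrightarrow> AE x in M. X t * a x + Y t * e x = c t x"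
    by blast
  define c' where "c' = (\<lambda>t x. X t * a x + Y t * e x)"
  have deriv_c': "(\<lambda>s x. deriv (\<lambda>\<tau>. c' \<tau> x) s) = (\<lambda>t x. deriv X t * a x + deriv Y t * e x)"
  proof (intro ext)
    fix s x
    have "((\<lambda>\<tau>. X \<tau> * a x + Y \<tau> * e x) has_real_derivative deriv X s * a x + deriv Y s * e x) (at s)"
      by (intro DERIV_add DERIV_cmult_right C_infty_deriv(1)[OF XY(1)] C_infty_deriv(1)[OF XY(2)]) auto
    then show "deriv (\<lambda>\<tau>. c' \<tau> x) s = deriv X s * a x + deriv Y s * e x"
      unfolding c'_def by (rule DERIV_imp_deriv)
  qed
  have "smooth_geodesic \<A> G UNIV c'"
    unfolding smooth_geodesic_def deriv_c'
  proof (intro conjI ballI)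
    fix t
    have "c' t \<in> C_inf" "0 < nrm (c' t)"
      using smooth.motionD(3,8)[OF mot UNIV_I, of t] by (simp_all add: c'_def)
    then show "c' t \<in> C_inf - {\<lambda>x. 0}" by auto
    show "smooth_curve \<A> UNIV c'" unfolding c'_def by (rule combination_smooth_curve[OF XY ae])
    show "geodesic_equation_at G C_inf c' (\<lambda>t x. deriv X t * a x + deriv Y t * e x) t"
      using smooth.motionD(11)[OF mot UNIV_I, of t] by (simp add: c'_def)
  qed
  moreover have "c' t = c t" if "t \<in> I" for t
  proof (rule continuous_AE_eq_imp_eq)
    show "continuous_on UNIV (c' t)" "continuous_on UNIV (c t)"
      using smooth_function_continuous cT[OF that] smooth.motionD(3)[OF mot UNIV_I, of t] by (auto simp: c'_def)
    show "AE x in M. c' t x = c t x" using agree[OF that] by (simp add: c'_def)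
  qed
  ultimately show "\<exists>c'. smooth_geodesic \<A> G UNIV c' \<and> (\<forall>t\<in>I. c' t = c t)" by blast
qed

end

theorem mainTheorem4:
  fixes \<A> :: "('m::{t2_space,second_countable_topology}, 'e::euclidean_space) chart set"
    and \<mu> :: "'m measure"
    and C1 C2 :: "real \<Rightarrow> real"
  assumes "compact (UNIV :: 'm set)"
    and "smooth_corner_atlas \<A>"
    and "smooth_positive_density \<A> \<mu>"
    and "emeasure \<mu> (space \<mu>) = 1"
    and "smooth_on C1 {0<..}"
    and "smooth_on C2 {0<..}"
    and "\<And>m. 0 < m \<Longrightarrow> 0 < C1 m"
    and "\<And>m. 0 < m \<Longrightarrow> - (1 / m) * C1 m < C2 m"
    and "filterlim (W C1 C2) at_bot (at_right 0)"
    and "filterlim (W C1 C2) at_top at_top"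
  shows "(Metric_space (L2_nonzero \<mu>) (geodesic_dist \<mu> (metric_G \<mu> C1 C2)) \<and>
          Metric_space.mcomplete (L2_nonzero \<mu>) (geodesic_dist \<mu> (metric_G \<mu> C1 C2))) \<and>
         L2_geodesically_complete \<mu> (metric_G \<mu> C1 C2) \<and>
         smooth_geodesically_complete \<A> (metric_G \<mu> C1 C2)"
proof -
  interpret corner_manifold_metric \<A> \<mu> C1 C2
    using assms by unfold_locales (auto simp: smooth_on_open_iff)
  show ?thesis
    using geodesic_dist_metric geodesic_dist_mcomplete L2_geodesics_extend smooth_geodesics_extend by blast
qed

end
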